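(* Let $G\curvearrowright T$ be an action by automorphisms of a countable group on a countable tree such that every infinite geodesic $\mathbf v$ in $T$ has a finite initial segment $\sigma$ such that $\mathrm{Stab}_G(\mathbf v)$ is uniformly coamenable in $\mathrm{Stab}_G(\sigma)$. Then the orbit equivalence relation $E_G^{\partial T}$ of the induced action on the boundary is Borel $2$-amenable, and in particular measure-hyperfinite.
   Context: A tree is a connected acyclic undirected simple graph. A geodesic is a finite or infinite injective sequence of vertices with consecutive terms adjacent. $\mathrm{Geo}(T)\subseteq V(T)^{\mathbb N}$ is the standard Borel space of infinite geodesics; $\mathbb N$ acts on it by the shift $(v_0,v_1,\dots)\mapsto(v_1,v_2,\dots)$, and $\partial T=\mathrm{Geo}(T)/\mathbb N$ (quotient by the equivalence relation generated by the shift). $G$ acts coordinatewise on geodesics, inducing a Borel action on $\partial T$. $\mathrm{Stab}_G(\sigma)=\{g: g\sigma=\sigma\}$ (pointwise). $\mathrm{Prob}(A)$ is the set of nonnegative $p\in\ell^1(A)$ with $\|p\|_1=1$; for an action $H\curvearrowright Y$, $p\in\mathrm{Prob}(H)$, $y\in Y$, $py$ is the pushforward of $p$ under $h\mapsto hy$. A subgroup $K\le H$ is uniformly coamenable if for every finite $S\subseteq H$ and $\varepsilon>0$ there is $p\in\mathrm{Prob}(H)$ with $\|py-psy\|_1<\varepsilon$ for all $s\in S$ and all $y\in H/K$. A CBER $E$ on $X$ is Borel $2$-amenable if there are $(p_{i,j})_{i,j\in\mathbb N}$, each assigning to $x\in X$ some $p^x_{i,j}\in\mathrm{Prob}([x]_E)$,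 such that for all $(x,y)\in E$ and $\varepsilon>0$, for all but finitely many $i$, for all but finitely many $j$, $\|p^x_{i,j}-p^y_{i,j}\|_1<\varepsilon$, and each map $(x,y)\mapsto p^x_{i,j}(\{y\})$ on $E$ is Borel. $E$ is measure-hyperfinite if for every Borel probability measure $\mu$ on $X$ there is a $\mu$-conull Borel $X'$ with $E\upharpoonright X'$ Borel hyperfinite (an increasing union of CBERs with finite classes). *)

theory Defs
  imports "HOL-Probability.Probability" "HOL-Algebra.Coset"
begin

definition is_tree :: "('v \<Rightarrow> 'v \<Rightarrow> bool) \<Rightarrow> bool" where
  "is_tree adj \<longleftrightarrow> symp adj \<and> irreflp adj \<and> (\<forall>u w. adj\<^sup>*\<^sup>* u w) \<and>
     \<not> (\<exists>xs. length xs \<ge> 3 \<and> distinct xs \<and>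
            (\<forall>i. Suc i < length xs \<longrightarrow> adj (xs ! i) (xs ! Suc i)) \<and>
            adj (last xs) (hd xs))"

definition tree_aut_action ::
  "('g, 'b) monoid_scheme \<Rightarrow> ('v \<Rightarrow> 'v \<Rightarrow> bool) \<Rightarrow> ('g \<Rightarrow> 'v \<Rightarrow> 'v) \<Rightarrow> bool" where
  "tree_aut_action G adj act \<longleftrightarrow>
     (\<forall>g\<in>carrier G. bij (act g) \<and> (\<forall>u w. adj (act g u) (act g w) \<longleftrightarrow> adj u w)) \<and>
     act \<one>\<^bsub>G\<^esub> = id \<and>
     (\<forall>g\<in>carrier G. \<forall>h\<in>carrier G. act (g \<otimes>\<^bsub>G\<^esub> h) = act g \<circ> act h)"

definition inf_geodesic :: "('v \<Rightarrow> 'v \<Rightarrow> bool) \<Rightarrow> (nat \<Rightarrow> 'v) \<Rightarrow> bool" where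
  "inf_geodesic adj v \<longleftrightarrow> inj v \<and> (\<forall>n. adj (v n) (v (Suc n)))"

definition Geo :: "('v \<Rightarrow> 'v \<Rightarrow> bool) \<Rightarrow> (nat \<Rightarrow> 'v) set" where
  "Geo adj = {v. inf_geodesic adj v}"

definition GeoM :: "('v \<Rightarrow> 'v \<Rightarrow> bool) \<Rightarrow> (nat \<Rightarrow> 'v) measure" where
  "GeoM adj = restrict_space (Pi\<^sub>M UNIV (\<lambda>_::nat. count_space (UNIV :: 'v set))) (Geo adj)"

text \<open>The equivalence relation on Geo(T) generated by the shift.\<close>

definition shift_rel :: "('v \<Rightarrow> 'v \<Rightarrow> bool) \<Rightarrow> ((nat \<Rightarrow> 'v) \<times> (nat \<Rightarrow> 'v)) set" where
  "shift_rel adj = {(v, w). v \<in> Geo adj \<and> w \<in> Geo adj \<and>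
                    (\<exists>m n. (\<lambda>k. v (k + m)) = (\<lambda>k. w (k + n)))}"

definition boundary :: "('v \<Rightarrow> 'v \<Rightarrow> bool) \<Rightarrow> (nat \<Rightarrow> 'v) set set" where
  "boundary adj = Geo adj // shift_rel adj"

definition boundaryM :: "('v \<Rightarrow> 'v \<Rightarrow> bool) \<Rightarrow> (nat \<Rightarrow> 'v) set measure" where
  "boundaryM adj = measure_of (boundary adj)
      {A. A \<subseteq> boundary adj \<and> \<Union>A \<in> sets (GeoM adj)} (\<lambda>_. 0)"

definition bdry_act :: "('g \<Rightarrow> 'v \<Rightarrow> 'v) \<Rightarrow> 'g \<Rightarrow> (nat \<Rightarrow> 'v) set \<Rightarrow> (nat \<Rightarrow> 'v) set" where
  "bdry_act act g \<xi> = (\<lambda>v. act g \<circ> v) ` \<xi>"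

definition orbit_rel_bdry ::
  "('g, 'b) monoid_scheme \<Rightarrow> ('v \<Rightarrow> 'v \<Rightarrow> bool) \<Rightarrow> ('g \<Rightarrow> 'v \<Rightarrow> 'v)
     \<Rightarrow> ((nat \<Rightarrow> 'v) set \<times> (nat \<Rightarrow> 'v) set) set" where
  "orbit_rel_bdry G adj act = {(\<xi>, \<eta>). \<xi> \<in> boundary adj \<and> \<eta> \<in> boundary adj \<and>
                                 (\<exists>g\<in>carrier G. bdry_act act g \<xi> = \<eta>)}"

definition stab_geo :: "('g, 'b) monoid_scheme \<Rightarrow> ('g \<Rightarrow> 'v \<Rightarrow> 'v) \<Rightarrow> (nat \<Rightarrow> 'v) \<Rightarrow> 'g set" where
  "stab_geo G act v = {g \<in> carrier G. \<forall>k. act g (v k) = v k}"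

definition stab_seg :: "('g, 'b) monoid_scheme \<Rightarrow> ('g \<Rightarrow> 'v \<Rightarrow> 'v) \<Rightarrow> nat \<Rightarrow> (nat \<Rightarrow> 'v) \<Rightarrow> 'g set" where
  "stab_seg G act n v = {g \<in> carrier G. \<forall>k\<le>n. act g (v k) = v k}"

definition is_prob :: "'a set \<Rightarrow> ('a \<Rightarrow> real) \<Rightarrow> bool" where
  "is_prob A p \<longleftrightarrow> (\<forall>x. 0 \<le> p x) \<and> (\<forall>x. x \<notin> A \<longrightarrow> p x = 0) \<and> (p has_sum 1) A"

definition l1dist :: "('a \<Rightarrow> real) \<Rightarrow> ('a \<Rightarrow> real) \<Rightarrow> real" where
  "l1dist f g = (\<Sum>\<^sub>\<infinity>z. \<bar>f z - g z\<bar>)"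

text \<open>Pushforward of p \<in> Prob(H) under h \<mapsto> h y, for y a left coset (H acting by left
multiplication on H/K).\<close>

definition coset_push :: "('g, 'b) monoid_scheme \<Rightarrow> 'g set \<Rightarrow> ('g \<Rightarrow> real) \<Rightarrow> 'g set \<Rightarrow> 'g set \<Rightarrow> real" where
  "coset_push G H p y z = (\<Sum>\<^sub>\<infinity>h\<in>{h \<in> H. h <#\<^bsub>G\<^esub> y = z}. p h)"

definition left_cosets_in :: "('g, 'b) monoid_scheme \<Rightarrow> 'g set \<Rightarrow> 'g set \<Rightarrow> 'g set set" where
  "left_cosets_in G H K = {h <#\<^bsub>G\<^esub> K | h. h \<in> H}"

definition unif_coamenable :: "('g, 'b) monoid_scheme \<Rightarrow> 'g set \<Rightarrow> 'g set \<Rightarrow> bool" where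
  "unif_coamenable G H K \<longleftrightarrow>
     (\<forall>S \<epsilon>. finite S \<longrightarrow> S \<subseteq> H \<longrightarrow> \<epsilon> > 0 \<longrightarrow>
        (\<exists>p. is_prob H p \<and>
             (\<forall>s\<in>S. \<forall>y\<in>left_cosets_in G H K.
                l1dist (coset_push G H p y) (coset_push G H p (s <#\<^bsub>G\<^esub> y)) < \<epsilon>)))"

definition borel_2_amenable :: "'x measure \<Rightarrow> ('x \<times> 'x) set \<Rightarrow> bool" where
  "borel_2_amenable M E \<longleftrightarrow>
     (\<exists>p :: nat \<Rightarrow> nat \<Rightarrow> 'x \<Rightarrow> 'x \<Rightarrow> real.
        (\<forall>i j. \<forall>x\<in>space M. is_prob (E `` {x}) (p i j x)) \<and>
        (\<forall>(x, y)\<in>E. \<forall>\<epsilon>>0. \<forall>\<^sub>F i in sequentially. \<forall>\<^sub>F j in sequentially.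
              l1dist (p i j x) (p i j y) < \<epsilon>) \<and>
        (\<forall>i j. (\<lambda>(x, y). p i j x y) \<in> borel_measurable (restrict_space (M \<Otimes>\<^sub>M M) E)))"

definition borel_hyperfinite_on :: "'x measure \<Rightarrow> 'x set \<Rightarrow> ('x \<times> 'x) set \<Rightarrow> bool" where
  "borel_hyperfinite_on M X' E \<longleftrightarrow>
     (\<exists>F :: nat \<Rightarrow> ('x \<times> 'x) set.
        (\<forall>n. F n \<in> sets (M \<Otimes>\<^sub>M M) \<and> equiv X' (F n) \<and>
             (\<forall>x\<in>X'. finite (F n `` {x})) \<and> F n \<subseteq> F (Suc n)) \<and>
        (\<Union>n. F n) = E \<inter> (X' \<times> X'))"

definition measure_hyperfinite :: "'x measure \<Rightarrow> ('x \<times> 'x) set \<Rightarrow> bool" where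
  "measure_hyperfinite M E \<longleftrightarrow>
     (\<forall>\<mu>. prob_space \<mu> \<and> sets \<mu> = sets M \<longrightarrow>
        (\<exists>X'. X' \<in> sets M \<and> emeasure \<mu> (space M - X') = 0 \<and> borel_hyperfinite_on M X' E))"

end

theory Submission
  imports Defs
begin

text \<open>
  For a geodesic v take the least l such that the stabiliser of v is uniformly coamenable in the
  stabiliser of its initial segment of length l, and move v by a group element taking this segment to
  a chosen representative of its orbit. The result is well defined up to the stabiliser of the
  representative, so applying to it an almost invariant finite list of stabiliser elements gives a
  probability measure on the orbit of v that is almost independent of the choices; the list can be
  taken to be the first good one in an enumeration, because goodness is a Borel condition that only
  depends on the stabiliser orbit. Averaging over the shifts of the ray of a boundary point from a
  fixed root makes the construction asymptotically insensitive to shifts, and the two limits (shifts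
  first, then almost invariance) are the two indices of Borel 2-amenability.

  For measure-hyperfiniteness, use common randomness to let every x select a point f x distributed
  according to its measure: throw random darts at the space of points and heights, and let x select
  the first dart below the graph of its measure. Points with nearby measures select the same point with
  high probability, and iterated use of Fatou's lemma fixes one outcome that is good for most x. The
  fibres of f, truncated to finite sets, form a finite subrelation containing most of any finitely
  many generators; intersecting tails of a sequence of such relations gives, by Borel-Cantelli, an
  increasing sequence that exhausts the relation almost everywhere.
\<close>

section \<open>The l1 distance and uniform distributions on lists\<close>

text \<open>The group need not fix the root, so the ray of a translated end differs from the
  translated ray by an initial piece, and the level and the list chosen along a geodesic depend on
  where it starts. Averaging over \<open>i + 1\<close> shifts leaves an error of order
  \<open>1 / i\<close>, but each term of the average becomes small in \<open>j\<close> at a rate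
  depending on the term. Hence \<open>i\<close> has to be fixed before \<open>j\<close>, which is
  what the two indices allow. Uniformity over all cosets matters because the point of the stabiliser
  orbit reached from a geodesic depends on arbitrary choices, while one list must serve the whole
  orbit. Finite lists with repetition replace probability vectors so that there are only countably
  many candidates. For measure-hyperfiniteness the darts are discretised by a height scale
  \<open>m\<close>, a number \<open>N\<close> of separating sets and a number \<open>K\<close> of
  throws. All probabilities are then proportions of finite sets of lists, at the price of three
  further limits.\<close>

lemma is_prob_has_sum_UNIV:
  assumes "is_prob A p"
  shows "(p has_sum 1) UNIV"
proof -
  have "(p has_sum 1) A \<longleftrightarrow> (p has_sum 1) UNIV"
    by (rule has_sum_cong_neutral) (use assms in \<open>auto simp: is_prob_def\<close>)
  then show ?thesis using assms by (auto simp: is_prob_def)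
qed

lemma is_prob_summable: "is_prob A p \<Longrightarrow> p summable_on UNIV"
  using is_prob_has_sum_UNIV has_sum_imp_summable by blast

lemma is_prob_nonneg: "is_prob A p \<Longrightarrow> 0 \<le> p x"
  by (simp add: is_prob_def)

lemma is_prob_sum_le_1:
  assumes "is_prob A p" "finite F"
  shows "sum p F \<le> 1"
proof -
  have "sum p F \<le> infsum p UNIV"
    by (rule finite_sum_le_infsum)
       (use assms is_prob_summable is_prob_nonneg in \<open>auto simp: is_prob_nonneg\<close>)
  then show ?thesis using is_prob_has_sum_UNIV[OF assms(1)] by (simp add: infsumI)
qed

lemma is_prob_le_1: "is_prob A p \<Longrightarrow> p x \<le> 1"
  using is_prob_sum_le_1[of A p "{x}"] by simp

lemma is_prob_finite_carrier:
  assumes "is_prob A p" "e > 0"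
  obtains F where "finite F" "F \<subseteq> A" "sum p F > 1 - e"
proof -
  have "(sum p \<longlongrightarrow> 1) (finite_subsets_at_top A)"
    using assms(1) by (simp add: is_prob_def has_sum_def)
  then have "eventually (\<lambda>F. sum p F > 1 - e) (finite_subsets_at_top A)"
    using assms(2) by (intro order_tendstoD) auto
  then show thesis using that by (auto simp: eventually_finite_subsets_at_top)
qed

lemma has_sum_diff_real:
  fixes f g :: "'a \<Rightarrow> real"
  assumes "(f has_sum a) A" "(g has_sum b) A"
  shows "((\<lambda>z. f z - g z) has_sum (a - b)) A"
  using has_sum_add[OF assms(1) has_sum_uminusI[OF assms(2)]] by simp

lemma summable_on_diff_real:
  fixes f g :: "'a \<Rightarrow> real"
  assumes "f summable_on A" "g summable_on A"
  shows "(\<lambda>z. f z - g z) summable_on A"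
  using has_sum_diff_real assms by (metis summable_on_def)

lemma infsum_diff_real:
  fixes f g :: "'a \<Rightarrow> real"
  assumes "f summable_on A" "g summable_on A"
  shows "(\<Sum>\<^sub>\<infinity>z\<in>A. f z - g z) = infsum f A - infsum g A"
  using assms by (intro infsumI has_sum_diff_real has_sum_infsum)

lemma has_sum_sum_real:
  fixes f :: "'i \<Rightarrow> 'a \<Rightarrow> real"
  assumes "finite I" "\<And>i. i \<in> I \<Longrightarrow> (f i has_sum s i) A"
  shows "((\<lambda>z. \<Sum>i\<in>I. f i z) has_sum (\<Sum>i\<in>I. s i)) A"
  using assms
proof induction
  case (insert i I)
  then show ?case using has_sum_add[of "f i" A "s i" "\<lambda>z. \<Sum>i\<in>I. f i z"] by simp
qed simp

lemma summable_on_sum_real: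
  fixes f :: "'i \<Rightarrow> 'a \<Rightarrow> real"
  assumes "finite I" "\<And>i. i \<in> I \<Longrightarrow> f i summable_on A"
  shows "(\<lambda>z. \<Sum>i\<in>I. f i z) summable_on A"
  using has_sum_sum_real[OF assms(1) has_sum_infsum[OF assms(2)]] by (rule has_sum_imp_summable)

lemma summable_on_abs_diff:
  fixes f g :: "'a \<Rightarrow> real"
  assumes "f summable_on A" "g summable_on A"
  shows "(\<lambda>z. \<bar>f z - g z\<bar>) summable_on A"
proof -
  have "(\<lambda>z. f z - g z) summable_on A" using assms by (rule summable_on_diff_real)
  then show ?thesis
    using summable_on_iff_abs_summable_on_real[of "\<lambda>z. f z - g z" A] by simp
qed

lemma l1dist_commute: "l1dist f g = l1dist g f"
  by (simp add: l1dist_def abs_minus_commute)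

lemma l1dist_triangle:
  assumes "f summable_on UNIV" "g summable_on UNIV" "h summable_on UNIV"
  shows "l1dist f h \<le> l1dist f g + l1dist g h"
proof -
  have "l1dist f h \<le> (\<Sum>\<^sub>\<infinity>z. \<bar>f z - g z\<bar> + \<bar>g z - h z\<bar>)"
    unfolding l1dist_def
    by (intro infsum_mono summable_on_abs_diff summable_on_add assms) auto
  also have "\<dots> = l1dist f g + l1dist g h"
    unfolding l1dist_def by (intro infsum_add summable_on_abs_diff assms)
  finally show ?thesis .
qed

lemma l1dist_le_2:
  assumes "is_prob A p" "is_prob B q"
  shows "l1dist p q \<le> 2"
proof -
  have s: "p summable_on UNIV" "q summable_on UNIV" using assms is_prob_summable by auto
  have "l1dist p q \<le> (\<Sum>\<^sub>\<infinity>z. p z + q z)"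
    unfolding l1dist_def
    by (intro infsum_mono summable_on_abs_diff summable_on_add s)
       (smt (verit) assms is_prob_nonneg)
  also have "\<dots> = infsum p UNIV + infsum q UNIV" by (intro infsum_add s)
  also have "\<dots> = 2" using assms[THEN is_prob_has_sum_UNIV] by (simp add: infsumI)
  finally show ?thesis .
qed

lemma l1dist_sum_le:
  assumes "finite I" "\<And>i. i \<in> I \<Longrightarrow> f i summable_on UNIV" "\<And>i. i \<in> I \<Longrightarrow> g i summable_on UNIV"
  shows "l1dist (\<lambda>z. \<Sum>i\<in>I. f i z) (\<lambda>z. \<Sum>i\<in>I. g i z) \<le> (\<Sum>i\<in>I. l1dist (f i) (g i))"
proof -
  have "l1dist (\<lambda>z. \<Sum>i\<in>I. f i z) (\<lambda>z. \<Sum>i\<in>I. g i z) \<le> (\<Sum>\<^sub>\<infinity>z. \<Sum>i\<in>I. \<bar>f i z - g i z\<bar>)"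
    unfolding l1dist_def
    by (intro infsum_mono summable_on_abs_diff summable_on_sum_real assms)
       (auto simp flip: sum_subtractf)
  also have "\<dots> = (\<Sum>i\<in>I. l1dist (f i) (g i))"
    unfolding l1dist_def by (intro infsumI has_sum_sum_real has_sum_infsum summable_on_abs_diff assms)
  finally show ?thesis .
qed

lemma l1dist_scale:
  "c \<ge> 0 \<Longrightarrow> l1dist (\<lambda>z. c * f z) (\<lambda>z. c * g z) = c * l1dist f g"
  unfolding l1dist_def right_diff_distrib[symmetric]
  by (simp add: abs_mult infsum_cmult_right')

section \<open>Push-forwards and the contraction of the l1 distance\<close>

definition push :: "('a \<Rightarrow> 'b) \<Rightarrow> 'a set \<Rightarrow> ('a \<Rightarrow> real) \<Rightarrow> 'b \<Rightarrow> real" where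
  "push \<phi> A f z = (\<Sum>\<^sub>\<infinity>a\<in>{a \<in> A. \<phi> a = z}. f a)"

text \<open>Pairs (z, a) with \<phi> a = z correspond to A by the second projection, so the sum over
  A can be regrouped into an outer sum over B of inner sums over fibres.\<close>

lemma push_has_sum:
  assumes f: "f summable_on A" and "\<phi> ` A \<subseteq> B"
  shows "(push \<phi> A f has_sum infsum f A) B"
proof -
  let ?S = "SIGMA z:B. {a \<in> A. \<phi> a = z}"
  have bij: "bij_betw snd ?S A"
    using assms(2) by (auto simp: bij_betw_def inj_on_def image_iff)
  have "((\<lambda>x. f (snd x)) has_sum infsum f A) ?S"
    using has_sum_infsum[OF f] by (subst has_sum_reindex_bij_betw[OF bij])
  then show ?thesis
  proof (rule has_sum_SigmaD)
    fix z
    have "f summable_on {a \<in> A. \<phi> a = z}"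
      by (rule summable_on_subset_banach[OF f]) auto
    then show "((\<lambda>y. f (snd (z, y))) has_sum push \<phi> A f z) {a \<in> A. \<phi> a = z}"
      unfolding push_def by simp
  qed
qed

lemma push_summable: "f summable_on A \<Longrightarrow> push \<phi> A f summable_on UNIV"
  using push_has_sum[of f A \<phi> UNIV] has_sum_imp_summable by auto

text \<open>Only the mass on \<open>?A\<close> reaches w, and over \<open>?B\<close> the push of
  that restricted mass agrees with the push of all of f. Preservation of total mass then gives the
  value.\<close>

lemma push_push:
  assumes f: "f summable_on A"
  shows "push \<psi> UNIV (push \<phi> A f) w = push (\<lambda>a. \<psi> (\<phi> a)) A f w"
proof -
  let ?A = "{a \<in> A. \<psi> (\<phi> a) = w}" and ?B = "{z. \<psi> z = w}"
  have "f summable_on ?A" by (rule summable_on_subset_banach[OF f]) auto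
  then have "(push \<phi> ?A f has_sum infsum f ?A) ?B" by (rule push_has_sum) auto
  moreover have "(push \<phi> ?A f has_sum infsum f ?A) ?B \<longleftrightarrow> (push \<phi> A f has_sum infsum f ?A) ?B"
  proof (rule has_sum_cong)
    fix z assume "z \<in> ?B"
    then have "{a \<in> ?A. \<phi> a = z} = {a \<in> A. \<phi> a = z}" by auto
    then show "push \<phi> ?A f z = push \<phi> A f z" by (simp add: push_def)
  qed
  ultimately have "infsum (push \<phi> A f) ?B = infsum f ?A" by (auto intro: infsumI)
  then show ?thesis by (simp add: push_def[of \<psi>] push_def[of "\<lambda>a. \<psi> (\<phi> a)"])
qed

text \<open>Triangle inequality inside each fibre: cancellation there can only lower the distance.
  The right-hand side sums over A because f and g are not assumed to vanish outside it.\<close>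

lemma l1dist_push_le:
  assumes f: "f summable_on A" and g: "g summable_on A"
  shows "l1dist (push \<phi> A f) (push \<phi> A g) \<le> (\<Sum>\<^sub>\<infinity>a\<in>A. \<bar>f a - g a\<bar>)"
proof -
  let ?h = "\<lambda>a. \<bar>f a - g a\<bar>"
  have h: "?h summable_on A" using f g by (rule summable_on_abs_diff)
  have "l1dist (push \<phi> A f) (push \<phi> A g) \<le> (\<Sum>\<^sub>\<infinity>z. push \<phi> A ?h z)"
    unfolding l1dist_def
  proof (intro infsum_mono summable_on_abs_diff push_summable f g h)
    fix z
    let ?A = "{a \<in> A. \<phi> a = z}"
    have s: "f summable_on ?A" "g summable_on ?A" "?h summable_on ?A"
      using summable_on_subset_banach[OF f, of ?A] summable_on_subset_banach[OF g, of ?A]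
        summable_on_subset_banach[OF h, of ?A] by auto
    have "push \<phi> A f z - push \<phi> A g z = (\<Sum>\<^sub>\<infinity>a\<in>?A. f a - g a)"
      unfolding push_def by (rule infsum_diff_real[symmetric]) (use s in auto)
    also have "\<bar>\<dots>\<bar> \<le> push \<phi> A ?h z"
      unfolding push_def using norm_infsum_bound[of "\<lambda>a. f a - g a" ?A] s by simp
    finally show "\<bar>push \<phi> A f z - push \<phi> A g z\<bar> \<le> push \<phi> A ?h z" by simp
  qed
  also have "\<dots> = infsum ?h A"
    using push_has_sum[OF h, of \<phi> UNIV] by (simp add: infsumI)
  finally show ?thesis .
qed

lemma l1dist_push_UNIV_le:
  "f summable_on UNIV \<Longrightarrow> g summable_on UNIV \<Longrightarrow> l1dist (push \<phi> UNIV f) (push \<phi> UNIV g) \<le> l1dist f g"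
  unfolding l1dist_def[of f g] by (rule l1dist_push_le)

text \<open>Repetitions count, so lists realise all finitely supported rational weights. The empty
  list gives the zero function, which is why nonemptiness is demanded wherever a probability is
  needed.\<close>

definition emp :: "'a list \<Rightarrow> 'a \<Rightarrow> real" where
  "emp xs z = real (count_list xs z) / real (length xs)"

lemma emp_eq_0: "z \<notin> set xs \<Longrightarrow> emp xs z = 0"
  by (simp add: emp_def count_list_0_iff)

lemma is_prob_emp:
  assumes "xs \<noteq> []" "set xs \<subseteq> A"
  shows "is_prob A (emp xs)"
proof -
  have "(emp xs has_sum (\<Sum>z\<in>set xs. emp xs z)) (set xs)" by (rule has_sum_finite) simp
  also have "(\<Sum>z\<in>set xs. emp xs z) = real (\<Sum>z\<in>set xs. count_list xs z) / real (length xs)"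
    by (simp add: emp_def sum_divide_distrib)
  also have "\<dots> = 1" using assms by (simp add: sum_count_set)
  finally have "(emp xs has_sum 1) (set xs)" .
  moreover have "(emp xs has_sum 1) (set xs) \<longleftrightarrow> (emp xs has_sum 1) A"
    by (rule has_sum_cong_neutral) (use assms in \<open>auto simp: emp_eq_0\<close>)
  moreover have "emp xs x = 0" if "x \<notin> A" for x using that assms by (intro emp_eq_0) auto
  ultimately show ?thesis by (auto simp: is_prob_def) (simp add: emp_def)
qed

lemma emp_summable: "emp xs summable_on A"
proof -
  have "emp xs summable_on (A \<inter> set xs)" by simp
  moreover have "emp xs summable_on (A \<inter> set xs) \<longleftrightarrow> emp xs summable_on A"
    by (rule summable_on_cong_neutral) (auto simp: emp_eq_0)
  ultimately show ?thesis by blast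
qed

lemma count_list_map_eq:
  "count_list (map \<phi> xs) z = (\<Sum>a\<in>{a \<in> set xs. \<phi> a = z}. count_list xs a)"
proof -
  have "count_list (map \<phi> xs) z = length (filter (\<lambda>a. \<phi> a = z) xs)"
    by (induction xs) auto
  also have "\<dots> = (\<Sum>a\<in>set (filter (\<lambda>a. \<phi> a = z) xs). count_list (filter (\<lambda>a. \<phi> a = z) xs) a)"
    by (rule sum_count_set[symmetric]) auto
  also have "\<dots> = (\<Sum>a\<in>{a \<in> set xs. \<phi> a = z}. count_list xs a)"
  proof (rule sum.cong)
    fix a assume "a \<in> {a \<in> set xs. \<phi> a = z}"
    then have "\<phi> a = z" by simp
    then show "count_list (filter (\<lambda>a. \<phi> a = z) xs) a = count_list xs a"
      by (induction xs) auto
  qed auto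
  finally show ?thesis .
qed

lemma emp_map:
  assumes "set xs \<subseteq> A"
  shows "emp (map \<phi> xs) = push \<phi> A (emp xs)"
proof
  fix z
  have "push \<phi> A (emp xs) z = infsum (emp xs) {a \<in> set xs. \<phi> a = z}"
    unfolding push_def by (rule infsum_cong_neutral) (use assms in \<open>auto simp: emp_eq_0\<close>)
  also have "\<dots> = (\<Sum>a\<in>{a \<in> set xs. \<phi> a = z}. emp xs a)" by (rule infsum_finite) simp
  also have "\<dots> = emp (map \<phi> xs) z"
    by (simp add: emp_def count_list_map_eq sum_divide_distrib)
  finally show "emp (map \<phi> xs) z = push \<phi> A (emp xs) z" by simp
qed

lemma l1dist_emp_map_le: "l1dist (emp (map \<phi> xs)) (emp (map \<phi> ys)) \<le> l1dist (emp xs) (emp ys)"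
proof -
  have "emp (map \<phi> xs) = push \<phi> UNIV (emp xs)" for xs by (rule emp_map) simp
  then show ?thesis
    using l1dist_push_UNIV_le[OF emp_summable[of xs UNIV] emp_summable[of ys UNIV], of \<phi>] by simp
qed

lemma ex_list_count:
  assumes "finite F"
  shows "\<exists>xs. set xs \<subseteq> F \<and> (\<forall>z. count_list xs z = (if z \<in> F then \<alpha> z else 0))"
  using assms
proof induction
  case empty
  show ?case by (intro exI[of _ "[]"]) auto
next
  case (insert x F)
  from insert.IH obtain xs where
    xs: "set xs \<subseteq> F" "\<forall>z. count_list xs z = (if z \<in> F then \<alpha> z else 0)" by blast
  have r: "count_list (replicate n x) z = (if z = x then n else 0)" for n z
    by (induction n) auto
  have "count_list (replicate (\<alpha> x) x @ xs) z = (if z \<in> insert x F then \<alpha> z else 0)" for z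
    unfolding count_list_append r using xs(2)[rule_format, of z] insert.hyps(2) by auto
  moreover have "set (replicate (\<alpha> x) x @ xs) \<subseteq> insert x F" using xs(1) by auto
  ultimately show ?case by blast
qed

text \<open>Rounding down: after scaling by a large M, the weights on a finite set F of nearly full
  mass are replaced by their integer parts, and the list repeats each point that often.\<close>

lemma is_prob_approx_emp:
  assumes p: "is_prob A p" and "\<delta> > 0"
  obtains xs where "xs \<noteq> []" "set xs \<subseteq> A" "l1dist p (emp xs) < \<delta>"
proof -
  \<comment> \<open>Each of the two errors below equals \<open>1 - T / real M\<close>, which is less
    than e. So e \<le> \<delta> / 4 leaves room, and e \<le> 1/2 forces T to be positive.\<close>
  define e where "e = min (1/2) (\<delta> / 4)"
  have e: "e > 0" "e \<le> 1/2" "e \<le> \<delta> / 4" using assms(2) by (auto simp: e_def)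
  obtain F where F: "finite F" "F \<subseteq> A" "sum p F > 1 - e / 2"
    using is_prob_finite_carrier[OF p, of "e / 2"] e by auto
  obtain M where M: "real (card F) / (e / 2) < real M" using reals_Archimedean2 by blast
  have "0 \<le> real (card F) / (e / 2)" using e by simp
  then have Mp: "0 < real M" using M by linarith
  define \<alpha> where "\<alpha> z = nat \<lfloor>real M * p z\<rfloor>" for z
  have \<alpha>: "real (\<alpha> z) \<le> real M * p z" "real M * p z - 1 \<le> real (\<alpha> z)" for z
    using is_prob_nonneg[OF p, of z] by (auto simp: \<alpha>_def)
  obtain xs where xs: "set xs \<subseteq> F" "\<And>z. count_list xs z = (if z \<in> F then \<alpha> z else 0)"
    using ex_list_count[OF F(1)] by blast
  define T where "T = real (length xs)"
  have T: "T = (\<Sum>z\<in>F. real (\<alpha> z))"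
    using sum_count_set[OF xs(1) F(1)] xs(2) by (auto simp: T_def simp flip: of_nat_sum)
  have TM: "T \<le> real M"
  proof -
    have "T \<le> (\<Sum>z\<in>F. real M * p z)" unfolding T by (intro sum_mono \<alpha>)
    also have "\<dots> = real M * sum p F" by (simp add: sum_distrib_left)
    also have "\<dots> \<le> real M * 1" by (intro mult_left_mono is_prob_sum_le_1[OF p F(1)]) auto
    finally show ?thesis by simp
  qed
  have MT: "1 - T / real M < e"
  proof -
    have "real M * (1 - e / 2) - real (card F) < real M * sum p F - real (card F)"
      using F(3) Mp by simp
    also have "\<dots> = (\<Sum>z\<in>F. real M * p z - 1)" by (simp add: sum_subtractf sum_distrib_left)
    also have "\<dots> \<le> T" unfolding T by (intro sum_mono \<alpha>)
    finally have "real M * (1 - e / 2) - real (card F) < T" .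
    moreover have "real (card F) < real M * (e / 2)" using M e by (simp add: field_simps)
    ultimately have "real M * (1 - e) < T" by (simp add: algebra_simps)
    then show ?thesis using Mp by (simp add: field_simps)
  qed
  have "0 < T / real M" using MT e by linarith
  then have Tp: "T > 0" using Mp by (simp add: zero_less_divide_iff)
  \<comment> \<open>The intermediate function has the counts of the list but the denominator M.
    Rounding only lowers weights, and dividing by T, which is at most M, only raises them again, so
    both distances are mere differences of total mass.\<close>
  let ?b = "\<lambda>z. if z \<in> F then real (\<alpha> z) / real M else 0"
  have bF: "infsum ?b UNIV = T / real M"
  proof -
    have "infsum ?b UNIV = infsum ?b F" by (rule infsum_cong_neutral) auto
    also have "\<dots> = T / real M" using F(1) by (simp add: T sum_divide_distrib)
    finally show ?thesis .
  qed
  have bs: "?b summable_on UNIV"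
  proof -
    have "?b summable_on F" using F(1) by simp
    moreover have "?b summable_on F \<longleftrightarrow> ?b summable_on UNIV"
      by (rule summable_on_cong_neutral) auto
    ultimately show ?thesis by blast
  qed
  have "l1dist p ?b = (\<Sum>\<^sub>\<infinity>z. p z - ?b z)"
    unfolding l1dist_def
  proof (rule infsum_cong)
    fix z
    have "?b z \<le> p z"
      using \<alpha>(1)[of z] Mp is_prob_nonneg[OF p, of z] by (auto simp: field_simps)
    then show "\<bar>p z - ?b z\<bar> = p z - ?b z" by simp
  qed
  also have "\<dots> = 1 - T / real M"
    using infsum_diff_real[OF is_prob_summable[OF p] bs] is_prob_has_sum_UNIV[OF p] bF
    by (simp add: infsumI)
  finally have 1: "l1dist p ?b = 1 - T / real M" .
  have "l1dist ?b (emp xs) = (\<Sum>\<^sub>\<infinity>z\<in>F. real (\<alpha> z) / T - real (\<alpha> z) / real M)"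
    unfolding l1dist_def
  proof (rule infsum_cong_neutral)
    fix z assume "z \<in> UNIV \<inter> F"
    then have "emp xs z = real (\<alpha> z) / T" by (simp add: emp_def xs T_def)
    moreover have "real (\<alpha> z) / real M \<le> real (\<alpha> z) / T"
      using TM Tp by (intro divide_left_mono) auto
    ultimately show "\<bar>?b z - emp xs z\<bar> = real (\<alpha> z) / T - real (\<alpha> z) / real M"
      using \<open>z \<in> UNIV \<inter> F\<close> by auto
  qed (auto simp: emp_def xs)
  also have "\<dots> = 1 - T / real M"
    using F(1) Tp by (simp add: sum_subtractf T flip: sum_divide_distrib)
  finally have 2: "l1dist ?b (emp xs) = 1 - T / real M" .
  have "l1dist p (emp xs) \<le> l1dist p ?b + l1dist ?b (emp xs)"
    by (rule l1dist_triangle[OF is_prob_summable[OF p] bs emp_summable])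
  also have "\<dots> < \<delta>" using 1 2 MT e by simp
  finally have "l1dist p (emp xs) < \<delta>" .
  moreover have "xs \<noteq> []" using Tp by (auto simp: T_def)
  ultimately show thesis using that xs(1) F(2) by blast
qed

section \<open>Amenable relations are measure-hyperfinite\<close>

text \<open>The default x for a list without an accepted dart keeps the selected point in the class
  of x.\<close>

primrec choice :: "('d \<Rightarrow> 'x \<Rightarrow> 'x option) \<Rightarrow> 'd list \<Rightarrow> 'x \<Rightarrow> 'x" where
  "choice acc [] x = x"
| "choice acc (d # ds) x = (case acc d x of None \<Rightarrow> choice acc ds x | Some z \<Rightarrow> z)"

text \<open>The first dart accepted by x or y decides whether they agree. Given that there is one,
  they can differ only with chance at most \<open>b / u\<close>; all K darts miss with chance
  \<open>(1 - u / c) ^ K\<close>, where c counts the darts.\<close>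

lemma card_disagree_le:
  assumes D: "finite D" and u: "u = card {d \<in> D. acc d x \<noteq> None \<or> acc d y \<noteq> None}"
    and b: "b = card {d \<in> D. acc d x \<noteq> acc d y}" and "u > 0"
  shows "real (card {ds. set ds \<subseteq> D \<and> length ds = K \<and> choice acc ds x \<noteq> choice acc ds y})
    \<le> real (card D) ^ K * (real b / real u + (1 - real u / real (card D)) ^ K)"
proof (induction K)
  case 0
  have "card {ds. set ds \<subseteq> D \<and> length ds = 0 \<and> choice acc ds x \<noteq> choice acc ds y} \<le> card {[] :: 'a list}"
    by (rule card_mono) auto
  then have "real (card {ds. set ds \<subseteq> D \<and> length ds = 0 \<and> choice acc ds x \<noteq> choice acc ds y}) \<le> 1"
    by (simp only: card.insert card.empty finite.emptyI empty_iff not_False_eq_True of_nat_le_1_iff)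
  moreover have "0 \<le> real b / real u" by simp
  ultimately show ?case unfolding power_0 mult_1 by linarith
next
  case (Suc K)
  define h where "h K = {ds. set ds \<subseteq> D \<and> length ds = K \<and> choice acc ds x \<noteq> choice acc ds y}" for K
  define L where "L = {ds. set ds \<subseteq> D \<and> length ds = K}"
  define U where "U = {d \<in> D. acc d x \<noteq> None \<or> acc d y \<noteq> None}"
  define V where "V = {d \<in> D. acc d x \<noteq> acc d y}"
  define c where "c = real (card D)"
  have fin: "finite L" "finite (h K)" "finite U" "finite V"
  proof -
    show "finite L" unfolding L_def by (rule finite_lists_length_eq[OF D])
    then show "finite (h K)" by (rule finite_subset[rotated]) (auto simp: L_def h_def)
  qed (use D in \<open>auto simp: U_def V_def\<close>)
  have cL: "card L = card D ^ K" unfolding L_def by (rule card_lists_length_eq[OF D])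
  have ub: "card U = u" "card V = b" unfolding u b U_def V_def by (rule refl)+
  have UD: "U \<subseteq> D" by (auto simp: U_def)
  have uc: "real u \<le> c" "0 < c"
    using card_mono[OF D UD] \<open>u > 0\<close> u by (auto simp: c_def U_def)
  \<comment> \<open>If both accept the first dart identically, the choices coincide. So it is either
    a dart on which they differ, with an arbitrary rest, or one that both reject, with a disagreeing
    rest.\<close>
  have "h (Suc K) \<subseteq> (\<lambda>(d, ds). d # ds) ` (V \<times> L \<union> (D - U) \<times> h K)"
  proof
    fix es assume es: "es \<in> h (Suc K)"
    then obtain d ds where e: "es = d # ds" "d \<in> D" "set ds \<subseteq> D" "length ds = K"
      by (cases es) (auto simp: h_def)
    have "(d, ds) \<in> V \<times> L \<union> (D - U) \<times> h K"
    proof (cases "d \<in> V")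
      case True
      then show ?thesis using e by (auto simp: L_def)
    next
      case False
      then have eq: "acc d x = acc d y" using e by (auto simp: V_def)
      have "choice acc es x \<noteq> choice acc es y" using es by (auto simp: h_def)
      then have "acc d x = None" "choice acc ds x \<noteq> choice acc ds y"
        using eq e(1) by (auto split: option.splits)
      then show ?thesis using e eq by (auto simp: U_def h_def)
    qed
    then show "es \<in> (\<lambda>(d, ds). d # ds) ` (V \<times> L \<union> (D - U) \<times> h K)"
      using e(1) by (auto intro!: image_eqI[where x = "(d, ds)"])
  qed
  then have "card (h (Suc K)) \<le> card (V \<times> L \<union> (D - U) \<times> h K)"
    using fin D by (intro surj_card_le) auto
  also have "\<dots> \<le> card (V \<times> L) + card ((D - U) \<times> h K)" by (rule card_Un_le)
  also have "\<dots> = b * card D ^ K + (card D - u) * card (h K)"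
    using fin UD by (simp add: card_cartesian_product cL card_Diff_subset ub)
  finally have "real (card (h (Suc K))) \<le> real (b * card D ^ K + (card D - u) * card (h K))"
    by (rule of_nat_mono)
  also have "\<dots> = real b * c ^ K + (c - real u) * real (card (h K))"
    using uc by (simp add: c_def of_nat_diff)
  also have "\<dots> \<le> real b * c ^ K + (c - real u) * (c ^ K * (real b / real u + (1 - real u / c) ^ K))"
    using Suc uc by (intro add_left_mono mult_left_mono) (auto simp: c_def h_def)
  also have "\<dots> = c ^ Suc K * (real b / real u + (1 - real u / c) ^ Suc K)"
  proof -
    have c1: "c - real u = c * (1 - real u / c)" using uc by (simp add: field_simps)
    have "c ^ Suc K * (real b / real u) = real b * c ^ K + (c - real u) * (c ^ K * (real b / real u))"
      using \<open>u > 0\<close> by (simp add: field_simps)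
    moreover have "c ^ Suc K * (1 - real u / c) ^ Suc K = (c - real u) * (c ^ K * (1 - real u / c) ^ K)"
      unfolding c1 by simp
    ultimately show ?thesis unfolding distrib_left by linarith
  qed
  finally show ?case by (simp add: c_def h_def)
qed

section \<open>Discretisation of probability vectors by integer heights\<close>

definition level :: "nat \<Rightarrow> ('x \<Rightarrow> real) \<Rightarrow> 'x \<Rightarrow> nat" where
  "level M f z = nat \<lfloor>real M * f z\<rfloor>"

lemma less_level_iff: "0 \<le> f z \<Longrightarrow> t < level M f z \<longleftrightarrow> real (Suc t) \<le> real M * f z"
  unfolding level_def by (simp add: zless_nat_eq_int_zless) linarith

text \<open>Markov's inequality: a total mass of 1 leaves room for at most M points of weight at
  least 1 / M.\<close>

lemma finite_superlevel:
  assumes "is_prob A f"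
  shows "finite {z. 1 \<le> real M * f z}"
proof (rule conjunct1[OF finite_if_finite_subsets_card_bdd])
  fix G assume G: "G \<subseteq> {z. 1 \<le> real M * f z}" "finite G"
  have "real (card G) = (\<Sum>z\<in>G. 1)" by simp
  also have "\<dots> \<le> (\<Sum>z\<in>G. real M * f z)" using G by (intro sum_mono) auto
  also have "\<dots> = real M * sum f G" by (simp add: sum_distrib_left)
  also have "\<dots> \<le> real M * 1" by (intro mult_left_mono is_prob_sum_le_1[OF assms G(2)]) auto
  finally show "card G \<le> M" by simp
qed

text \<open>On a finite F carrying nearly all mass of both vectors, rounding costs at most 1 per
  point, hence \<open>card F\<close> in all, which is negligible against M. Outside F each vector
  has mass at most e / 4, whatever the rounding does.\<close>

lemma level_approx:
  assumes f: "is_prob A f" and g: "is_prob B g" and "e > 0"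
  defines "Z \<equiv> \<lambda>M. {z. 1 \<le> real M * f z \<or> 1 \<le> real M * g z}"
  shows "\<forall>\<^sub>F M in sequentially. finite (Z M) \<and> real M * (1 - e) \<le> (\<Sum>z\<in>Z M. real (level M f z)) \<and>
    (\<Sum>z\<in>Z M. \<bar>real (level M f z) - real (level M g z)\<bar>) \<le> real M * (l1dist f g + e)"
proof -
  have "e / 4 > 0" using \<open>e > 0\<close> by simp
  obtain F1 where F1: "finite F1" "sum f F1 > 1 - e / 4"
    using is_prob_finite_carrier[OF f \<open>e / 4 > 0\<close>] by metis
  obtain F2 where F2: "finite F2" "sum g F2 > 1 - e / 4"
    using is_prob_finite_carrier[OF g \<open>e / 4 > 0\<close>] by metis
  define F where "F = F1 \<union> F2"
  have "sum f F1 \<le> sum f F" "sum g F2 \<le> sum g F"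
    using F1 F2 is_prob_nonneg[OF f] is_prob_nonneg[OF g] by (auto simp: F_def intro!: sum_mono2)
  then have F: "finite F" "sum f F > 1 - e / 4" "sum g F > 1 - e / 4"
    using F1 F2 by (auto simp: F_def)
  have Zfin: "finite (Z M)" for M
  proof -
    have "Z M = {z. 1 \<le> real M * f z} \<union> {z. 1 \<le> real M * g z}" by (auto simp: Z_def)
    then show ?thesis using finite_superlevel[OF f] finite_superlevel[OF g] by simp
  qed
  have lev: "real (level M h z) \<le> real M * h z" "real M * h z - 1 \<le> real (level M h z)"
    if "is_prob C h" for M h C z
    using is_prob_nonneg[OF that, of z] by (auto simp: level_def)
  have lev0: "level M f z = 0" "level M g z = 0" if "z \<notin> Z M" for M z
    using that by (auto simp: Z_def level_def not_le floor_le_iff nat_eq_iff2)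
  have tail: "(\<Sum>z\<in>Z M - F. h z) \<le> e / 4" if "is_prob C h" "sum h F > 1 - e / 4" for M C h
  proof -
    have "sum h (Z M - F) + sum h F = sum h (Z M \<union> F)"
      using Zfin[of M] F(1) by (subst sum.union_disjoint[symmetric]) (auto intro: sum.cong)
    also have "\<dots> \<le> 1" by (rule is_prob_sum_le_1[OF that(1)]) (use Zfin F in auto)
    finally show ?thesis using that(2) by simp
  qed
  \<comment> \<open>Makes the total rounding error \<open>card F\<close> at most a quarter of
    \<open>real M * e\<close>.\<close>
  obtain M0 where M0: "4 * real (card F) / e < real M0" using reals_Archimedean2 by blast
  have "finite (Z M) \<and> real M * (1 - e) \<le> (\<Sum>z\<in>Z M. real (level M f z)) \<and>
    (\<Sum>z\<in>Z M. \<bar>real (level M f z) - real (level M g z)\<bar>) \<le> real M * (l1dist f g + e)"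
    if "M \<ge> M0" for M
  proof (intro conjI)
    show "finite (Z M)" by (rule Zfin)
    have "4 * real (card F) / e < real M" using M0 that by linarith
    then have cF: "real (card F) \<le> real M * (e / 4)" using \<open>e > 0\<close> by (simp add: field_simps)
    have "real M * (1 - e) \<le> real M * (1 - e / 4) - real M * (e / 4)"
      using \<open>e > 0\<close> by (simp add: algebra_simps)
    also have "\<dots> \<le> real M * sum f F - real (card F)"
      using F cF by (intro diff_mono mult_left_mono) auto
    also have "\<dots> = (\<Sum>z\<in>F. real M * f z - 1)" by (simp add: sum_subtractf sum_distrib_left)
    also have "\<dots> \<le> (\<Sum>z\<in>F. real (level M f z))" by (intro sum_mono lev[OF f])
    also have "\<dots> \<le> (\<Sum>z\<in>Z M \<union> F. real (level M f z))"
      using Zfin F by (intro sum_mono2) auto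
    also have "\<dots> = (\<Sum>z\<in>Z M. real (level M f z))"
      using Zfin F lev0 by (intro sum.mono_neutral_right) auto
    finally show "real M * (1 - e) \<le> (\<Sum>z\<in>Z M. real (level M f z))" .
    let ?d = "\<lambda>z. \<bar>real (level M f z) - real (level M g z)\<bar>"
    have "(\<Sum>z\<in>Z M. ?d z) \<le> (\<Sum>z\<in>(Z M - F) \<union> F. ?d z)"
      using Zfin F by (intro sum_mono2) auto
    also have "\<dots> = (\<Sum>z\<in>Z M - F. ?d z) + (\<Sum>z\<in>F. ?d z)"
      using Zfin[of M] F(1) by (intro sum.union_disjoint) auto
    also have "(\<Sum>z\<in>Z M - F. ?d z) \<le> (\<Sum>z\<in>Z M - F. real M * f z + real M * g z)"
    proof (rule sum_mono)
      fix z
      show "?d z \<le> real M * f z + real M * g z" using lev(1)[OF f, of M z] lev(1)[OF g, of M z] by linarith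
    qed
    also have "\<dots> = real M * ((\<Sum>z\<in>Z M - F. f z) + (\<Sum>z\<in>Z M - F. g z))"
      by (simp add: sum.distrib sum_distrib_left distrib_left)
    also have "\<dots> \<le> real M * (e / 4 + e / 4)"
      by (intro mult_left_mono add_mono tail[OF f F(2)] tail[OF g F(3)]) auto
    also have "(\<Sum>z\<in>F. ?d z) \<le> (\<Sum>z\<in>F. real M * \<bar>f z - g z\<bar> + 1)"
    proof (rule sum_mono)
      fix z
      have "\<bar>real M * f z - real M * g z\<bar> = real M * \<bar>f z - g z\<bar>"
        by (simp add: abs_mult flip: right_diff_distrib)
      then show "?d z \<le> real M * \<bar>f z - g z\<bar> + 1"
        using lev[OF f, of M z] lev[OF g, of M z] by linarith
    qed
    also have "\<dots> = real M * (\<Sum>z\<in>F. \<bar>f z - g z\<bar>) + real (card F)"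
      by (simp add: sum.distrib sum_distrib_left)
    also have "\<dots> \<le> real M * l1dist f g + real M * (e / 4)"
    proof (intro add_mono mult_left_mono cF)
      show "(\<Sum>z\<in>F. \<bar>f z - g z\<bar>) \<le> l1dist f g"
        unfolding l1dist_def using F(1)
        by (intro finite_sum_le_infsum summable_on_abs_diff is_prob_summable[OF f] is_prob_summable[OF g]) auto
    qed auto
    finally have "(\<Sum>z\<in>Z M. ?d z) \<le> real M * (e / 4 + e / 4) + (real M * l1dist f g + real M * (e / 4))"
      by simp
    also have "\<dots> \<le> real M * (l1dist f g + e)" using \<open>e > 0\<close> by (simp add: algebra_simps)
    finally show "(\<Sum>z\<in>Z M. ?d z) \<le> real M * (l1dist f g + e)" .
  qed
  then show ?thesis by (auto simp: eventually_sequentially)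
qed

text \<open>The relation is presented by a sequence of Borel maps whose values run through each
  class, as the elements of a countable group do. The separating sets stand in for a standard Borel
  structure: they make equality of Borel maps a Borel condition and cut the space into finitely many
  cells.\<close>

locale cber_maps =
  fixes M :: "'x measure" and \<phi> :: "nat \<Rightarrow> 'x \<Rightarrow> 'x" and B :: "nat \<Rightarrow> 'x set"
    and E :: "('x \<times> 'x) set"
  assumes \<phi>_measurable [measurable]: "\<And>k. \<phi> k \<in> M \<rightarrow>\<^sub>M M"
    and B_sets [measurable]: "\<And>n. B n \<in> sets M"
    and separating: "\<And>x y. x \<in> space M \<Longrightarrow> y \<in> space M \<Longrightarrow> x \<noteq> y \<Longrightarrow> \<exists>n. x \<in> B n \<longleftrightarrow> y \<notin> B n"
    and E_eq: "E = {(x, y). x \<in> space M \<and> (\<exists>k. y = \<phi> k x)}"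
    and equiv_E: "equiv (space M) E"
begin

lemma pred_eq:
  assumes [measurable]: "f \<in> N \<rightarrow>\<^sub>M M" "g \<in> N \<rightarrow>\<^sub>M M"
  shows "Measurable.pred N (\<lambda>x. f x = g x)"
proof -
  have "Measurable.pred N (\<lambda>x. \<forall>n. f x \<in> B n \<longleftrightarrow> g x \<in> B n)" by measurable
  moreover have "f x = g x \<longleftrightarrow> (\<forall>n. f x \<in> B n \<longleftrightarrow> g x \<in> B n)" if "x \<in> space N" for x
    using separating[of "f x" "g x"] that measurable_space[OF assms(1)] measurable_space[OF assms(2)]
    by metis
  ultimately show ?thesis
    using measurable_cong[of N "\<lambda>x. f x = g x" "\<lambda>x. \<forall>n. f x \<in> B n \<longleftrightarrow> g x \<in> B n"] by blast
qed

lemma E_space: "(x, y) \<in> E \<Longrightarrow> x \<in> space M \<and> y \<in> space M"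
  using equiv_E by (auto simp: equiv_def refl_on_def E_eq \<phi>_measurable[THEN measurable_space])

lemma E_class_eq: "(x, y) \<in> E \<Longrightarrow> E `` {x} = E `` {y}"
  by (rule equiv_class_eq[OF equiv_E])

text \<open>The atom of x in the partition generated by the first N separating sets, coded by a set
  of indices so that a uniformly random cell is a random element of a finite power set.\<close>

definition cell :: "nat \<Rightarrow> 'x \<Rightarrow> nat set" where
  "cell N x = {n. n < N \<and> x \<in> B n}"

lemma cell_eq_iff: "cell N x = c \<longleftrightarrow> c \<subseteq> {..<N} \<and> (\<forall>n<N. x \<in> B n \<longleftrightarrow> n \<in> c)"
  by (auto simp: cell_def)

lemma pred_cell: "f \<in> N' \<rightarrow>\<^sub>M M \<Longrightarrow> Measurable.pred N' (\<lambda>x. cell N (f x) = c)"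
  unfolding cell_eq_iff by measurable

lemma eventually_inj_on_cell:
  assumes "finite Z" "Z \<subseteq> space M"
  shows "\<forall>\<^sub>F N in sequentially. inj_on (cell N) Z"
proof -
  have "\<forall>\<^sub>F N in sequentially. \<forall>z\<in>Z. \<forall>z'\<in>Z. z \<noteq> z' \<longrightarrow> cell N z \<noteq> cell N z'"
  proof (intro eventually_ball_finite assms ballI)
    fix z z' assume z: "z \<in> Z" "z' \<in> Z"
    show "\<forall>\<^sub>F N in sequentially. z \<noteq> z' \<longrightarrow> cell N z \<noteq> cell N z'"
    proof (cases "z = z'")
      case False
      then obtain n where n: "z \<in> B n \<longleftrightarrow> z' \<notin> B n" using separating[of z z'] z assms(2) by blast
      show ?thesis using eventually_gt_at_top[of n]
        by eventually_elim (use n in \<open>auto simp: cell_def\<close>)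
    qed simp
  qed
  then show ?thesis by eventually_elim (auto simp: inj_on_def)
qed

text \<open>A point of the class is named by an index k so that ties between eligible points of one
  cell can be broken by the least index. That index depends on x and not only on the class, so
  agreement of x and y needs cells with a single eligible point.\<close>

definition hit :: "('x \<Rightarrow> 'x \<Rightarrow> real) \<Rightarrow> nat \<Rightarrow> nat \<Rightarrow> nat set \<times> nat \<Rightarrow> nat \<Rightarrow> 'x \<Rightarrow> bool" where
  "hit p m N d k x \<longleftrightarrow> cell N (\<phi> k x) = fst d \<and> real (Suc (snd d)) \<le> real m * p x (\<phi> k x)"

text \<open>A dart is a cell together with a height. The point x accepts it if the cell contains a point
  at which the measure assigned to x exceeds the height; nearby measures accept nearly the same darts.\<close>

definition accept :: "('x \<Rightarrow> 'x \<Rightarrow> real) \<Rightarrow> nat \<Rightarrow> nat \<Rightarrow> nat set \<times> nat \<Rightarrow> 'x \<Rightarrow> 'x option" where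
  "accept p m N d x = (if \<exists>k. hit p m N d k x then Some (\<phi> (LEAST k. hit p m N d k x) x) else None)"

text \<open>Heights below m suffice because a probability never exceeds 1. Codes of empty cells are
  included; such darts are rejected by everyone.\<close>

definition darts :: "nat \<Rightarrow> nat \<Rightarrow> (nat set \<times> nat) set" where
  "darts m N = Pow {..<N} \<times> {..<m}"

text \<open>The probability that K independent uniform darts make x and y select different points,
  as a proportion of lists.\<close>

definition disagree :: "('x \<Rightarrow> 'x \<Rightarrow> real) \<Rightarrow> nat \<Rightarrow> nat \<Rightarrow> nat \<Rightarrow> 'x \<Rightarrow> 'x \<Rightarrow> real" where
  "disagree p m N K x y =
     real (card {ds. set ds \<subseteq> darts m N \<and> length ds = K \<and>
       choice (accept p m N) ds x \<noteq> choice (accept p m N) ds y}) / real (card (darts m N)) ^ K"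

lemma finite_darts: "finite (darts m N)"
  by (simp add: darts_def)

lemma choice_measurable:
  assumes p [measurable]: "\<And>k. (\<lambda>x. p x (\<phi> k x)) \<in> borel_measurable M"
  shows "choice (accept p m N) ds \<in> M \<rightarrow>\<^sub>M M"
proof (induction ds)
  case (Cons d ds)
  note Cons [measurable]
  have h [measurable]: "Measurable.pred M (hit p m N d k)" for k
  proof -
    have [measurable]: "Measurable.pred M (\<lambda>x. cell N (\<phi> k x) = fst d)" by (rule pred_cell) simp
    show ?thesis unfolding hit_def by measurable
  qed
  have [measurable]: "(\<lambda>x. \<phi> (LEAST k. hit p m N d k x) x) \<in> M \<rightarrow>\<^sub>M M"
    by (rule measurable_compose_countable[where f = \<phi>]) (auto intro: measurable_Least h)
  have "choice (accept p m N) (d # ds) = (\<lambda>x. if \<exists>k. hit p m N d k x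
      then \<phi> (LEAST k. hit p m N d k x) x else choice (accept p m N) ds x)"
    by (auto simp: accept_def)
  also have "\<dots> \<in> M \<rightarrow>\<^sub>M M" by measurable
  finally show ?case .
qed (simp add: measurable_ident_sets)

lemma choice_in_class: "x \<in> space M \<Longrightarrow> (x, choice (accept p m N) ds x) \<in> E"
proof (induction ds)
  case Nil
  then show ?case using equiv_E by (auto simp: equiv_def refl_on_def)
next
  case (Cons d ds)
  then show ?case by (auto simp: accept_def E_eq)
qed

text \<open>Once the cells separate the points of weight at least 1 / m, the least index can only
  name the one eligible point, and acceptance no longer depends on how the class is enumerated from
  x.\<close>

lemma accept_eq_Some_iff:
  assumes x: "x \<in> space M" and inj: "inj_on (cell N) Z"
    and Z: "\<And>z. (x, z) \<in> E \<Longrightarrow> 1 \<le> real m * p x z \<Longrightarrow> z \<in> Z"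
  shows "accept p m N (c, t) x = Some z \<longleftrightarrow> (x, z) \<in> E \<and> cell N z = c \<and> real (Suc t) \<le> real m * p x z"
proof
  assume "accept p m N (c, t) x = Some z"
  then have "\<exists>k. hit p m N (c, t) k x" "z = \<phi> (LEAST k. hit p m N (c, t) k x) x"
    by (auto simp: accept_def split: if_splits)
  then have "hit p m N (c, t) (LEAST k. hit p m N (c, t) k x) x" by (auto intro: LeastI)
  then show "(x, z) \<in> E \<and> cell N z = c \<and> real (Suc t) \<le> real m * p x z"
    using x \<open>z = _\<close> by (auto simp: hit_def E_eq)
next
  assume z: "(x, z) \<in> E \<and> cell N z = c \<and> real (Suc t) \<le> real m * p x z"
  then obtain k where k: "z = \<phi> k x" by (auto simp: E_eq)
  have ex: "hit p m N (c, t) k x" using z k by (auto simp: hit_def)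
  let ?k = "LEAST k. hit p m N (c, t) k x"
  have h: "hit p m N (c, t) ?k x" using ex by (rule LeastI)
  have "\<phi> ?k x \<in> Z" by (rule Z) (use x h in \<open>auto simp: hit_def E_eq\<close>)
  moreover have "z \<in> Z" by (rule Z) (use z in auto)
  moreover have "cell N (\<phi> ?k x) = cell N z" using h z by (simp add: hit_def)
  ultimately have "\<phi> ?k x = z" using inj by (auto dest: inj_onD)
  then show "accept p m N (c, t) x = Some z" using ex by (auto simp: accept_def)
qed

text \<open>The order of the limits is forced: m is taken large for the rounding, then N large
  enough to separate the finitely many points of weight at least 1 / m, then K large enough that
  some dart is almost surely accepted.\<close>

lemma disagree_small:
  assumes xy: "(x, y) \<in> E" and px: "is_prob (E `` {x}) (p x)" and py: "is_prob (E `` {y}) (p y)"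
    and "l1dist (p x) (p y) < e"
  shows "\<forall>\<^sub>F m in sequentially. \<forall>\<^sub>F N in sequentially. \<forall>\<^sub>F K in sequentially.
    disagree p m N K x y < 6 * e"
proof -
  have "0 \<le> l1dist (p x) (p y)" unfolding l1dist_def by (rule infsum_nonneg) simp
  then have e: "e > 0" using assms(4) by simp
  have xs: "x \<in> space M" "y \<in> space M" using E_space[OF xy] by auto
  have cl: "E `` {y} = E `` {x}" using E_class_eq[OF xy] by simp
  \<comment> \<open>With e' \<le> e the darts treated differently number at most
    \<open>2 * e * m\<close>, and with e' \<le> 1/4 those accepted by x or y number at least
    \<open>m / 2\<close>. The ratio is at most 4 * e; another e pays for lists without an accepted
    dart.\<close>
  define e' where "e' = min e (1/4)"
  have e': "e' > 0" "e' \<le> e" "e' \<le> 1/4" using e by (auto simp: e'_def)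
  define Z where "Z m = {z. 1 \<le> real m * p x z \<or> 1 \<le> real m * p y z}" for m
  have ZE: "Z m \<subseteq> E `` {x}" for m
    using px py cl by (auto simp: Z_def is_prob_def)
  then have ZM: "Z m \<subseteq> space M" for m using E_space by blast
  have "\<forall>\<^sub>F m in sequentially. finite (Z m) \<and> real m * (1 - e') \<le> (\<Sum>z\<in>Z m. real (level m (p x) z)) \<and>
    (\<Sum>z\<in>Z m. \<bar>real (level m (p x) z) - real (level m (p y) z)\<bar>) \<le> real m * (l1dist (p x) (p y) + e')"
    unfolding Z_def by (rule level_approx[OF px py e'(1)])
  then show ?thesis using eventually_gt_at_top[of 0]
  proof eventually_elim
    case (elim m)
    have "\<forall>\<^sub>F N in sequentially. inj_on (cell N) (Z m)"
      using elim ZM by (intro eventually_inj_on_cell) auto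
    then show ?case
    proof eventually_elim
      case inj: (elim N)
      \<comment> \<open>Turns a point and a height under a graph into a dart; being injective, it
        reduces counting darts to adding up levels.\<close>
      define \<theta> where "\<theta> = (\<lambda>(z, t :: nat). (cell N z, t))"
      have inj\<theta>: "inj_on \<theta> (Z m \<times> UNIV)"
        using inj by (auto simp: \<theta>_def inj_on_def)
      have acc_x: "accept p m N (c, t) x = Some z \<longleftrightarrow> z \<in> E `` {x} \<and> cell N z = c \<and> t < level m (p x) z" for c t z
        using accept_eq_Some_iff[OF xs(1) inj, where p = p and m = m and c = c and t = t and z = z]
          less_level_iff[of "p x" z t m] is_prob_nonneg[OF px] by (auto simp: Z_def)
      have acc_y: "accept p m N (c, t) y = Some z \<longleftrightarrow> z \<in> E `` {x} \<and> cell N z = c \<and> t < level m (p y) z" for c t z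
        using accept_eq_Some_iff[OF xs(2) inj, where p = p and m = m and c = c and t = t and z = z]
          less_level_iff[of "p y" z t m] is_prob_nonneg[OF py] cl by (auto simp: Z_def)
      have lev_Z: "z \<in> Z m" if "t < level m (p x) z \<or> t < level m (p y) z" for t z
        using that less_level_iff[of "p x" z t m] less_level_iff[of "p y" z t m]
          is_prob_nonneg[OF px] is_prob_nonneg[OF py] by (auto simp: Z_def)
      define u where "u = card {d \<in> darts m N. accept p m N d x \<noteq> None \<or> accept p m N d y \<noteq> None}"
      define b where "b = card {d \<in> darts m N. accept p m N d x \<noteq> accept p m N d y}"
      have "(\<Sum>z\<in>Z m. level m (p x) z) = card (SIGMA z:Z m. {..<level m (p x) z})"
        using elim by simp
      also have "\<dots> = card (\<theta> ` (SIGMA z:Z m. {..<level m (p x) z}))"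
        by (rule card_image[symmetric]) (rule inj_on_subset[OF inj\<theta>], auto)
      also have "\<dots> \<le> u"
        unfolding u_def
      proof (rule card_mono)
        show "\<theta> ` (SIGMA z:Z m. {..<level m (p x) z})
            \<subseteq> {d \<in> darts m N. accept p m N d x \<noteq> None \<or> accept p m N d y \<noteq> None}"
        proof
          fix d assume "d \<in> \<theta> ` (SIGMA z:Z m. {..<level m (p x) z})"
          then obtain z t where d: "d = \<theta> (z, t)" and z: "z \<in> Z m" "t \<in> {..<level m (p x) z}"
            by blast
          have "accept p m N (cell N z, t) x = Some z" using z ZE by (auto simp: acc_x)
          moreover have "t < m"
          proof -
            have "real (Suc t) \<le> real m * p x z"
              using z less_level_iff[of "p x" z t m] is_prob_nonneg[OF px] by auto
            also have "\<dots> \<le> real m * 1" by (intro mult_left_mono is_prob_le_1[OF px]) auto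
            finally show ?thesis by simp
          qed
          ultimately show "d \<in> {d \<in> darts m N. accept p m N d x \<noteq> None \<or> accept p m N d y \<noteq> None}"
            by (auto simp: d \<theta>_def darts_def cell_def)
        qed
      qed (simp add: finite_darts)
      finally have u: "real m * (1 - e') \<le> real u"
        using elim unfolding of_nat_sum[symmetric] by linarith
      \<comment> \<open>A dart is treated differently only if its height lies between the two levels
        at a point of its cell, so the count is bounded by the sum of the level differences.\<close>
      have "b \<le> card (\<theta> ` (SIGMA z:Z m. {min (level m (p x) z) (level m (p y) z)..<max (level m (p x) z) (level m (p y) z)}))"
        unfolding b_def
      proof (rule card_mono)
        show "{d \<in> darts m N. accept p m N d x \<noteq> accept p m N d y} \<subseteq>
          \<theta> ` (SIGMA z:Z m. {min (level m (p x) z) (level m (p y) z)..<max (level m (p x) z) (level m (p y) z)})"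
        proof
          fix d assume "d \<in> {d \<in> darts m N. accept p m N d x \<noteq> accept p m N d y}"
          then obtain c t where d: "d = (c, t)" and "accept p m N (c, t) x \<noteq> accept p m N (c, t) y"
            by (cases d) auto
          then obtain z where "(accept p m N (c, t) x = Some z) \<noteq> (accept p m N (c, t) y = Some z)"
            by (metis not_Some_eq)
          then have z: "cell N z = c" "(t < level m (p x) z) \<noteq> (t < level m (p y) z)"
            by (auto simp: acc_x acc_y)
          then have "z \<in> Z m" using lev_Z by blast
          then show "d \<in> \<theta> ` (SIGMA z:Z m. {min (level m (p x) z) (level m (p y) z)..<max (level m (p x) z) (level m (p y) z)})"
            using z by (intro image_eqI[where x = "(z, t)"]) (auto simp: d \<theta>_def)
        qed
      qed (use elim in auto)
      also have "\<dots> \<le> card (SIGMA z:Z m. {min (level m (p x) z) (level m (p y) z)..<max (level m (p x) z) (level m (p y) z)})"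
        using elim by (intro card_image_le) auto
      also have "\<dots> = (\<Sum>z\<in>Z m. max (level m (p x) z) (level m (p y) z) - min (level m (p x) z) (level m (p y) z))"
        using elim by simp
      finally have "real b \<le> real (\<Sum>z\<in>Z m. max (level m (p x) z) (level m (p y) z) - min (level m (p x) z) (level m (p y) z))"
        by (rule of_nat_mono)
      also have "\<dots> = (\<Sum>z\<in>Z m. \<bar>real (level m (p x) z) - real (level m (p y) z)\<bar>)"
        unfolding of_nat_sum by (intro sum.cong) (auto simp: max_def min_def of_nat_diff)
      also have "\<dots> \<le> real m * (l1dist (p x) (p y) + e')" using elim by simp
      also have "\<dots> \<le> real m * (2 * e)" using assms(4) e' by (intro mult_left_mono) auto
      finally have b: "real b \<le> real m * (2 * e)" .
      have "real m * (1/2) \<le> real m * (1 - e')" using e' by (intro mult_left_mono) auto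
      then have u': "real m / 2 \<le> real u" using u by simp
      then have u0: "u > 0" using elim by (cases u) auto
      have "real b / real u \<le> (real m * (2 * e)) / (real m / 2)"
        using b u' elim e by (intro frac_le) auto
      also have "\<dots> = 4 * e" using elim by simp
      finally have bu: "real b / real u \<le> 4 * e" .
      define c where "c = real (card (darts m N))"
      have "u \<le> card (darts m N)" unfolding u_def by (intro card_mono finite_darts) auto
      then have c: "0 < c" "real u \<le> c" using u0 by (auto simp: c_def)
      have "(\<lambda>K. (1 - real u / c) ^ K) \<longlonglongrightarrow> 0"
        using c u0 by (intro LIMSEQ_realpow_zero) (auto simp: field_simps)
      then have "\<forall>\<^sub>F K in sequentially. (1 - real u / c) ^ K < e"
        using e by (rule order_tendstoD)
      then show ?case
      proof eventually_elim
        case K: (elim K)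
        have "disagree p m N K x y \<le> c ^ K * (real b / real u + (1 - real u / c) ^ K) / c ^ K"
          unfolding disagree_def c_def
          by (intro divide_right_mono 
              card_disagree_le[where acc = "accept p m N" and x = x and y = y, OF finite_darts u_def b_def u0]) auto
        also have "\<dots> = real b / real u + (1 - real u / c) ^ K" using c by simp
        also have "\<dots> < 6 * e" using K bu e by simp
        finally show ?case .
      qed
    qed
  qed
qed

text \<open>The average over dart lists of the measure of the set of disagreement is the integral of
  the pointwise disagreement probability. Once this integral is small for some parameters, some list
  does at least as well as the average.\<close>

lemma exists_approx_selector:
  fixes \<mu> :: "'x measure"
  assumes \<mu>: "prob_space \<mu>" "sets \<mu> = sets M" and amen: "borel_2_amenable M E" and "\<epsilon> > 0"
  obtains f where "f \<in> M \<rightarrow>\<^sub>M M" "\<And>x. x \<in> space M \<Longrightarrow> (x, f x) \<in> E"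
    "measure \<mu> {x \<in> space M. \<exists>k\<le>n. f x \<noteq> f (\<phi> k x)} < \<epsilon>"
proof -
  interpret \<mu>: prob_space \<mu> by (rule \<mu>)
  have sp: "space \<mu> = space M" using \<mu>(2) by (rule sets_eq_imp_space_eq)
  note [measurable_cong] = \<mu>(2)
  obtain p :: "nat \<Rightarrow> nat \<Rightarrow> 'x \<Rightarrow> 'x \<Rightarrow> real" where
    prob: "\<And>i j x. x \<in> space M \<Longrightarrow> is_prob (E `` {x}) (p i j x)" and
    close: "\<And>x y e. (x, y) \<in> E \<Longrightarrow> e > 0 \<Longrightarrow>
      \<forall>\<^sub>F i in sequentially. \<forall>\<^sub>F j in sequentially. l1dist (p i j x) (p i j y) < e" and
    meas: "\<And>i j. (\<lambda>(x, y). p i j x y) \<in> borel_measurable (restrict_space (M \<Otimes>\<^sub>M M) E)"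
    using amen unfolding borel_2_amenable_def by blast
  have p_meas: "(\<lambda>x. p i j x (\<phi> k x)) \<in> borel_measurable M" for i j k
  proof -
    have "(\<lambda>x. (x, \<phi> k x)) \<in> M \<rightarrow>\<^sub>M restrict_space (M \<Otimes>\<^sub>M M) E"
      by (rule measurable_restrict_space2) (auto simp: E_eq)
    from measurable_compose[OF this meas[of i j]] show ?thesis by simp
  qed
  \<comment> \<open>\<open>Suc m\<close> keeps the set of darts nonempty, so averages over lists
    have a positive denominator.\<close>
  define f where "f i j m N ds = choice (accept (p i j) (Suc m) N) ds" for i j m N ds
  have f_meas [measurable]: "f i j m N ds \<in> M \<rightarrow>\<^sub>M M" for i j m N ds
    unfolding f_def by (rule choice_measurable) (rule p_meas)
  define bad where "bad i j m N ds k = {x \<in> space M. f i j m N ds x \<noteq> f i j m N ds (\<phi> k x)}" for i j m N ds k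
  have bad_sets [measurable]: "bad i j m N ds k \<in> sets M" for i j m N ds k
  proof -
    have "Measurable.pred M (\<lambda>x. f i j m N ds x = f i j m N ds (\<phi> k x))"
      by (rule pred_eq) measurable
    then show ?thesis unfolding bad_def by measurable
  qed
  define L where "L m N K = {ds. set ds \<subseteq> darts (Suc m) N \<and> length ds = K}" for m N K
  have L: "finite (L m N K)" "card (L m N K) = card (darts (Suc m) N) ^ K" for m N K
    unfolding L_def by (simp_all add: finite_lists_length_eq finite_darts card_lists_length_eq)
  define h where "h i j m N K x = (\<Sum>k\<le>n. ennreal (disagree (p i j) (Suc m) N K x (\<phi> k x)))" for i j m N K x
  have dis: "disagree (p i j) (Suc m) N K x (\<phi> k x) =
      (\<Sum>ds\<in>L m N K. indicator (bad i j m N ds k) x) / real (card (L m N K))" if "x \<in> space M" for i j m N K k x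
  proof -
    have "{ds. set ds \<subseteq> darts (Suc m) N \<and> length ds = K \<and>
        choice (accept (p i j) (Suc m) N) ds x \<noteq> choice (accept (p i j) (Suc m) N) ds (\<phi> k x)} =
        {ds \<in> L m N K. x \<in> bad i j m N ds k}"
      using that by (auto simp: L_def bad_def f_def)
    then show ?thesis
      using L(1)[of m N K]
      by (simp add: disagree_def L(2) indicator_def sum.If_cases Int_def)
  qed
  have h_meas [measurable]: "h i j m N K \<in> borel_measurable M" for i j m N K
  proof -
    have "h i j m N K \<in> borel_measurable M \<longleftrightarrow> (\<lambda>x. \<Sum>k\<le>n.
      ennreal ((\<Sum>ds\<in>L m N K. indicator (bad i j m N ds k) x) / real (card (L m N K)))) \<in> borel_measurable M"
      by (rule measurable_cong) (simp add: h_def dis)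
    moreover have "(\<lambda>x. \<Sum>k\<le>n.
      ennreal ((\<Sum>ds\<in>L m N K. indicator (bad i j m N ds k) x) / real (card (L m N K)))) \<in> borel_measurable M"
      by measurable
    ultimately show ?thesis by blast
  qed
  have h_le: "h i j m N K x \<le> ennreal (real (Suc n))" if "x \<in> space M" for i j m N K x
  proof -
    have "disagree (p i j) (Suc m) N K x (\<phi> k x) \<le> 1" for k
    proof -
      have "(\<Sum>ds\<in>L m N K. indicator (bad i j m N ds k) x) \<le> (\<Sum>ds\<in>L m N K. 1 :: real)"
        by (intro sum_mono) (auto simp: indicator_def)
      then show ?thesis using dis[OF that, of i j m N K k] by (auto simp: divide_le_eq_1)
    qed
    then have "h i j m N K x \<le> (\<Sum>k\<le>n. ennreal 1)"
      unfolding h_def by (intro sum_mono ennreal_leI)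
    also have "\<dots> = ennreal (real (Suc n))"
      by (simp add: ennreal_of_nat_eq_real_of_nat flip: ennreal_plus)
    finally show ?thesis .
  qed
  \<comment> \<open>The reverse Fatou inequality. Its dominating constant \<open>n + 1\<close> is
    integrable for a probability measure and survives a limsup, so the inequality can be applied
    once for each of the five parameters.\<close>
  have fatou: "limsup (\<lambda>i. \<integral>\<^sup>+x. u i x \<partial>\<mu>) \<le> (\<integral>\<^sup>+x. limsup (\<lambda>i. u i x) \<partial>\<mu>)"
    if [measurable]: "\<And>i. u i \<in> borel_measurable M" and "\<And>i x. x \<in> space M \<Longrightarrow> u i x \<le> ennreal (real (Suc n))"
    for u :: "nat \<Rightarrow> 'x \<Rightarrow> ennreal"
    by (rule nn_integral_limsup[where w = "\<lambda>_. ennreal (real (Suc n))"])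
       (use that(2) sp in \<open>auto simp: \<mu>.emeasure_space_1[unfolded sp]\<close>)
  have bd: "limsup v \<le> ennreal (real (Suc n))" if "\<And>i. v i \<le> ennreal (real (Suc n))" for v :: "nat \<Rightarrow> ennreal"
    using that by (intro Limsup_bounded) auto
  have "limsup (\<lambda>i. limsup (\<lambda>j. limsup (\<lambda>m. limsup (\<lambda>N. limsup (\<lambda>K. \<integral>\<^sup>+x. h i j m N K x \<partial>\<mu>))))) \<le>
    limsup (\<lambda>i. limsup (\<lambda>j. limsup (\<lambda>m. limsup (\<lambda>N. \<integral>\<^sup>+x. limsup (\<lambda>K. h i j m N K x) \<partial>\<mu>))))"
    by (intro Limsup_mono always_eventually allI fatou h_le) auto
  also have "\<dots> \<le> limsup (\<lambda>i. limsup (\<lambda>j. limsup (\<lambda>m. \<integral>\<^sup>+x. limsup (\<lambda>N. limsup (\<lambda>K. h i j m N K x)) \<partial>\<mu>)))"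
    by (intro Limsup_mono always_eventually allI fatou h_le bd) auto
  also have "\<dots> \<le> limsup (\<lambda>i. limsup (\<lambda>j. \<integral>\<^sup>+x. limsup (\<lambda>m. limsup (\<lambda>N. limsup (\<lambda>K. h i j m N K x))) \<partial>\<mu>))"
    by (intro Limsup_mono always_eventually allI fatou h_le bd) auto
  also have "\<dots> \<le> limsup (\<lambda>i. \<integral>\<^sup>+x. limsup (\<lambda>j. limsup (\<lambda>m. limsup (\<lambda>N. limsup (\<lambda>K. h i j m N K x)))) \<partial>\<mu>)"
    by (intro Limsup_mono always_eventually allI fatou h_le bd) auto
  also have "\<dots> \<le> (\<integral>\<^sup>+x. limsup (\<lambda>i. limsup (\<lambda>j. limsup (\<lambda>m. limsup (\<lambda>N. limsup (\<lambda>K. h i j m N K x))))) \<partial>\<mu>)"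
    by (intro fatou h_le bd) auto
  also have "\<dots> = (\<integral>\<^sup>+x. 0 \<partial>\<mu>)"
  proof (rule nn_integral_cong)
    fix x assume "x \<in> space \<mu>"
    then have x: "x \<in> space M" by (simp add: sp)
    let ?l = "limsup (\<lambda>i. limsup (\<lambda>j. limsup (\<lambda>m. limsup (\<lambda>N. limsup (\<lambda>K. h i j m N K x)))))"
    have "?l \<le> ennreal e" if "e > 0" for e
    proof -
      \<comment> \<open>The 6 cancels the constant in \<open>disagree_small\<close>, and
        \<open>Suc n\<close> is the number of maps whose disagreements are added.\<close>
      define d where "d = e / (6 * real (Suc n))"
      have d: "d > 0" using that by (simp add: d_def)
      have Ek: "(x, \<phi> k x) \<in> E" "\<phi> k x \<in> space M" for k
        using x E_eq \<phi>_measurable[THEN measurable_space] by auto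
      have "\<forall>\<^sub>F i in sequentially. \<forall>k\<in>{..n}. \<forall>\<^sub>F j in sequentially. l1dist (p i j x) (p i j (\<phi> k x)) < d"
        by (intro eventually_ball_finite) (auto intro: close Ek d)
      then have "\<forall>\<^sub>F i in sequentially. \<forall>\<^sub>F j in sequentially. \<forall>k\<in>{..n}. l1dist (p i j x) (p i j (\<phi> k x)) < d"
        by eventually_elim (intro eventually_ball_finite, auto)
      then have "\<forall>\<^sub>F i in sequentially. \<forall>\<^sub>F j in sequentially. \<forall>k\<in>{..n}.
          \<forall>\<^sub>F m in sequentially. \<forall>\<^sub>F N in sequentially. \<forall>\<^sub>F K in sequentially. disagree (p i j) (Suc m) N K x (\<phi> k x) < 6 * d"
      proof (elim eventually_mono, intro ballI)
        fix i j k assume "\<forall>k\<in>{..n}. l1dist (p i j x) (p i j (\<phi> k x)) < d" "k \<in> {..n}"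
        then have "\<forall>\<^sub>F m in sequentially. \<forall>\<^sub>F N in sequentially. \<forall>\<^sub>F K in sequentially.
            disagree (p i j) m N K x (\<phi> k x) < 6 * d"
          by (intro disagree_small prob Ek x) auto
        then show "\<forall>\<^sub>F m in sequentially. \<forall>\<^sub>F N in sequentially. \<forall>\<^sub>F K in sequentially.
            disagree (p i j) (Suc m) N K x (\<phi> k x) < 6 * d"
          by (rule eventually_sequentially_Suc[THEN iffD2])
      qed
      then have "\<forall>\<^sub>F i in sequentially. \<forall>\<^sub>F j in sequentially. \<forall>\<^sub>F m in sequentially. \<forall>\<^sub>F N in sequentially. \<forall>\<^sub>F K in sequentially.
          \<forall>k\<in>{..n}. disagree (p i j) (Suc m) N K x (\<phi> k x) < 6 * d"
        by (simp only: eventually_ball_finite_distrib finite_atMost)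
      moreover have "h i j m N K x \<le> ennreal e" if "\<forall>k\<in>{..n}. disagree (p i j) (Suc m) N K x (\<phi> k x) < 6 * d" for i j m N K
      proof -
        have "h i j m N K x \<le> (\<Sum>k\<le>n. ennreal (6 * d))"
          unfolding h_def using that by (intro sum_mono ennreal_leI) (auto intro: less_imp_le)
        also have "\<dots> = ennreal (real (Suc n) * (6 * d))"
          using d by (simp add: ennreal_mult ennreal_of_nat_eq_real_of_nat)
        also have "real (Suc n) * (6 * d) = e" by (simp add: d_def field_simps)
        finally show ?thesis .
      qed
      ultimately have "\<forall>\<^sub>F i in sequentially. \<forall>\<^sub>F j in sequentially. \<forall>\<^sub>F m in sequentially. \<forall>\<^sub>F N in sequentially. \<forall>\<^sub>F K in sequentially.
          h i j m N K x \<le> ennreal e"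
        by (elim eventually_mono)
      then show ?thesis
        by (intro Limsup_bounded) (elim eventually_mono, intro Limsup_bounded, elim eventually_mono,
            intro Limsup_bounded, elim eventually_mono, intro Limsup_bounded, elim eventually_mono,
            intro Limsup_bounded)
    qed
    then have "?l \<le> 0" by (metis ennreal_le_epsilon add_0 ennreal_less_top)
    then show "?l = 0" by simp
  qed
  also have "\<dots> < ennreal \<epsilon>" using \<open>\<epsilon> > 0\<close> by simp
  finally have lt: "limsup (\<lambda>i. limsup (\<lambda>j. limsup (\<lambda>m. limsup (\<lambda>N. limsup (\<lambda>K. \<integral>\<^sup>+x. h i j m N K x \<partial>\<mu>))))) < ennreal \<epsilon>" .
  have ex: "\<exists>i. v i < c" if "limsup v < c" for v :: "nat \<Rightarrow> ennreal" and c
    using eventually_happens'[OF sequentially_bot Limsup_lessD[OF that]] .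
  from ex[OF lt] obtain i where "limsup (\<lambda>j. limsup (\<lambda>m. limsup (\<lambda>N. limsup (\<lambda>K. \<integral>\<^sup>+x. h i j m N K x \<partial>\<mu>)))) < ennreal \<epsilon>" ..
  from ex[OF this] obtain j where "limsup (\<lambda>m. limsup (\<lambda>N. limsup (\<lambda>K. \<integral>\<^sup>+x. h i j m N K x \<partial>\<mu>))) < ennreal \<epsilon>" ..
  from ex[OF this] obtain m where "limsup (\<lambda>N. limsup (\<lambda>K. \<integral>\<^sup>+x. h i j m N K x \<partial>\<mu>)) < ennreal \<epsilon>" ..
  from ex[OF this] obtain N where "limsup (\<lambda>K. \<integral>\<^sup>+x. h i j m N K x \<partial>\<mu>) < ennreal \<epsilon>" ..
  from ex[OF this] obtain K where small: "(\<integral>\<^sup>+x. h i j m N K x \<partial>\<mu>) < ennreal \<epsilon>" ..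
  \<comment> \<open>Interchanging sum and integral turns the bound on the integral of
    \<open>h\<close> into a bound on the average of \<open>s\<close> over the lists, so some list
    has \<open>s ds\<close> below \<epsilon>.\<close>
  define s where "s ds = (\<Sum>k\<le>n. measure \<mu> (bad i j m N ds k))" for ds
  define D where "D = real (card (L m N K))"
  have ib: "integrable \<mu> (indicat_real (bad i j m N ds k))" for ds k
    using bad_sets[of i j m N ds k] \<mu>(2)
    by (intro integrable_real_indicator) (auto simp: \<mu>.emeasure_finite less_top[symmetric])
  have mb: "(\<integral>x. indicat_real (bad i j m N ds k) x \<partial>\<mu>) = measure \<mu> (bad i j m N ds k)" for ds k
  proof -
    have "bad i j m N ds k \<inter> space \<mu> = bad i j m N ds k" by (auto simp: bad_def sp)
    then show ?thesis by simp
  qed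
  have "(\<integral>\<^sup>+x. h i j m N K x \<partial>\<mu>) = (\<integral>\<^sup>+x. ennreal ((\<Sum>k\<le>n. \<Sum>ds\<in>L m N K. indicator (bad i j m N ds k) x) / D) \<partial>\<mu>)"
  proof (rule nn_integral_cong)
    fix x assume "x \<in> space \<mu>"
    then have "h i j m N K x = (\<Sum>k\<le>n. ennreal ((\<Sum>ds\<in>L m N K. indicator (bad i j m N ds k) x) / D))"
      by (simp add: h_def dis sp D_def)
    also have "\<dots> = ennreal ((\<Sum>k\<le>n. \<Sum>ds\<in>L m N K. indicator (bad i j m N ds k) x) / D)"
      unfolding sum_divide_distrib[where A = "{..n}"] by (rule sum_ennreal) (auto simp: D_def intro!: divide_nonneg_nonneg sum_nonneg)
    finally show "h i j m N K x = ennreal ((\<Sum>k\<le>n. \<Sum>ds\<in>L m N K. indicator (bad i j m N ds k) x) / D)" .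
  qed
  also have "\<dots> = ennreal (\<integral>x. (\<Sum>k\<le>n. \<Sum>ds\<in>L m N K. indicator (bad i j m N ds k) x) / D \<partial>\<mu>)"
    by (rule nn_integral_eq_integral)
       (auto simp: D_def intro!: sum_nonneg divide_nonneg_nonneg integrable_divide_zero
          Bochner_Integration.integrable_sum ib)
  also have "(\<integral>x. (\<Sum>k\<le>n. \<Sum>ds\<in>L m N K. indicator (bad i j m N ds k) x) / D \<partial>\<mu>) =
      (\<Sum>k\<le>n. \<Sum>ds\<in>L m N K. measure \<mu> (bad i j m N ds k)) / D"
    by (simp add: Bochner_Integration.integral_sum Bochner_Integration.integrable_sum ib mb
        del: Bochner_Integration.integral_indicator)
  also have "\<dots> = (\<Sum>ds\<in>L m N K. s ds) / D" unfolding s_def by (subst sum.swap) simp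
  finally have avg: "(\<Sum>ds\<in>L m N K. s ds) / D < \<epsilon>"
    using small \<open>\<epsilon> > 0\<close> by (simp add: ennreal_less_iff s_def D_def sum_nonneg)
  have "\<exists>ds. s ds < \<epsilon>"
  proof (rule ccontr)
    assume "\<not> (\<exists>ds. s ds < \<epsilon>)"
    then have "s ds \<ge> \<epsilon>" for ds by (auto simp: not_less)
    then have "D * \<epsilon> \<le> (\<Sum>ds\<in>L m N K. s ds)"
      using sum_mono[of "L m N K" "\<lambda>_. \<epsilon>" s] by (simp add: D_def)
    moreover have "card (darts (Suc m) N) > 0" by (simp add: darts_def card_cartesian_product card_Pow)
    then have "D > 0" by (simp add: D_def L(2))
    ultimately show False using avg \<open>D > 0\<close> by (simp add: field_simps)
  qed
  then obtain ds where ds: "s ds < \<epsilon>" ..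
  show thesis
  proof (rule that)
    show "f i j m N ds \<in> M \<rightarrow>\<^sub>M M" by measurable
    show "(x, f i j m N ds x) \<in> E" if "x \<in> space M" for x
      unfolding f_def by (rule choice_in_class[OF that])
    have "{x \<in> space M. \<exists>k\<le>n. f i j m N ds x \<noteq> f i j m N ds (\<phi> k x)} = (\<Union>k\<in>{..n}. bad i j m N ds k)"
      by (auto simp: bad_def)
    then have "measure \<mu> {x \<in> space M. \<exists>k\<le>n. f i j m N ds x \<noteq> f i j m N ds (\<phi> k x)} \<le> s ds"
      unfolding s_def by (simp only:) (intro \<mu>.finite_measure_subadditive_finite, auto simp: \<mu>(2))
    then show "measure \<mu> {x \<in> space M. \<exists>k\<le>n. f i j m N ds x \<noteq> f i j m N ds (\<phi> k x)} < \<epsilon>" using ds by simp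
  qed
qed

lemma exists_finite_subrelation:
  fixes \<mu> :: "'x measure"
  assumes \<mu>: "prob_space \<mu>" "sets \<mu> = sets M" and amen: "borel_2_amenable M E" and "\<epsilon> > 0"
  obtains F where "F \<in> sets (M \<Otimes>\<^sub>M M)" "equiv (space M) F" "\<And>x. x \<in> space M \<Longrightarrow> finite (F `` {x})" "F \<subseteq> E"
    "measure \<mu> {x \<in> space M. \<exists>k\<le>n. (x, \<phi> k x) \<notin> F} < \<epsilon>"
proof -
  interpret \<mu>: prob_space \<mu> by (rule \<mu>)
  have sp: "space \<mu> = space M" using \<mu>(2) by (rule sets_eq_imp_space_eq)
  note [measurable_cong] = \<mu>(2)
  have "\<epsilon> / 2 > 0" using \<open>\<epsilon> > 0\<close> by simp
  obtain f where f [measurable]: "f \<in> M \<rightarrow>\<^sub>M M" and fE: "\<And>x. x \<in> space M \<Longrightarrow> (x, f x) \<in> E"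
    and f_bad: "measure \<mu> {x \<in> space M. \<exists>k\<le>n. f x \<noteq> f (\<phi> k x)} < \<epsilon> / 2"
    using exists_approx_selector[OF \<mu> amen \<open>\<epsilon> / 2 > 0\<close>, where n = n] by blast
  have [measurable]: "Measurable.pred M (\<lambda>x. f x = f (\<phi> k x))" for k by (rule pred_eq) measurable
  \<comment> \<open>A fibre of f lies in one class but may be infinite. Keeping only the points
    among the first N + 1 enumerated from their common value under f bounds it by N + 1.\<close>
  define R where "R N x \<longleftrightarrow> (\<exists>k\<le>N. x = \<phi> k (f x))" for N :: nat and x
  have [measurable]: "Measurable.pred M (\<lambda>x. x = \<phi> k (f x))" for k by (rule pred_eq) measurable
  have [measurable]: "Measurable.pred M (R N)" for N unfolding R_def by measurable
  \<comment> \<open>Where the truncation loses x or one of its first n + 1 images. Each of these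
    finitely many points is eventually kept, so the sets decrease to the empty set and their
    measures tend to 0.\<close>
  define T where "T N = {x \<in> space M. \<not> R N x \<or> (\<exists>k\<le>n. \<not> R N (\<phi> k x))}" for N
  have T_sets [measurable]: "T N \<in> sets M" for N unfolding T_def by measurable
  have R_mono: "R N x \<Longrightarrow> N \<le> N' \<Longrightarrow> R N' x" for N N' x by (auto simp: R_def intro: order_trans)
  have R_ex: "\<exists>N. R N x" if "x \<in> space M" for x
  proof -
    have "(f x, x) \<in> E" using fE[OF that] equiv_E by (meson equivE symD)
    then show ?thesis by (auto simp: E_eq R_def)
  qed
  have \<phi>_space: "\<phi> k x \<in> space M" if "x \<in> space M" for k x
    using \<phi>_measurable that by (rule measurable_space)
  have "(\<Inter>N. T N) = {}"
  proof (rule equals0I)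
    fix x assume x: "x \<in> (\<Inter>N. T N)"
    then have xM: "x \<in> space M" by (auto simp: T_def)
    obtain N0 where N0: "R N0 x" using R_ex[OF xM] ..
    have "\<forall>k. \<exists>N. R N (\<phi> k x)" using R_ex \<phi>_space[OF xM] by blast
    then obtain N1 where N1: "\<And>k. R (N1 k) (\<phi> k x)" by metis
    define N where "N = max N0 (Max (N1 ` {..n}))"
    have "R N x" using N0 by (rule R_mono) (simp add: N_def)
    moreover have "R N (\<phi> k x)" if "k \<le> n" for k
      using N1 by (rule R_mono) (use that in \<open>auto simp: N_def intro!: max.coboundedI2 Max_ge\<close>)
    ultimately show False using x by (auto simp: T_def)
  qed
  moreover have "decseq T"
  proof (rule decseq_SucI)
    have "R N x \<Longrightarrow> R (Suc N) x" for N x by (erule R_mono) simp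
    then show "T (Suc N) \<subseteq> T N" for N unfolding T_def by blast
  qed
  then have "(\<lambda>N. measure \<mu> (T N)) \<longlonglongrightarrow> measure \<mu> (\<Inter>N. T N)"
    by (intro \<mu>.finite_Lim_measure_decseq) (auto simp: \<mu>(2))
  ultimately have "(\<lambda>N. measure \<mu> (T N)) \<longlonglongrightarrow> 0" by (simp only: measure_empty)
  then have "\<forall>\<^sub>F N in sequentially. measure \<mu> (T N) < \<epsilon> / 2"
    using \<open>\<epsilon> / 2 > 0\<close> by (rule order_tendstoD)
  then obtain N where N: "measure \<mu> (T N) < \<epsilon> / 2" by (auto simp: eventually_sequentially)
  \<comment> \<open>Points discarded by the truncation become singleton classes, which keeps F
    reflexive on the whole space.\<close>
  define F where "F = {w \<in> space (M \<Otimes>\<^sub>M M).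
    fst w = snd w \<or> (f (fst w) = f (snd w) \<and> R N (fst w) \<and> R N (snd w))}"
  have F_iff: "(x, y) \<in> F \<longleftrightarrow> x \<in> space M \<and> y \<in> space M \<and> (x = y \<or> (f x = f y \<and> R N x \<and> R N y))" for x y
    by (auto simp: F_def space_pair_measure)
  show thesis
  proof (rule that)
    have [measurable]: "Measurable.pred (M \<Otimes>\<^sub>M M) (\<lambda>w. fst w = snd w)" by (rule pred_eq) measurable
    have [measurable]: "Measurable.pred (M \<Otimes>\<^sub>M M) (\<lambda>w. f (fst w) = f (snd w))" by (rule pred_eq) measurable
    show "F \<in> sets (M \<Otimes>\<^sub>M M)" unfolding F_def by measurable
    show "equiv (space M) F"
      by (rule equivI) (auto simp: F_iff refl_on_def sym_def trans_def)
    show "finite (F `` {x})" if "x \<in> space M" for x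
    proof (rule finite_subset)
      show "F `` {x} \<subseteq> insert x ((\<lambda>k. \<phi> k (f x)) ` {..N})" by (auto simp: F_iff R_def)
    qed simp
    show "F \<subseteq> E"
    proof clarify
      fix x y assume "(x, y) \<in> F"
      then have xy: "x \<in> space M" "y \<in> space M" "x = y \<or> f x = f y" by (auto simp: F_iff)
      then show "(x, y) \<in> E"
        using fE[of x] fE[of y] equiv_E by (metis equivE refl_onD symD transD)
    qed
    let ?A = "{x \<in> space M. \<exists>k\<le>n. f x \<noteq> f (\<phi> k x)}"
    have A: "?A \<in> sets M" by measurable
    have "{x \<in> space M. \<exists>k\<le>n. (x, \<phi> k x) \<notin> F} \<subseteq> ?A \<union> T N"
      using \<phi>_space by (auto simp: F_iff T_def)
    then have "measure \<mu> {x \<in> space M. \<exists>k\<le>n. (x, \<phi> k x) \<notin> F} \<le> measure \<mu> (?A \<union> T N)"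
      by (intro \<mu>.finite_measure_mono) (use A T_sets \<mu>(2) in auto)
    also have "\<dots> \<le> measure \<mu> ?A + measure \<mu> (T N)"
      by (intro measure_Un_le) (use A T_sets \<mu>(2) in auto)
    also have "\<dots> < \<epsilon>" using N f_bad by simp
    finally show "measure \<mu> {x \<in> space M. \<exists>k\<le>n. (x, \<phi> k x) \<notin> F} < \<epsilon>" .
  qed
qed

theorem borel_2_amenable_imp_measure_hyperfinite:
  assumes amen: "borel_2_amenable M E"
  shows "measure_hyperfinite M E"
  unfolding measure_hyperfinite_def
proof (intro allI impI, elim conjE)
  fix \<mu> :: "'x measure" assume \<mu>: "prob_space \<mu>" "sets \<mu> = sets M"
  interpret \<mu>: prob_space \<mu> by (rule \<mu>)
  have sp: "space \<mu> = space M" using \<mu>(2) by (rule sets_eq_imp_space_eq)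
  have "\<exists>F. F \<in> sets (M \<Otimes>\<^sub>M M) \<and> equiv (space M) F \<and> (\<forall>x\<in>space M. finite (F `` {x})) \<and> F \<subseteq> E \<and>
    measure \<mu> {x \<in> space M. \<exists>k\<le>n. (x, \<phi> k x) \<notin> F} < (1/2) ^ n" for n
    by (rule exists_finite_subrelation[OF \<mu> amen, where n = n and \<epsilon> = "(1/2) ^ n"]) (simp, blast)
  then have "\<forall>n. \<exists>F. F \<in> sets (M \<Otimes>\<^sub>M M) \<and> equiv (space M) F \<and> (\<forall>x\<in>space M. finite (F `` {x})) \<and> F \<subseteq> E \<and>
    measure \<mu> {x \<in> space M. \<exists>k\<le>n. (x, \<phi> k x) \<notin> F} < (1/2) ^ n" ..
  from choice[OF this] obtain F where F_all: "\<forall>n. F n \<in> sets (M \<Otimes>\<^sub>M M) \<and> equiv (space M) (F n) \<and>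
    (\<forall>x\<in>space M. finite (F n `` {x})) \<and> F n \<subseteq> E \<and>
    measure \<mu> {x \<in> space M. \<exists>k\<le>n. (x, \<phi> k x) \<notin> F n} < (1/2) ^ n" ..
  have F: "\<And>n. F n \<in> sets (M \<Otimes>\<^sub>M M)" "\<And>n. equiv (space M) (F n)"
    "\<And>n x. x \<in> space M \<Longrightarrow> finite (F n `` {x})" "\<And>n. F n \<subseteq> E"
    "\<And>n. measure \<mu> {x \<in> space M. \<exists>k\<le>n. (x, \<phi> k x) \<notin> F n} < (1/2) ^ n"
    using F_all by blast+
  have F_pred [measurable]: "Measurable.pred M (\<lambda>x. (x, \<phi> k x) \<in> F n)" for k n
    by (rule pred_sets2[OF F(1)]) measurable
  define A where "A n = {x \<in> space M. \<exists>k\<le>n. (x, \<phi> k x) \<notin> F n}" for n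
  have A_sets [measurable]: "A n \<in> sets M" for n unfolding A_def by measurable
  \<comment> \<open>Capturing each pair of x and an image from some stage on, rather than infinitely
    often, is what lets the tail intersections exhaust the relation.\<close>
  define X where "X = {x \<in> space M. \<forall>k. \<exists>m. \<forall>n\<ge>m. (x, \<phi> k x) \<in> F n}"
  have X_sets [measurable]: "X \<in> sets M" unfolding X_def by measurable
  have "AE x in \<mu>. eventually (\<lambda>n. x \<in> space \<mu> - A n) sequentially"
  proof (rule borel_cantelli_AE1)
    show "A n \<in> sets \<mu>" for n using A_sets \<mu>(2) by simp
    show "emeasure \<mu> (A n) < \<infinity>" for n by (simp add: \<mu>.emeasure_finite less_top[symmetric])
    show "summable (\<lambda>n. measure \<mu> (A n))"
    proof (rule summable_comparison_test[of _ "\<lambda>n. (1/2) ^ n"])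
      show "\<exists>N. \<forall>n\<ge>N. norm (measure \<mu> (A n)) \<le> (1/2) ^ n"
        using F(5) by (auto simp: A_def intro: less_imp_le)
    qed (simp add: summable_geometric)
  qed
  then have "AE x in \<mu>. x \<in> X"
  proof (rule AE_mp, intro AE_I2 impI)
    fix x assume x: "x \<in> space \<mu>" "eventually (\<lambda>n. x \<in> space \<mu> - A n) sequentially"
    then obtain m where m: "\<And>n. n \<ge> m \<Longrightarrow> x \<notin> A n" by (auto simp: eventually_sequentially)
    have "(x, \<phi> k x) \<in> F n" if "n \<ge> max m k" for k n
      using m[of n] that x(1) by (auto simp: A_def sp)
    then have "\<forall>k. \<exists>m. \<forall>n\<ge>m. (x, \<phi> k x) \<in> F n" by blast
    then show "x \<in> X" using x(1) by (auto simp: X_def sp)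
  qed
  then have null: "emeasure \<mu> (space M - X) = 0"
    using X_sets \<mu>(2) sp by (subst (asm) AE_iff_measurable[of "space M - X"]) auto
  \<comment> \<open>The relations F n need not be nested; their tail intersections are, and they
    inherit being an equivalence with finite classes.\<close>
  define G where "G m = (\<Inter>n\<in>{m..}. F n) \<inter> (X \<times> X)" for m
  have XM: "X \<subseteq> space M" by (auto simp: X_def)
  have "borel_hyperfinite_on M X E"
    unfolding borel_hyperfinite_on_def
  proof (intro exI[of _ G] conjI allI ballI)
    fix m
    show "G m \<in> sets (M \<Otimes>\<^sub>M M)"
      unfolding G_def by (intro sets.Int sets.countable_INT' pair_measureI X_sets) (use F(1) in auto)
    show "equiv X (G m)"
    proof (rule equivI)
      show "refl_on X (G m)"
        using F(2) XM by (auto simp: refl_on_def G_def equiv_def)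
      show "sym (G m)" using F(2) by (auto simp: sym_def G_def equiv_def)
      show "trans (G m)"
        using F(2) unfolding trans_def G_def equiv_def by blast
    qed (auto simp: G_def)
    show "finite (G m `` {x})" if "x \<in> X" for x
      by (rule finite_subset[OF _ F(3)[of x m]]) (use that XM in \<open>auto simp: G_def\<close>)
    show "G m \<subseteq> G (Suc m)" by (auto simp: G_def)
  next
    show "(\<Union>m. G m) = E \<inter> X \<times> X"
    proof
      show "(\<Union>m. G m) \<subseteq> E \<inter> X \<times> X" using F(4) by (auto simp: G_def)
      show "E \<inter> X \<times> X \<subseteq> (\<Union>m. G m)"
      proof clarify
        fix x y assume xy: "(x, y) \<in> E" "x \<in> X" "y \<in> X"
        then obtain k where "y = \<phi> k x" by (auto simp: E_eq)
        then obtain m where "\<forall>n\<ge>m. (x, y) \<in> F n" using xy(2) unfolding X_def by blast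
        then show "(x, y) \<in> (\<Union>m. G m)" using xy by (auto simp: G_def)
      qed
    qed
  qed
  then show "\<exists>X'. X' \<in> sets M \<and> emeasure \<mu> (space M - X') = 0 \<and> borel_hyperfinite_on M X' E"
    by (intro exI[of _ X] conjI X_sets null)
qed

end

section \<open>The boundary of a tree\<close>

lemma GeoD: "v \<in> Geo adj \<Longrightarrow> inj v" "v \<in> Geo adj \<Longrightarrow> adj (v n) (v (Suc n))"
  by (auto simp: Geo_def inf_geodesic_def)

lemma GeoI: "inj v \<Longrightarrow> (\<And>n. adj (v n) (v (Suc n))) \<Longrightarrow> v \<in> Geo adj"
  by (auto simp: Geo_def inf_geodesic_def)

lemma Geo_shift: "v \<in> Geo adj \<Longrightarrow> (\<lambda>k. v (k + n)) \<in> Geo adj"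
  by (intro GeoI injI) (auto simp: GeoD(2) dest: injD[OF GeoD(1)])

lemma shift_relI:
  "v \<in> Geo adj \<Longrightarrow> w \<in> Geo adj \<Longrightarrow> (\<And>k. v (k + m) = w (k + n)) \<Longrightarrow> (v, w) \<in> shift_rel adj"
  unfolding shift_rel_def by auto

lemma shift_relD:
  "(v, w) \<in> shift_rel adj \<Longrightarrow> v \<in> Geo adj \<and> w \<in> Geo adj \<and> (\<exists>m n. \<forall>k. v (k + m) = w (k + n))"
  unfolding shift_rel_def by (auto simp: fun_eq_iff)

lemma equiv_shift_rel: "equiv (Geo adj) (shift_rel adj)"
proof (rule equivI)
  show "shift_rel adj \<subseteq> Geo adj \<times> Geo adj" by (auto simp: shift_rel_def)
  show "refl_on (Geo adj) (shift_rel adj)"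
    unfolding refl_on_def using shift_relI[where m = 0 and n = 0] by auto
  show "sym (shift_rel adj)"
  proof (rule symI)
    fix v w assume "(v, w) \<in> shift_rel adj"
    then obtain m n where "v \<in> Geo adj" "w \<in> Geo adj" "\<forall>k. v (k + m) = w (k + n)"
      using shift_relD by blast
    then show "(w, v) \<in> shift_rel adj" by (intro shift_relI[where m = n and n = m]) auto
  qed
  show "trans (shift_rel adj)"
  proof (rule transI)
    fix v w x assume "(v, w) \<in> shift_rel adj" "(w, x) \<in> shift_rel adj"
    then obtain m n a b where *: "v \<in> Geo adj" "x \<in> Geo adj"
      "\<forall>k. v (k + m) = w (k + n)" "\<forall>k. w (k + a) = x (k + b)"
      using shift_relD by metis
    have "v (k + (a + m)) = x (k + (n + b))" for k
      using *(3)[rule_format, of "k + a"] *(4)[rule_format, of "k + n"] by (simp add: ac_simps)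
    then show "(v, x) \<in> shift_rel adj" using * by (intro shift_relI) auto
  qed
qed

lemma successively_map_upt:
  "(\<And>i. m \<le> i \<Longrightarrow> Suc i < n \<Longrightarrow> P (f i) (f (Suc i))) \<Longrightarrow> successively P (map f [m..<n])"
  by (auto simp: successively_conv_nth)

text \<open>Two geodesics from the same vertex that part and meet again would enclose a cycle.\<close>

lemma Geo_eq_if_tail_eq:
  assumes tree: "is_tree adj" and vw: "(v, w) \<in> shift_rel adj" and "v 0 = w 0"
  shows "v = w"
proof (rule ccontr)
  assume "v \<noteq> w"
  obtain m n where v: "v \<in> Geo adj" and w: "w \<in> Geo adj" and tail: "\<forall>k. v (k + m) = w (k + n)"
    using shift_relD[OF vw] by blast
  define a' where "a' = (LEAST i. v i \<noteq> w i)"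
  have "\<exists>i. v i \<noteq> w i" using \<open>v \<noteq> w\<close> by auto
  then have a': "v a' \<noteq> w a'" unfolding a'_def by (rule LeastI_ex)
  then obtain a where a: "a' = Suc a" using \<open>v 0 = w 0\<close> by (cases a') auto
  have eq: "v i = w i" if "i \<le> a" for i
    using not_less_Least[of i "\<lambda>i. v i \<noteq> w i"] that a a'_def by auto
  define Q where "Q b \<longleftrightarrow> a < b \<and> (\<exists>c>a. v b = w c)" for b
  define b where "b = (LEAST b. Q b)"
  have "Q (Suc a + m)" using tail[rule_format, of "Suc a"] by (auto simp: Q_def intro!: exI[of _ "Suc a + n"])
  then have "Q b" unfolding b_def by (rule LeastI)
  then obtain c where b: "a < b" and c: "a < c" "v b = w c" by (auto simp: Q_def)
  have minb: "\<not> Q i" if "i < b" for i using that not_less_Least unfolding b_def by blast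
  \<comment> \<open>The cycle leaves the last common vertex v a along v, stops just before the first
    later vertex of v lying on w beyond a, and returns along w from that vertex. Minimality of b
    makes the two pieces disjoint.\<close>
  define xs where "xs = map v [a..<b] @ rev (map w [Suc a..<Suc c])"
  have sym: "adj x y \<Longrightarrow> adj y x" for x y using tree by (auto simp: is_tree_def dest: sympD)
  have injv: "inj_on v A" and injw: "inj_on w A" for A
    using GeoD(1)[OF v] GeoD(1)[OF w] by (auto intro: inj_on_subset)
  \<comment> \<open>If both indices were \<open>Suc a\<close>, the geodesics would agree one step
    beyond their last common index. This excludes a closed walk of length two.\<close>
  have "b \<noteq> Suc a \<or> c \<noteq> Suc a" using c a' a by auto
  then have "length xs \<ge> 3" using b c by (auto simp: xs_def)
  moreover have "distinct xs"
  proof -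
    have "v i \<noteq> w j" if "a \<le> i" "i < b" "a < j" for i j
    proof (cases "i = a")
      case True
      then show ?thesis using eq[of a] that GeoD(1)[OF w] by (auto dest: injD)
    next
      case False
      then show ?thesis using minb[of i] that by (auto simp: Q_def)
    qed
    then show ?thesis by (auto simp: xs_def distinct_map injv injw)
  qed
  moreover have "\<forall>i. Suc i < length xs \<longrightarrow> adj (xs ! i) (xs ! Suc i)"
  proof -
    have "successively adj (map v [a..<b])" using GeoD(2)[OF v] by (intro successively_map_upt)
    moreover have "successively (\<lambda>x y. adj y x) (map w [Suc a..<Suc c])"
      by (rule successively_map_upt) (rule sym[OF GeoD(2)[OF w]])
    then have "successively adj (rev (map w [Suc a..<Suc c]))" unfolding successively_rev .
    moreover have "adj (last (map v [a..<b])) (hd (rev (map w [Suc a..<Suc c])))"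
    proof -
      have "adj (v (b - 1)) (v (Suc (b - 1)))" using GeoD(2)[OF v] .
      then show ?thesis using b c by (simp add: last_map hd_rev)
    qed
    ultimately have "successively adj xs" unfolding xs_def by (simp add: successively_append_iff)
    then show ?thesis by (simp add: successively_conv_nth)
  qed
  moreover have "adj (last xs) (hd xs)"
  proof -
    have "hd xs = w a" using b eq[of a] by (simp add: xs_def hd_map hd_append)
    moreover have "last xs = w (Suc a)"
      using c by (simp add: xs_def last_append last_rev hd_map del: upt_Suc)
    ultimately show ?thesis using GeoD(2)[OF w, of a] sym by auto
  qed
  ultimately show False using tree unfolding is_tree_def by blast
qed

text \<open>Replaces the first l vertices of v by xs. Only countably many pairs (xs, l) exist, so a
  search over all modifications of v is a countable union.\<close>

definition prepend :: "'v list \<Rightarrow> nat \<Rightarrow> (nat \<Rightarrow> 'v) \<Rightarrow> nat \<Rightarrow> 'v" where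
  "prepend xs l v k = (if k < length xs then xs ! k else v (k - length xs + l))"

lemma prepend_shift_rel:
  "prepend xs l v \<in> Geo adj \<Longrightarrow> v \<in> Geo adj \<Longrightarrow> (prepend xs l v, v) \<in> shift_rel adj"
  by (rule shift_relI[where m = "length xs" and n = l]) (auto simp: prepend_def)

lemma ex_walk:
  assumes "adj\<^sup>*\<^sup>* x y"
  shows "\<exists>xs. xs \<noteq> [] \<and> hd xs = x \<and> last xs = y \<and> successively adj xs"
  using assms
proof induction
  case base
  show ?case by (intro exI[of _ "[x]"]) auto
next
  case (step y z)
  then obtain xs where "xs \<noteq> []" "hd xs = x" "last xs = y" "successively adj xs" by auto
  then show ?case using step(2) by (intro exI[of _ "xs @ [z]"]) (auto simp: successively_append_iff)
qed

text \<open>A shortest walk from r to the range of v repeats no vertex, since a loop could be cut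
  out, and meets v only at its end, since otherwise it could stop earlier. Continuing along v is
  then injective.\<close>

lemma ex_prepend_Geo:
  assumes tree: "is_tree adj" and v: "v \<in> Geo adj"
  shows "\<exists>xs l. prepend xs l v \<in> Geo adj \<and> prepend xs l v 0 = r"
proof -
  define W where "W xs \<longleftrightarrow> xs \<noteq> [] \<and> hd xs = r \<and> last xs \<in> range v \<and> successively adj xs" for xs
  have "\<exists>xs. W xs"
    using ex_walk[of adj r "v 0"] tree by (auto simp: is_tree_def W_def)
  then obtain xs where xs: "W xs" and min: "\<And>ys. W ys \<Longrightarrow> length xs \<le> length ys"
    using ex_has_least_nat[of W _ length] by metis
  then obtain l where l: "last xs = v l" by (auto simp: W_def)
  have ne: "xs \<noteq> []" and adj_xs: "\<And>i. Suc i < length xs \<Longrightarrow> adj (xs ! i) (xs ! Suc i)"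
    using xs by (auto simp: W_def successively_conv_nth)
  have "distinct xs"
  proof (rule ccontr)
    assume "\<not> distinct xs"
    then obtain as bs cs y where dec: "xs = as @ [y] @ bs @ [y] @ cs" using not_distinct_decomp by blast
    have "successively adj ((as @ [y]) @ (bs @ [y] @ cs))" "successively adj ((as @ [y] @ bs) @ ([y] @ cs))"
      using xs unfolding W_def dec by simp_all
    then have "successively adj (as @ [y])" "successively adj ([y] @ cs)"
      unfolding successively_append_iff[of adj "as @ [y]"] successively_append_iff[of adj "as @ [y] @ bs"]
      by blast+
    then have "successively adj ((as @ [y]) @ cs)"
      unfolding successively_append_iff[of adj "as @ [y]"] by (cases cs) auto
    moreover have "hd (as @ [y] @ cs) = hd xs" "last (as @ [y] @ cs) = last xs"
      unfolding dec by (cases as; simp; fail) simp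
    ultimately have "W (as @ [y] @ cs)" using xs unfolding W_def by simp
    then show False using min[of "as @ [y] @ cs"] by (simp add: dec)
  qed
  have off: "xs ! i \<noteq> v j" if "Suc i < length xs" for i j
  proof
    assume "xs ! i = v j"
    have "xs = take (Suc i) xs @ drop (Suc i) xs" by simp
    then have "successively adj (take (Suc i) xs)"
      using xs unfolding W_def by (metis successively_append_iff)
    moreover have "last (take (Suc i) xs) = xs ! i" using that by (simp add: take_Suc_conv_app_nth)
    ultimately have "W (take (Suc i) xs)" using xs \<open>xs ! i = v j\<close> by (auto simp: W_def)
    then show False using min[of "take (Suc i) xs"] that by simp
  qed
  \<comment> \<open>\<open>Suc l\<close> and not l, because the last entry of xs is already v
    l.\<close>
  let ?w = "prepend xs (Suc l) v"
  have "?w \<in> Geo adj"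
  proof (rule GeoI)
    have ij: "?w i \<noteq> ?w j" if "i < j" for i j
    proof (cases "j < length xs")
      case True
      then show ?thesis using that \<open>distinct xs\<close> by (simp add: prepend_def nth_eq_iff_index_eq)
    next
      case j: False
      show ?thesis
      proof (cases "i < length xs")
        case True
        show ?thesis
        proof (cases "Suc i < length xs")
          case True
          then show ?thesis using j off[OF True] by (simp add: prepend_def)
        next
          case False
          then have "i = length xs - 1" using True by linarith
          then have "?w i = v l" using True l ne by (simp add: prepend_def last_conv_nth)
          then show ?thesis using j by (simp add: prepend_def inj_eq[OF GeoD(1)[OF v]])
        qed
      next
        case False
        then show ?thesis using j that by (simp add: prepend_def inj_eq[OF GeoD(1)[OF v]])
      qed
    qed
    show "inj ?w" by (rule injI) (metis ij linorder_neq_iff)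
    fix n
    consider "Suc n < length xs" | "Suc n = length xs" | "length xs \<le> n" by linarith
    then show "adj (?w n) (?w (Suc n))"
    proof cases
      case 1
      then show ?thesis using adj_xs by (simp add: prepend_def)
    next
      case 2
      then have "xs ! n = v l" using l ne by (metis diff_Suc_1 last_conv_nth)
      then show ?thesis using 2 GeoD(2)[OF v, of l] by (simp add: prepend_def)
    next
      case 3
      then have "Suc n - length xs = Suc (n - length xs)" by simp
      then show ?thesis using 3 GeoD(2)[OF v] by (simp add: prepend_def)
    qed
  qed
  moreover have "?w 0 = r" using xs by (auto simp: W_def prepend_def hd_conv_nth)
  ultimately show ?thesis by blast
qed

section \<open>Borel structure of the space of geodesics and of the boundary\<close>

lemma pred_count_space2:
  fixes f :: "'x \<Rightarrow> 'a::countable"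
  assumes "f \<in> N \<rightarrow>\<^sub>M count_space UNIV" "g \<in> N \<rightarrow>\<^sub>M count_space UNIV"
  shows "Measurable.pred N (\<lambda>x. P (f x) (g x))"
proof (rule measurable_compose_countable[where f = "\<lambda>a x. P a (g x)", OF _ assms(1)])
  show "Measurable.pred N (\<lambda>x. P i (g x))" for i
    by (rule measurable_compose[OF assms(2)]) simp
qed

lemma Geo_sets:
  fixes adj :: "'v::countable \<Rightarrow> 'v \<Rightarrow> bool"
  shows "Geo adj \<in> sets (Pi\<^sub>M UNIV (\<lambda>_::nat. count_space UNIV))"
proof -
  let ?M = "Pi\<^sub>M UNIV (\<lambda>_::nat. count_space (UNIV :: 'v set))"
  have c: "(\<lambda>v. v i) \<in> ?M \<rightarrow>\<^sub>M count_space UNIV" for i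
    by (rule measurable_component_singleton) simp
  have [measurable]: "Measurable.pred ?M (\<lambda>v. v i = v j \<longrightarrow> i = j)" for i j
    by (rule pred_count_space2[OF c c, where P = "\<lambda>a b. a = b \<longrightarrow> i = j"])
  have [measurable]: "Measurable.pred ?M (\<lambda>v. adj (v n) (v (Suc n)))" for n
    by (rule pred_count_space2[OF c c])
  have "Geo adj = {v \<in> space ?M. (\<forall>i j. v i = v j \<longrightarrow> i = j) \<and> (\<forall>n. adj (v n) (v (Suc n)))}"
    by (auto simp: Geo_def inf_geodesic_def inj_def space_PiM)
  also have "\<dots> \<in> sets ?M" by measurable
  finally show ?thesis .
qed

lemma space_GeoM: "space (GeoM adj) = Geo adj"
  by (auto simp: GeoM_def space_restrict_space space_PiM)

lemma coordinate_measurable: "(\<lambda>v. v i) \<in> GeoM adj \<rightarrow>\<^sub>M count_space UNIV"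
  unfolding GeoM_def by (intro measurable_restrict_space1 measurable_component_singleton) simp

lemma measurable_into_sequences:
  assumes "\<And>k. (\<lambda>x. T x k) \<in> N \<rightarrow>\<^sub>M count_space UNIV"
  shows "T \<in> N \<rightarrow>\<^sub>M Pi\<^sub>M UNIV (\<lambda>_::nat. count_space UNIV)"
  using measurable_PiM_single'[of UNIV "\<lambda>k x. T x k" N "\<lambda>_. count_space UNIV"] assms by auto

lemma measurable_into_GeoM:
  assumes "\<And>k. (\<lambda>x. T x k) \<in> N \<rightarrow>\<^sub>M count_space UNIV" "\<And>x. x \<in> space N \<Longrightarrow> T x \<in> Geo adj"
  shows "T \<in> N \<rightarrow>\<^sub>M GeoM adj"
  unfolding GeoM_def using assms by (intro measurable_restrict_space2 measurable_into_sequences) auto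

lemma shift_measurable: "(\<lambda>v k. v (k + n)) \<in> GeoM adj \<rightarrow>\<^sub>M GeoM adj"
  by (intro measurable_into_GeoM coordinate_measurable) (simp add: space_GeoM Geo_shift)

lemma space_boundaryM: "space (boundaryM adj) = boundary adj"
  unfolding boundaryM_def by (rule space_measure_of) auto

locale rooted_tree =
  fixes adj :: "'v::countable \<Rightarrow> 'v \<Rightarrow> bool" and root :: 'v
  assumes tree: "is_tree adj"
begin

definition endpt :: "(nat \<Rightarrow> 'v) \<Rightarrow> (nat \<Rightarrow> 'v) set" where
  "endpt v = shift_rel adj `` {v}"

text \<open>A section of the quotient map onto the boundary. Each end has exactly one geodesic
  issuing from the root: connectedness gives existence, acyclicity uniqueness.\<close>

definition ray :: "(nat \<Rightarrow> 'v) set \<Rightarrow> nat \<Rightarrow> 'v" where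
  "ray \<xi> = (THE w. w \<in> \<xi> \<and> w 0 = root)"

lemma endpt_in_boundary: "v \<in> Geo adj \<Longrightarrow> endpt v \<in> boundary adj"
  unfolding boundary_def endpt_def by (rule quotientI)

lemma endpt_eq_iff: "v \<in> Geo adj \<Longrightarrow> w \<in> Geo adj \<Longrightarrow> endpt v = endpt w \<longleftrightarrow> (v, w) \<in> shift_rel adj"
  unfolding endpt_def by (rule eq_equiv_class_iff[OF equiv_shift_rel])

lemma in_boundaryD:
  assumes "\<xi> \<in> boundary adj" "v \<in> \<xi>"
  shows "v \<in> Geo adj" "endpt v = \<xi>"
proof -
  obtain w where w: "w \<in> Geo adj" "\<xi> = shift_rel adj `` {w}"
    using assms(1) unfolding boundary_def by (rule quotientE)
  then have wv: "(w, v) \<in> shift_rel adj" using assms(2) by simp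
  then show "v \<in> Geo adj" using shift_relD by blast
  show "endpt v = \<xi>" unfolding endpt_def w(2) using equiv_class_eq[OF equiv_shift_rel wv] by simp
qed

lemma in_endpt: "v \<in> Geo adj \<Longrightarrow> v \<in> endpt v"
  unfolding endpt_def by (rule equiv_class_self[OF equiv_shift_rel])

lemma ray_eqI:
  assumes "\<xi> \<in> boundary adj" "w \<in> \<xi>" "w 0 = root"
  shows "ray \<xi> = w"
  unfolding ray_def
proof (rule the_equality)
  fix w' assume w': "w' \<in> \<xi> \<and> w' 0 = root"
  have "(w', w) \<in> shift_rel adj"
    using assms w' in_boundaryD by (metis endpt_eq_iff)
  then show "w' = w" using Geo_eq_if_tail_eq[OF tree] w' assms(3) by simp
qed (use assms in simp)

lemma prepend_in_endpt:
  assumes "v \<in> Geo adj" "prepend xs l v \<in> Geo adj"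
  shows "prepend xs l v \<in> endpt v"
  using prepend_shift_rel[OF assms(2,1)] assms endpt_eq_iff in_endpt by metis

lemma ray_endpt:
  assumes "v \<in> Geo adj"
  obtains xs l where "ray (endpt v) = prepend xs l v" "prepend xs l v \<in> Geo adj" "prepend xs l v 0 = root"
  using ex_prepend_Geo[OF tree assms, of root] ray_eqI[OF endpt_in_boundary prepend_in_endpt] assms
  by metis

lemma ray_in:
  assumes "\<xi> \<in> boundary adj"
  shows "ray \<xi> \<in> \<xi>"
proof -
  obtain v where v: "v \<in> Geo adj" "\<xi> = endpt v"
    using assms unfolding boundary_def endpt_def by (auto elim: quotientE)
  then show ?thesis using prepend_in_endpt ray_endpt by metis
qed

lemma ray_Geo: "\<xi> \<in> boundary adj \<Longrightarrow> ray \<xi> \<in> Geo adj"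
  and endpt_ray: "\<xi> \<in> boundary adj \<Longrightarrow> endpt (ray \<xi>) = \<xi>"
  using in_boundaryD ray_in by blast+

lemma Union_boundary_eq:
  assumes "A \<subseteq> boundary adj"
  shows "\<Union>A = {v \<in> Geo adj. endpt v \<in> A}"
  using assms in_boundaryD in_endpt by blast

lemma endpt_measurable: "endpt \<in> GeoM adj \<rightarrow>\<^sub>M boundaryM adj"
  unfolding boundaryM_def
proof (rule measurable_measure_of)
  fix A assume A: "A \<in> {A. A \<subseteq> boundary adj \<and> \<Union>A \<in> sets (GeoM adj)}"
  have "endpt -` A \<inter> space (GeoM adj) = \<Union>A"
    using A Union_boundary_eq[of A] by (auto simp: space_GeoM)
  then show "endpt -` A \<inter> space (GeoM adj) \<in> sets (GeoM adj)" using A by simp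
qed (auto simp: space_GeoM endpt_in_boundary)

text \<open>The geodesic from the root equivalent to v is one of the countably many
  \<open>prepend xs l v\<close>. The union of the ends whose ray lies in A is therefore a countable
  union of Borel sets of geodesics, which is what a Borel set of ends requires.\<close>

lemma ray_measurable: "ray \<in> boundaryM adj \<rightarrow>\<^sub>M GeoM adj"
proof (rule measurableI)
  fix \<xi> assume "\<xi> \<in> space (boundaryM adj)"
  then show "ray \<xi> \<in> space (GeoM adj)" by (simp add: space_boundaryM space_GeoM ray_Geo)
next
  fix A assume "A \<in> sets (GeoM adj)"
  let ?P = "Pi\<^sub>M UNIV (\<lambda>_::nat. count_space (UNIV :: 'v set))"
  have A: "A \<in> sets ?P" "A \<subseteq> Geo adj"
    using \<open>A \<in> sets (GeoM adj)\<close> Geo_sets[of adj]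
    by (auto simp: GeoM_def sets_restrict_space_iff space_PiM)
  let ?S = "ray -` A \<inter> space (boundaryM adj)"
  have "\<Union>?S = {v \<in> Geo adj. ray (endpt v) \<in> A}"
    by (subst Union_boundary_eq) (auto simp: space_boundaryM endpt_in_boundary)
  also have "\<dots> = (\<Union>xs. \<Union>l. {v \<in> space (GeoM adj). prepend xs l v \<in> {w \<in> A. w 0 = root}})"
  proof (intro Set.set_eqI iffI)
    fix v assume v: "v \<in> {v \<in> Geo adj. ray (endpt v) \<in> A}"
    then obtain xs l where "ray (endpt v) = prepend xs l v" "prepend xs l v 0 = root"
      using ray_endpt[of v] by blast
    then show "v \<in> (\<Union>xs. \<Union>l. {v \<in> space (GeoM adj). prepend xs l v \<in> {w \<in> A. w 0 = root}})"
      using v by (auto simp: space_GeoM)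
  next
    fix v assume "v \<in> (\<Union>xs. \<Union>l. {v \<in> space (GeoM adj). prepend xs l v \<in> {w \<in> A. w 0 = root}})"
    then obtain xs l where v: "v \<in> Geo adj" "prepend xs l v \<in> A" "prepend xs l v 0 = root"
      by (auto simp: space_GeoM)
    then have "ray (endpt v) = prepend xs l v"
      using A(2) by (intro ray_eqI endpt_in_boundary prepend_in_endpt) auto
    then show "v \<in> {v \<in> Geo adj. ray (endpt v) \<in> A}" using v by simp
  qed
  also have "\<dots> \<in> sets (GeoM adj)"
  proof (intro sets.countable_UN'' countableI_type)
    fix xs :: "'v list" and l
    have "prepend xs l \<in> GeoM adj \<rightarrow>\<^sub>M ?P"
    proof (rule measurable_into_sequences)
      fix k
      show "(\<lambda>v. prepend xs l v k) \<in> GeoM adj \<rightarrow>\<^sub>M count_space UNIV"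
        by (cases "k < length xs") (simp_all add: prepend_def coordinate_measurable)
    qed
    moreover have "{w \<in> A. w 0 = root} \<in> sets ?P"
    proof -
      have "{w \<in> A. w 0 = root} = A \<inter> ((\<lambda>w. w 0) -` {root} \<inter> space ?P)"
        by (auto simp: space_PiM)
      also have "\<dots> \<in> sets ?P"
        using A by (intro sets.Int measurable_sets[OF measurable_component_singleton]) auto
      finally show ?thesis .
    qed
    ultimately show "{v \<in> space (GeoM adj). prepend xs l v \<in> {w \<in> A. w 0 = root}} \<in> sets (GeoM adj)"
      by (rule pred_sets2[rotated, unfolded pred_def])
  qed
  finally have "\<Union>?S \<in> sets (GeoM adj)" .
  then show "?S \<in> sets (boundaryM adj)"
    unfolding boundaryM_def
    by (subst sets_measure_of) (auto simp: space_boundaryM[unfolded boundaryM_def] intro!: sigma_sets.Basic)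
qed

end

section \<open>The induced action on the boundary\<close>

locale tree_action = rooted_tree adj root + group G
  for adj :: "'v::countable \<Rightarrow> 'v \<Rightarrow> bool" and root :: 'v and G :: "('g, 'b) monoid_scheme" (structure) +
  fixes act :: "'g \<Rightarrow> 'v \<Rightarrow> 'v"
  assumes countable_carrier: "countable (carrier G)"
    and action: "tree_aut_action G adj act"
begin

lemma act_inj: "g \<in> carrier G \<Longrightarrow> inj (act g)"
  using action by (auto simp: tree_aut_action_def bij_def)

lemma act_adj: "g \<in> carrier G \<Longrightarrow> adj (act g u) (act g w) \<longleftrightarrow> adj u w"
  using action by (auto simp: tree_aut_action_def)

lemma act_one: "act \<one> u = u"
  using action by (auto simp: tree_aut_action_def)

lemma act_mult: "g \<in> carrier G \<Longrightarrow> h \<in> carrier G \<Longrightarrow> act (g \<otimes> h) u = act g (act h u)"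
  using action by (auto simp: tree_aut_action_def)

lemma act_inv: "g \<in> carrier G \<Longrightarrow> act (inv g) (act g u) = u"
  using act_mult[of "inv g" g u] by (simp add: act_one)

lemma act_inv': "g \<in> carrier G \<Longrightarrow> act g (act (inv g) u) = u"
  using act_mult[of g "inv g" u] by (simp add: act_one)

definition mv :: "'g \<Rightarrow> (nat \<Rightarrow> 'v) \<Rightarrow> nat \<Rightarrow> 'v" where
  "mv g v = act g \<circ> v"

lemma mv_Geo: "g \<in> carrier G \<Longrightarrow> v \<in> Geo adj \<Longrightarrow> mv g v \<in> Geo adj"
  unfolding mv_def
  by (rule GeoI, rule inj_compose[OF act_inj GeoD(1)]) (auto simp: act_adj GeoD(2))

lemma mv_mult: "g \<in> carrier G \<Longrightarrow> h \<in> carrier G \<Longrightarrow> mv (g \<otimes> h) v = mv g (mv h v)"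
  by (auto simp: mv_def act_mult)

lemma mv_measurable: "g \<in> carrier G \<Longrightarrow> mv g \<in> GeoM adj \<rightarrow>\<^sub>M GeoM adj"
proof (rule measurable_into_GeoM)
  show "(\<lambda>v. mv g v k) \<in> GeoM adj \<rightarrow>\<^sub>M count_space UNIV" for k
    unfolding mv_def comp_def by (rule measurable_compose[OF coordinate_measurable]) simp
qed (simp add: space_GeoM mv_Geo)

lemma mv_shift_rel:
  assumes "g \<in> carrier G" "(v, w) \<in> shift_rel adj"
  shows "(mv g v, mv g w) \<in> shift_rel adj"
proof -
  obtain m n where "v \<in> Geo adj" "w \<in> Geo adj" "\<forall>k. v (k + m) = w (k + n)"
    using shift_relD[OF assms(2)] by blast
  then show ?thesis
    using assms(1) by (intro shift_relI[where m = m and n = n] mv_Geo) (auto simp: mv_def)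
qed

lemma bdry_act_endpt:
  assumes g: "g \<in> carrier G" and v: "v \<in> Geo adj"
  shows "bdry_act act g (endpt v) = endpt (mv g v)"
proof -
  have "(mv g v, w) \<in> shift_rel adj \<Longrightarrow> \<exists>w'. (v, w') \<in> shift_rel adj \<and> w = mv g w'" for w
    using mv_shift_rel[of "inv g" "mv g v" w] g
    by (intro exI[of _ "mv (inv g) w"]) (auto simp: mv_def act_inv act_inv' comp_def)
  then show ?thesis
    unfolding bdry_act_def endpt_def using mv_shift_rel[OF g] by (auto simp: mv_def[symmetric])
qed

lemma bdry_act_eq:
  "g \<in> carrier G \<Longrightarrow> \<xi> \<in> boundary adj \<Longrightarrow> bdry_act act g \<xi> = endpt (mv g (ray \<xi>))"
  using bdry_act_endpt[of g "ray \<xi>"] by (simp add: endpt_ray ray_Geo)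

lemma bdry_act_boundary: "g \<in> carrier G \<Longrightarrow> \<xi> \<in> boundary adj \<Longrightarrow> bdry_act act g \<xi> \<in> boundary adj"
  by (simp add: bdry_act_eq endpt_in_boundary mv_Geo ray_Geo)

lemma bdry_act_one: "bdry_act act \<one> \<xi> = \<xi>"
  by (auto simp: bdry_act_def act_one comp_def)

lemma bdry_act_mult:
  "g \<in> carrier G \<Longrightarrow> h \<in> carrier G \<Longrightarrow> bdry_act act (g \<otimes> h) \<xi> = bdry_act act g (bdry_act act h \<xi>)"
  by (auto simp: bdry_act_def image_image comp_def act_mult)

lemma bdry_act_measurable:
  assumes "g \<in> carrier G"
  shows "bdry_act act g \<in> boundaryM adj \<rightarrow>\<^sub>M boundaryM adj"
proof -
  have "(\<lambda>\<xi>. endpt (mv g (ray \<xi>))) \<in> boundaryM adj \<rightarrow>\<^sub>M boundaryM adj"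
    using measurable_compose[OF ray_measurable measurable_compose[OF mv_measurable[OF assms] endpt_measurable]] .
  moreover have "bdry_act act g \<in> boundaryM adj \<rightarrow>\<^sub>M boundaryM adj \<longleftrightarrow>
      (\<lambda>\<xi>. endpt (mv g (ray \<xi>))) \<in> boundaryM adj \<rightarrow>\<^sub>M boundaryM adj"
    by (rule measurable_cong) (simp add: space_boundaryM bdry_act_eq assms)
  ultimately show ?thesis by blast
qed

abbreviation E where "E \<equiv> orbit_rel_bdry G adj act"

lemma equiv_orbit_rel: "equiv (boundary adj) E"
proof (rule equivI)
  show "E \<subseteq> boundary adj \<times> boundary adj" by (auto simp: orbit_rel_bdry_def)
  show "refl_on (boundary adj) E"
    by (auto simp: refl_on_def orbit_rel_bdry_def intro!: bexI[of _ \<one>] bdry_act_one)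
  show "sym E"
  proof (rule symI)
    fix \<xi> \<eta> assume "(\<xi>, \<eta>) \<in> E"
    then obtain g where g: "g \<in> carrier G" "\<xi> \<in> boundary adj" "\<eta> \<in> boundary adj" "bdry_act act g \<xi> = \<eta>"
      by (auto simp: orbit_rel_bdry_def)
    then have "bdry_act act (inv g) \<eta> = \<xi>"
      using bdry_act_mult[of "inv g" g \<xi>] by (auto simp: bdry_act_one)
    then show "(\<eta>, \<xi>) \<in> E" using g by (auto simp: orbit_rel_bdry_def)
  qed
  show "trans E"
  proof (rule transI)
    fix \<xi> \<eta> \<zeta> assume "(\<xi>, \<eta>) \<in> E" "(\<eta>, \<zeta>) \<in> E"
    then obtain g h where "g \<in> carrier G" "bdry_act act g \<xi> = \<eta>" "h \<in> carrier G" "bdry_act act h \<eta> = \<zeta>"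
      and b: "\<xi> \<in> boundary adj" "\<zeta> \<in> boundary adj"
      by (auto simp: orbit_rel_bdry_def)
    then have "h \<otimes> g \<in> carrier G" "bdry_act act (h \<otimes> g) \<xi> = \<zeta>" by (auto simp: bdry_act_mult)
    then show "(\<xi>, \<zeta>) \<in> E" using b by (auto simp: orbit_rel_bdry_def)
  qed
qed

definition nth_elt :: "nat \<Rightarrow> 'g" where
  "nth_elt = from_nat_into (carrier G)"

lemma nth_elt: "nth_elt k \<in> carrier G"
  unfolding nth_elt_def by (rule from_nat_into) (use one_closed in blast)

lemma nth_elt_surj: "g \<in> carrier G \<Longrightarrow> \<exists>k. nth_elt k = g"
  unfolding nth_elt_def by (rule from_nat_into_surj[OF countable_carrier])

text \<open>The number n codes a position and a vertex. Distinct ends have rays that differ at some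
  position, so these countably many sets separate ends.\<close>

definition sep_set :: "nat \<Rightarrow> (nat \<Rightarrow> 'v) set set" where
  "sep_set n = {\<xi> \<in> boundary adj. ray \<xi> (fst (prod_decode n)) = from_nat (snd (prod_decode n))}"

lemma cber_maps_boundary: "cber_maps (boundaryM adj) (\<lambda>k. bdry_act act (nth_elt k)) sep_set E"
proof (rule cber_maps.intro)
  show "bdry_act act (nth_elt k) \<in> boundaryM adj \<rightarrow>\<^sub>M boundaryM adj" for k
    by (rule bdry_act_measurable[OF nth_elt])
  show "sep_set n \<in> sets (boundaryM adj)" for n
  proof -
    have "Measurable.pred (boundaryM adj) (\<lambda>\<xi>. ray \<xi> (fst (prod_decode n)) = from_nat (snd (prod_decode n)))"
      by (rule measurable_compose[OF ray_measurable measurable_compose[OF coordinate_measurable]]) simp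
    then show ?thesis unfolding sep_set_def space_boundaryM[symmetric] by measurable
  qed
  show "\<exists>n. \<xi> \<in> sep_set n \<longleftrightarrow> \<eta> \<notin> sep_set n"
    if "\<xi> \<in> space (boundaryM adj)" "\<eta> \<in> space (boundaryM adj)" "\<xi> \<noteq> \<eta>" for \<xi> \<eta>
  proof -
    have b: "\<xi> \<in> boundary adj" "\<eta> \<in> boundary adj" using that by (auto simp: space_boundaryM)
    then have "ray \<xi> \<noteq> ray \<eta>" using endpt_ray that(3) by metis
    then obtain k where "ray \<xi> k \<noteq> ray \<eta> k" by auto
    then show ?thesis
      using b by (intro exI[of _ "prod_encode (k, to_nat (ray \<xi> k))"]) (auto simp: sep_set_def)
  qed
  show "E = {(\<xi>, \<eta>). \<xi> \<in> space (boundaryM adj) \<and> (\<exists>k. \<eta> = bdry_act act (nth_elt k) \<xi>)}"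
  proof (intro Set.set_eqI iffI)
    fix x assume "x \<in> E"
    then obtain \<xi> \<eta> g where x: "x = (\<xi>, \<eta>)" "\<xi> \<in> boundary adj" "g \<in> carrier G" "bdry_act act g \<xi> = \<eta>"
      by (auto simp: orbit_rel_bdry_def)
    obtain k where "nth_elt k = g" using nth_elt_surj[OF x(3)] ..
    then show "x \<in> {(\<xi>, \<eta>). \<xi> \<in> space (boundaryM adj) \<and> (\<exists>k. \<eta> = bdry_act act (nth_elt k) \<xi>)}"
      using x by (auto simp: space_boundaryM)
  next
    fix x assume "x \<in> {(\<xi>, \<eta>). \<xi> \<in> space (boundaryM adj) \<and> (\<exists>k. \<eta> = bdry_act act (nth_elt k) \<xi>)}"
    then show "x \<in> E"
      using nth_elt by (auto simp: orbit_rel_bdry_def space_boundaryM bdry_act_boundary)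
  qed
  show "equiv (space (boundaryM adj)) E" using equiv_orbit_rel by (simp add: space_boundaryM)
qed

end

section \<open>Almost invariant finite sets of group elements\<close>

lemma infsum_abs_diff_eq_l1dist:
  assumes "is_prob A p" "is_prob A q"
  shows "(\<Sum>\<^sub>\<infinity>a\<in>A. \<bar>p a - q a\<bar>) = l1dist p q"
  unfolding l1dist_def using assms by (intro infsum_cong_neutral) (auto simp: is_prob_def)

text \<open>Replacing p by the distribution of xs costs at most \<open>l1dist p (emp xs)\<close> on
  each side, and applying \<psi> afterwards costs nothing. In the application \<phi>1 and \<phi>2
  take values in cosets, and \<psi> reads a coset as a geodesic.\<close>

lemma l1dist_push_emp_le:
  assumes p: "is_prob A p" and xs: "xs \<noteq> []" "set xs \<subseteq> A"
  shows "l1dist (emp (map (\<lambda>h. \<psi> (\<phi>1 h)) xs)) (emp (map (\<lambda>h. \<psi> (\<phi>2 h)) xs))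
    \<le> l1dist (push \<phi>1 A p) (push \<phi>2 A p) + 2 * l1dist p (emp xs)"
proof -
  have e: "is_prob A (emp xs)" using xs by (rule is_prob_emp)
  have pA: "p summable_on A"
    using is_prob_summable[OF p] summable_on_subset_banach by blast
  have eA: "emp xs summable_on A" by (rule emp_summable)
  have 1: "l1dist (push f A (emp xs)) (push f A p) \<le> l1dist p (emp xs)" for f :: "'a \<Rightarrow> 'b"
    using l1dist_push_le[OF eA pA, of f] infsum_abs_diff_eq_l1dist[OF e p] by (simp add: l1dist_commute)
  let ?f1 = "\<lambda>h. \<psi> (\<phi>1 h)" and ?f2 = "\<lambda>h. \<psi> (\<phi>2 h)"
  have pp: "push (\<lambda>h. \<psi> (\<phi> h)) A p = push \<psi> UNIV (push \<phi> A p)" for \<phi>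
    using push_push[OF pA, of \<psi> \<phi>] by auto
  have 2: "l1dist (push ?f1 A p) (push ?f2 A p) \<le> l1dist (push \<phi>1 A p) (push \<phi>2 A p)"
    unfolding pp by (intro l1dist_push_UNIV_le push_summable pA)
  have "l1dist (push ?f1 A (emp xs)) (push ?f2 A (emp xs))
      \<le> l1dist (push ?f1 A (emp xs)) (push ?f1 A p) + l1dist (push ?f1 A p) (push ?f2 A (emp xs))"
    by (intro l1dist_triangle push_summable pA eA)
  also have "l1dist (push ?f1 A p) (push ?f2 A (emp xs))
      \<le> l1dist (push ?f1 A p) (push ?f2 A p) + l1dist (push ?f2 A p) (push ?f2 A (emp xs))"
    by (intro l1dist_triangle push_summable pA eA)
  finally have "l1dist (push ?f1 A (emp xs)) (push ?f2 A (emp xs))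
      \<le> l1dist (push \<phi>1 A p) (push \<phi>2 A p) + 2 * l1dist p (emp xs)"
    using 1[of ?f1] 1[of ?f2] 2 l1dist_commute[of "push ?f2 A p" "push ?f2 A (emp xs)"] by simp
  then show ?thesis by (simp only: emp_map[OF xs(2)])
qed

lemma count_list_map_nth: "count_list (map \<phi> P) z = (\<Sum>i<length P. of_bool (\<phi> (P ! i) = z))"
proof (induction P)
  case (Cons x P)
  then show ?case by (simp add: sum.lessThan_Suc_shift del: sum.lessThan_Suc)
qed simp

text \<open>The distance depends only on which pairs of points coincide, which makes it measurable.\<close>

lemma l1dist_emp_map_eq:
  fixes \<phi> :: "'a \<Rightarrow> 'b"
  defines "F \<equiv> \<lambda>P Q. set P \<union> set Q"
  shows "l1dist (emp (map \<phi> P)) (emp (map \<phi> Q)) =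
    (\<Sum>a\<in>F P Q. \<bar>(\<Sum>i<length P. of_bool (\<phi> (P ! i) = \<phi> a)) / real (length P)
        - (\<Sum>i<length Q. of_bool (\<phi> (Q ! i) = \<phi> a)) / real (length Q)\<bar>
      / (\<Sum>b\<in>F P Q. of_bool (\<phi> b = \<phi> a)))"
proof -
  let ?d = "\<lambda>z. \<bar>emp (map \<phi> P) z - emp (map \<phi> Q) z\<bar>"
  define S where "S = F P Q"
  have fin: "finite S" by (simp add: S_def F_def)
  have "l1dist (emp (map \<phi> P)) (emp (map \<phi> Q)) = (\<Sum>\<^sub>\<infinity>z\<in>\<phi> ` S. ?d z)"
    unfolding l1dist_def
  proof (rule infsum_cong_neutral)
    fix z assume "z \<in> UNIV - \<phi> ` S"
    then have "emp (map \<phi> P) z = 0" "emp (map \<phi> Q) z = 0" by (auto simp: S_def F_def intro!: emp_eq_0)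
    then show "?d z = 0" by simp
  qed auto
  also have "\<dots> = (\<Sum>z\<in>\<phi> ` S. ?d z)" using fin by simp
  \<comment> \<open>The term of each image point is shared equally among its preimages, so that the
    index set no longer depends on \<phi>.\<close>
  also have "\<dots> = (\<Sum>z\<in>\<phi> ` S. \<Sum>a\<in>{a \<in> S. \<phi> a = z}. ?d z / real (card {b \<in> S. \<phi> b = z}))"
  proof (rule sum.cong)
    fix z assume "z \<in> \<phi> ` S"
    then have "card {b \<in> S. \<phi> b = z} \<noteq> 0" using fin by auto
    then show "?d z = (\<Sum>a\<in>{a \<in> S. \<phi> a = z}. ?d z / real (card {b \<in> S. \<phi> b = z}))" by simp
  qed simp
  also have "\<dots> = (\<Sum>z\<in>\<phi> ` S. \<Sum>a\<in>{a \<in> S. \<phi> a = z}. ?d (\<phi> a) / real (card {b \<in> S. \<phi> b = \<phi> a}))"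
    by (intro sum.cong) auto
  also have "\<dots> = (\<Sum>a\<in>S. ?d (\<phi> a) / real (card {b \<in> S. \<phi> b = \<phi> a}))"
    by (rule sum.image_gen[OF fin, symmetric])
  also have "\<dots> = (\<Sum>a\<in>S. ?d (\<phi> a) / (\<Sum>b\<in>S. of_bool (\<phi> b = \<phi> a)))"
    using fin by (intro sum.cong) (auto simp: Int_def)
  finally show ?thesis
    unfolding emp_def count_list_map_nth S_def by (simp add: of_nat_sum)
qed

section \<open>Orbits of segments and invariant coamenability\<close>

context tree_action
begin

definition seg :: "nat \<Rightarrow> (nat \<Rightarrow> 'v) \<Rightarrow> 'v list" where
  "seg l v = map v [0..<Suc l]"

definition Stab :: "'v list \<Rightarrow> 'g set" where
  "Stab \<sigma> = {g \<in> carrier G. map (act g) \<sigma> = \<sigma>}"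

text \<open>The predicate depends only on the orbit of the segment, hence so does the choice.\<close>

definition rep :: "'v list \<Rightarrow> 'v list" where
  "rep \<sigma> = (SOME \<tau>. \<exists>g\<in>carrier G. map (act g) \<sigma> = \<tau>)"

text \<open>Not canonical, unlike \<open>rep\<close>: two elements taking \<sigma> to
  \<open>rep \<sigma>\<close> differ by left multiplication with an element of
  \<open>Stab (rep \<sigma>)\<close>. Almost invariance under that group absorbs the
  ambiguity.\<close>

definition to_rep :: "'v list \<Rightarrow> 'g" where
  "to_rep \<sigma> = (SOME g. g \<in> carrier G \<and> map (act g) \<sigma> = rep \<sigma>)"

definition movers :: "(nat \<Rightarrow> 'v) \<Rightarrow> nat \<Rightarrow> 'g set" where
  "movers v l = {a \<in> carrier G. map (act a) (seg l v) = rep (seg l v)}"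

text \<open>A copy of the coset space in the hypothesis: with t one mover, H the stabiliser of the
  segment and K that of v, the coset hK corresponds to \<open>mv (t \<otimes> h) v\<close>.\<close>

definition moved :: "(nat \<Rightarrow> 'v) \<Rightarrow> nat \<Rightarrow> (nat \<Rightarrow> 'v) set" where
  "moved v l = (\<lambda>a. mv a v) ` movers v l"

text \<open>The number j fixes both the tested elements, those of the first j + 1 in the enumeration
  that lie in H, and the tolerance. Every element of H is tested from some j on.\<close>

definition almost_inv :: "'g set \<Rightarrow> (nat \<Rightarrow> 'v) set \<Rightarrow> nat \<Rightarrow> 'g list \<Rightarrow> bool" where
  "almost_inv H Y j P \<longleftrightarrow> P \<noteq> [] \<and> set P \<subseteq> H \<and> (\<forall>s\<in>nth_elt ` {..j} \<inter> H. \<forall>y\<in>Y.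
     l1dist (emp (map (\<lambda>h. mv h y) P)) (emp (map (\<lambda>h. mv h (mv s y)) P)) < 1 / real (Suc j))"

text \<open>Stated through the representative segment and \<open>moved\<close>, so that it depends
  only on the orbit of v and can be expressed with countable quantifiers.\<close>

definition coamenable :: "(nat \<Rightarrow> 'v) \<Rightarrow> nat \<Rightarrow> bool" where
  "coamenable v l \<longleftrightarrow> (\<forall>j. \<exists>P. almost_inv (Stab (rep (seg l v))) (moved v l) j P)"

lemma map_act_mult:
  "g \<in> carrier G \<Longrightarrow> h \<in> carrier G \<Longrightarrow> map (act g) (map (act h) \<sigma>) = map (act (g \<otimes> h)) \<sigma>"
  by (simp add: act_mult)

lemma map_act_inv: "g \<in> carrier G \<Longrightarrow> map (act g) \<sigma> = \<tau> \<Longrightarrow> map (act (inv g)) \<tau> = \<sigma>"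
  by (auto simp: act_inv comp_def)

lemma seg_mv: "seg l (mv g v) = map (act g) (seg l v)"
  by (simp add: seg_def mv_def)

lemma stab_seg_eq: "stab_seg G act l v = Stab (seg l v)"
  by (auto simp: stab_seg_def Stab_def seg_def less_Suc_eq_le)

lemma Stab_sub: "Stab \<sigma> \<subseteq> carrier G"
  by (auto simp: Stab_def)

lemma rep_ex: "\<exists>g\<in>carrier G. map (act g) \<sigma> = rep \<sigma>"
  unfolding rep_def by (rule someI_ex) auto

lemma to_rep: "to_rep \<sigma> \<in> carrier G" "map (act (to_rep \<sigma>)) \<sigma> = rep \<sigma>"
proof -
  have "\<exists>g. g \<in> carrier G \<and> map (act g) \<sigma> = rep \<sigma>" using rep_ex by blast
  from someI_ex[OF this] show "to_rep \<sigma> \<in> carrier G" "map (act (to_rep \<sigma>)) \<sigma> = rep \<sigma>"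
    unfolding to_rep_def by auto
qed

lemma rep_invariant:
  assumes g: "g \<in> carrier G"
  shows "rep (map (act g) \<sigma>) = rep \<sigma>"
proof -
  have "(\<exists>h\<in>carrier G. map (act h) (map (act g) \<sigma>) = \<tau>) \<longleftrightarrow> (\<exists>h\<in>carrier G. map (act h) \<sigma> = \<tau>)" for \<tau>
  proof
    assume "\<exists>h\<in>carrier G. map (act h) (map (act g) \<sigma>) = \<tau>"
    then show "\<exists>h\<in>carrier G. map (act h) \<sigma> = \<tau>" using g map_act_mult by (metis m_closed)
  next
    assume "\<exists>h\<in>carrier G. map (act h) \<sigma> = \<tau>"
    then obtain h where h: "h \<in> carrier G" "map (act h) \<sigma> = \<tau>" by blast
    have "map (act (h \<otimes> inv g)) (map (act g) \<sigma>) = map (act (h \<otimes> inv g \<otimes> g)) \<sigma>"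
      using g h by (intro map_act_mult) auto
    also have "h \<otimes> inv g \<otimes> g = h" using g h by (simp add: m_assoc)
    finally show "\<exists>h\<in>carrier G. map (act h) (map (act g) \<sigma>) = \<tau>"
      using g h by (intro bexI[of _ "h \<otimes> inv g"]) auto
  qed
  then show ?thesis unfolding rep_def by simp
qed

text \<open>Right multiplication by g turns movers of \<open>mv g v\<close> into movers of v, with
  the same resulting geodesic; right multiplication by the inverse goes back.\<close>

lemma moved_invariant:
  assumes g: "g \<in> carrier G"
  shows "moved (mv g v) l = moved v l"
proof -
  have 1: "a \<otimes> g \<in> movers v l \<and> mv a (mv g v) = mv (a \<otimes> g) v" if "a \<in> movers (mv g v) l" for a
    using that g map_act_mult[of a g "seg l v"]
    by (auto simp: movers_def seg_mv rep_invariant mv_mult simp del: map_map)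
  have 2: "a \<otimes> inv g \<in> movers (mv g v) l \<and> mv a v = mv (a \<otimes> inv g) (mv g v)" if "a \<in> movers v l" for a
  proof -
    have a: "a \<in> carrier G" using that by (auto simp: movers_def)
    have e: "a \<otimes> inv g \<otimes> g = a" using a g by (simp add: m_assoc)
    have "mv (a \<otimes> inv g) (mv g v) = mv a v" using mv_mult[of "a \<otimes> inv g" g v] a g e by simp
    moreover have "map (act (a \<otimes> inv g)) (map (act g) (seg l v)) = map (act a) (seg l v)"
      using map_act_mult[of "a \<otimes> inv g" g "seg l v"] a g e by simp
    ultimately show ?thesis
      using that a g by (simp add: movers_def seg_mv rep_invariant del: map_map)
  qed
  show ?thesis unfolding moved_def using 1 2 by (auto simp: image_iff) metis+
qed

lemma coamenable_invariant: "g \<in> carrier G \<Longrightarrow> coamenable (mv g v) l \<longleftrightarrow> coamenable v l"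
  by (simp add: coamenable_def moved_invariant seg_mv rep_invariant)

lemma movers_eq_Stab:
  assumes "a \<in> movers v l" "b \<in> movers v l"
  shows "a \<otimes> inv b \<in> Stab (rep (seg l v))"
proof -
  have c: "a \<in> carrier G" "b \<in> carrier G" using assms by (auto simp: movers_def)
  have "map (act (inv b)) (rep (seg l v)) = seg l v"
    using assms by (intro map_act_inv) (auto simp: movers_def)
  then have "map (act (a \<otimes> inv b)) (rep (seg l v)) = rep (seg l v)"
    using map_act_mult[of a "inv b" "rep (seg l v)"] c assms(1) by (simp add: movers_def)
  then show ?thesis using c by (simp add: Stab_def)
qed

lemma mv_coset:
  assumes z: "z \<in> carrier G" and "z' \<in> z <# stab_geo G act v"
  shows "z' \<in> carrier G" "mv z' v = mv z v"
proof -
  obtain k where k: "k \<in> stab_geo G act v" "z' = z \<otimes> k" using assms(2) by (auto simp: l_coset_def)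
  then have kc: "k \<in> carrier G" by (auto simp: stab_geo_def)
  show "z' \<in> carrier G" using k kc z by simp
  have "mv k v = v" using k by (auto simp: stab_geo_def mv_def)
  then show "mv z' v = mv z v" using k kc z by (simp add: mv_mult)
qed

text \<open>Conjugation by t carries the stabiliser of the segment to that of its representative,
  and the coset zK becomes the geodesic \<open>mv (t \<otimes> z) v\<close>. An almost invariant
  vector, approximated by a list and conjugated, thus acts almost invariantly on
  \<open>moved v l\<close>.\<close>

lemma coamenableI:
  assumes "unif_coamenable G (stab_seg G act l v) (stab_geo G act v)"
  shows "coamenable v l"
  unfolding coamenable_def
proof
  fix j
  define H where "H = Stab (seg l v)"
  define K where "K = stab_geo G act v"
  define t where "t = to_rep (seg l v)"
  define e where "e = 1 / real (Suc j)"
  have Hc: "H \<subseteq> carrier G" unfolding H_def by (rule Stab_sub)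
  have Kc: "K \<subseteq> carrier G" by (auto simp: K_def stab_geo_def)
  have "\<one> \<in> K" by (auto simp: K_def stab_geo_def act_one)
  have t: "t \<in> carrier G" "map (act t) (seg l v) = rep (seg l v)" unfolding t_def by (rule to_rep)+
  have ti: "map (act (inv t)) (rep (seg l v)) = seg l v" using t by (rule map_act_inv)
  have conj: "inv t \<otimes> s \<otimes> t \<in> H" if "s \<in> Stab (rep (seg l v))" for s
  proof -
    have s: "s \<in> carrier G" "map (act s) (rep (seg l v)) = rep (seg l v)" using that by (auto simp: Stab_def)
    have "map (act (inv t \<otimes> s \<otimes> t)) (seg l v) = map (act (inv t)) (map (act s) (map (act t) (seg l v)))"
      using s(1) t(1) by (simp only: map_act_mult inv_closed m_closed m_assoc)
    also have "\<dots> = seg l v" using s t ti by simp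
    finally show ?thesis using s t by (simp add: H_def Stab_def)
  qed
  define S where "S = (\<lambda>s. inv t \<otimes> s \<otimes> t) ` (nth_elt ` {..j} \<inter> Stab (rep (seg l v)))"
  have S: "finite S" "S \<subseteq> H" unfolding S_def using conj by auto
  \<comment> \<open>Half of e goes to the coamenability estimate; the other half to passing from p
    to a list, which is paid twice at e / 4.\<close>
  have "e / 2 > 0" by (simp add: e_def)
  then obtain p where p: "is_prob H p" and
    pS: "\<And>s y. s \<in> S \<Longrightarrow> y \<in> left_cosets_in G H K \<Longrightarrow>
      l1dist (coset_push G H p y) (coset_push G H p (s <# y)) < e / 2"
    using assms S unfolding unif_coamenable_def stab_seg_eq H_def[symmetric] K_def[symmetric] by meson
  have "e / 4 > 0" by (simp add: e_def)
  obtain xs where xs: "xs \<noteq> []" "set xs \<subseteq> H" "l1dist p (emp xs) < e / 4"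
    using is_prob_approx_emp[OF p \<open>e / 4 > 0\<close>] by blast
  define P where "P = map (\<lambda>h. t \<otimes> h \<otimes> inv t) xs"
  \<comment> \<open>Which element of the coset is chosen does not matter: elements of zK differ by
    something fixing v.\<close>
  define \<psi> where "\<psi> c = mv (t \<otimes> (SOME z. z \<in> c)) v" for c
  have \<psi>: "\<psi> (z <# K) = mv (t \<otimes> z) v" if z: "z \<in> carrier G" for z
  proof -
    have "z \<in> z <# K" using \<open>\<one> \<in> K\<close> z by (auto simp: l_coset_def intro!: bexI[of _ \<one>])
    then have "(SOME z'. z' \<in> z <# K) \<in> z <# K" by (rule someI)
    from mv_coset[OF z this[unfolded K_def]] show ?thesis
      using t z by (simp add: \<psi>_def mv_mult K_def)
  qed
  have "almost_inv (Stab (rep (seg l v))) (moved v l) j P"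
    unfolding almost_inv_def
  proof (intro conjI ballI)
    show "P \<noteq> []" using xs by (simp add: P_def)
    show "set P \<subseteq> Stab (rep (seg l v))"
    proof
      fix g assume "g \<in> set P"
      then obtain h where h: "h \<in> H" "g = t \<otimes> h \<otimes> inv t" using xs(2) by (auto simp: P_def)
      then have hc: "h \<in> carrier G" "map (act h) (seg l v) = seg l v" by (auto simp: H_def Stab_def)
      have "map (act (t \<otimes> h \<otimes> inv t)) (rep (seg l v)) = map (act t) (map (act h) (map (act (inv t)) (rep (seg l v))))"
        using hc(1) t(1) by (simp only: map_act_mult inv_closed m_closed m_assoc)
      also have "\<dots> = rep (seg l v)" using hc t ti by simp
      finally show "g \<in> Stab (rep (seg l v))" using h hc t by (simp add: Stab_def)
    qed
    fix s y assume s: "s \<in> nth_elt ` {..j} \<inter> Stab (rep (seg l v))" and "y \<in> moved v l"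
    then obtain a where a: "a \<in> movers v l" "y = mv a v" by (auto simp: moved_def)
    then have ac: "a \<in> carrier G" by (auto simp: movers_def)
    \<comment> \<open>The coset of h0 is the one that corresponds to y, and s0 is s conjugated back
      to the stabiliser of the original segment.\<close>
    define h0 where "h0 = inv t \<otimes> a"
    define s0 where "s0 = inv t \<otimes> s \<otimes> t"
    have sc: "s \<in> carrier G" using s Stab_sub by blast
    have s0: "s0 \<in> S" "s0 \<in> carrier G" using s sc t by (auto simp: S_def s0_def)
    have h0c: "h0 \<in> carrier G" using ac t by (simp add: h0_def)
    have "map (act (inv t)) (map (act a) (seg l v)) = seg l v" using a ti by (simp add: movers_def)
    then have h0: "h0 \<in> H" using h0c map_act_mult[of "inv t" a "seg l v"] ac t
      by (simp add: H_def Stab_def h0_def)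
    then have cos: "h0 <# K \<in> left_cosets_in G H K" by (auto simp: left_cosets_in_def)
    have assoc: "h <# (h0 <# K) = (h \<otimes> h0) <# K" "h <# (s0 <# (h0 <# K)) = (h \<otimes> (s0 \<otimes> h0)) <# K"
      if "h \<in> carrier G" for h
      using that h0c s0 Kc by (simp_all add: lcos_m_assoc)
    have e1: "map (\<lambda>h. mv h y) P = map (\<lambda>h. \<psi> (h <# (h0 <# K))) xs"
      unfolding P_def map_map
    proof (rule map_cong)
      fix h assume "h \<in> set xs"
      then have hc: "h \<in> carrier G" using xs(2) Hc by auto
      have "\<psi> (h <# (h0 <# K)) = mv (t \<otimes> (h \<otimes> h0)) v" using hc h0c assoc \<psi> by simp
      also have "t \<otimes> (h \<otimes> h0) = (t \<otimes> h \<otimes> inv t) \<otimes> a" using hc t ac by (simp add: h0_def m_assoc)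
      also have "mv \<dots> v = mv (t \<otimes> h \<otimes> inv t) y" unfolding a(2) using hc t ac by (intro mv_mult) auto
      finally show "((\<lambda>h. mv h y) \<circ> (\<lambda>h. t \<otimes> h \<otimes> inv t)) h = \<psi> (h <# (h0 <# K))" by simp
    qed simp
    have e2: "map (\<lambda>h. mv h (mv s y)) P = map (\<lambda>h. \<psi> (h <# (s0 <# (h0 <# K)))) xs"
      unfolding P_def map_map
    proof (rule map_cong)
      fix h assume "h \<in> set xs"
      then have hc: "h \<in> carrier G" using xs(2) Hc by auto
      have "\<psi> (h <# (s0 <# (h0 <# K))) = mv (t \<otimes> (h \<otimes> (s0 \<otimes> h0))) v" using hc h0c s0 assoc \<psi> by simp
      also have "t \<otimes> (h \<otimes> (s0 \<otimes> h0)) = (t \<otimes> h \<otimes> inv t) \<otimes> (s \<otimes> a)"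
      proof -
        have "s0 \<otimes> h0 = inv t \<otimes> (s \<otimes> (t \<otimes> (inv t \<otimes> a)))" using t ac sc by (simp add: s0_def h0_def m_assoc)
        also have "t \<otimes> (inv t \<otimes> a) = a" using t ac by (simp add: m_assoc[symmetric])
        finally show ?thesis using hc t ac sc by (simp add: m_assoc)
      qed
      also have "mv \<dots> v = mv (t \<otimes> h \<otimes> inv t) (mv (s \<otimes> a) v)" using hc t ac sc by (intro mv_mult) auto
      also have "mv (s \<otimes> a) v = mv s y" unfolding a(2) using ac sc by (intro mv_mult)
      finally show "((\<lambda>h. mv h (mv s y)) \<circ> (\<lambda>h. t \<otimes> h \<otimes> inv t)) h = \<psi> (h <# (s0 <# (h0 <# K)))" by simp
    qed simp
    have push_eq: "coset_push G H p y = push (\<lambda>h. h <# y) H p" for y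
      by (auto simp: coset_push_def push_def)
    have "l1dist (emp (map (\<lambda>h. mv h y) P)) (emp (map (\<lambda>h. mv h (mv s y)) P)) \<le>
        l1dist (coset_push G H p (h0 <# K)) (coset_push G H p (s0 <# (h0 <# K))) + 2 * l1dist p (emp xs)"
      unfolding e1 e2 push_eq by (rule l1dist_push_emp_le[OF p xs(1,2)])
    also have "\<dots> < e / 2 + 2 * (e / 4)" using pS[OF s0(1) cos] xs(3) by simp
    also have "\<dots> = e" by simp
    finally show "l1dist (emp (map (\<lambda>h. mv h y) P)) (emp (map (\<lambda>h. mv h (mv s y)) P)) < 1 / real (Suc j)"
      unfolding e_def .
  qed
  then show "\<exists>P. almost_inv (Stab (rep (seg l v))) (moved v l) j P" ..
qed

lemma mv_eq_measurable:
  "a \<in> carrier G \<Longrightarrow> b \<in> carrier G \<Longrightarrow> Measurable.pred (GeoM adj) (\<lambda>v. mv a v = mv b v)"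
proof -
  have [measurable]: "Measurable.pred (GeoM adj) (\<lambda>v. act a (v k) = act b (v k))" for k
    by (rule measurable_compose[OF coordinate_measurable]) simp
  have "(mv a v = mv b v) = (\<forall>k. act a (v k) = act b (v k))" for v by (auto simp: mv_def fun_eq_iff)
  then show ?thesis by simp
qed

lemma l1dist_emp_measurable:
  assumes "set P \<subseteq> carrier G" "set Q \<subseteq> carrier G"
  shows "(\<lambda>v. l1dist (emp (map (\<lambda>h. mv h v) P)) (emp (map (\<lambda>h. mv h v) Q))) \<in> borel_measurable (GeoM adj)"
proof -
  have ob: "(\<lambda>v. of_bool (mv a v = mv b v) :: real) \<in> borel_measurable (GeoM adj)"
    if "a \<in> set P \<union> set Q" "b \<in> set P \<union> set Q" for a b
    by (rule measurable_compose[OF mv_eq_measurable]) (use that assms in auto)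
  have cnt: "(\<lambda>v. (\<Sum>i<length R. of_bool (mv (R ! i) v = mv a v)) / real (length R)) \<in> borel_measurable (GeoM adj)"
    if "a \<in> set P \<union> set Q" "set R \<subseteq> set P \<union> set Q" for a R
    by (rule borel_measurable_divide[OF borel_measurable_sum[OF ob] borel_measurable_const])
       (use that in \<open>auto dest!: subsetD[OF _ nth_mem]\<close>)
  have mult: "(\<lambda>v. \<Sum>b\<in>set P \<union> set Q. of_bool (mv b v = mv a v) :: real) \<in> borel_measurable (GeoM adj)"
    if "a \<in> set P \<union> set Q" for a
    by (rule borel_measurable_sum[OF ob[OF _ that]])
  show ?thesis
    unfolding l1dist_emp_map_eq
  proof (rule borel_measurable_sum)
    fix a assume a: "a \<in> set P \<union> set Q"
    show "(\<lambda>v. \<bar>(\<Sum>i<length P. of_bool (mv (P ! i) v = mv a v)) / real (length P) -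
        (\<Sum>i<length Q. of_bool (mv (Q ! i) v = mv a v)) / real (length Q)\<bar> /
        (\<Sum>b\<in>set P \<union> set Q. of_bool (mv b v = mv a v))) \<in> borel_measurable (GeoM adj)"
      by (rule borel_measurable_divide[OF borel_measurable_abs[OF borel_measurable_diff[OF cnt[OF a] cnt[OF a]]] mult[OF a]]) auto
  qed
qed

lemma seg_measurable: "seg l \<in> GeoM adj \<rightarrow>\<^sub>M count_space UNIV"
proof (subst measurable_count_space_eq2_countable, intro conjI ballI)
  fix xs :: "'v list"
  have [measurable]: "Measurable.pred (GeoM adj) (\<lambda>v. v k = xs ! k)" for k
    by (rule measurable_compose[OF coordinate_measurable]) simp
  have "seg l -` {xs} \<inter> space (GeoM adj) =
      {v \<in> space (GeoM adj). length xs = Suc l \<and> (\<forall>k\<in>{..l}. v k = xs ! k)}"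
    by (auto simp: seg_def list_eq_iff_nth_eq simp del: upt_Suc)
  also have "\<dots> \<in> sets (GeoM adj)" by measurable
  finally show "seg l -` {xs} \<inter> space (GeoM adj) \<in> sets (GeoM adj)" .
qed auto

lemma pred_seg: "Measurable.pred (GeoM adj) (\<lambda>v. Q (seg l v))"
  by (rule measurable_compose[OF seg_measurable]) simp

text \<open>Enumerating the group turns the quantifier over \<open>moved v l\<close>, a set
  depending on v, into a countable conjunction. Its conditions involve only the segment, which has
  countably many values, and l1 distances of lists applied to a translate of v.\<close>

lemma almost_inv_measurable:
  assumes P: "set P \<subseteq> carrier G"
  shows "Measurable.pred (GeoM adj) (\<lambda>v. almost_inv (Stab (rep (seg l v))) (moved v l) j P)"
proof -
  have eq: "almost_inv (Stab (rep (seg l v))) (moved v l) j P \<longleftrightarrow>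
    (P \<noteq> [] \<and> set P \<subseteq> Stab (rep (seg l v))) \<and>
    (\<forall>i\<in>{..j}. nth_elt i \<in> Stab (rep (seg l v)) \<longrightarrow> (\<forall>k. map (act (nth_elt k)) (seg l v) = rep (seg l v) \<longrightarrow>
       l1dist (emp (map (\<lambda>h. mv h (mv (nth_elt k) v)) P))
         (emp (map (\<lambda>h. mv h (mv (nth_elt k) v)) (map (\<lambda>h. h \<otimes> nth_elt i) P))) < 1 / real (Suc j)))"
    (is "_ \<longleftrightarrow> ?A \<and> ?B") for v
  proof -
    have mm: "map (\<lambda>h. mv h (mv s y)) P = map (\<lambda>h. mv h y) (map (\<lambda>h. h \<otimes> s) P)" if "s \<in> carrier G" for s y
      using that P by (auto simp: mv_mult)
    have bm: "(\<forall>y\<in>moved v l. R y) \<longleftrightarrow> (\<forall>k. map (act (nth_elt k)) (seg l v) = rep (seg l v) \<longrightarrow> R (mv (nth_elt k) v))" for R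
    proof
      assume "\<forall>y\<in>moved v l. R y"
      then show "\<forall>k. map (act (nth_elt k)) (seg l v) = rep (seg l v) \<longrightarrow> R (mv (nth_elt k) v)"
        using nth_elt by (auto simp: moved_def movers_def)
    next
      assume R: "\<forall>k. map (act (nth_elt k)) (seg l v) = rep (seg l v) \<longrightarrow> R (mv (nth_elt k) v)"
      show "\<forall>y\<in>moved v l. R y"
      proof
        fix y assume "y \<in> moved v l"
        then obtain a where a: "a \<in> carrier G" "map (act a) (seg l v) = rep (seg l v)" "y = mv a v"
          by (auto simp: moved_def movers_def)
        obtain k where "nth_elt k = a" using nth_elt_surj[OF a(1)] ..
        then show "R y" using R a by blast
      qed
    qed
    have bi: "(\<forall>s\<in>nth_elt ` {..j} \<inter> H. R s) \<longleftrightarrow> (\<forall>i\<in>{..j}. nth_elt i \<in> H \<longrightarrow> R (nth_elt i))" for H R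
      by auto
    have "almost_inv (Stab (rep (seg l v))) (moved v l) j P \<longleftrightarrow> P \<noteq> [] \<and> set P \<subseteq> Stab (rep (seg l v)) \<and>
      (\<forall>i\<in>{..j}. nth_elt i \<in> Stab (rep (seg l v)) \<longrightarrow> (\<forall>y\<in>moved v l. l1dist (emp (map (\<lambda>h. mv h y) P))
        (emp (map (\<lambda>h. mv h y) (map (\<lambda>h. h \<otimes> nth_elt i) P))) < 1 / real (Suc j)))"
      unfolding almost_inv_def bi mm[OF nth_elt] by (rule refl)
    then show ?thesis unfolding bm by (simp only: conj_assoc)
  qed
  have [measurable]: "Measurable.pred (GeoM adj) (\<lambda>v. P \<noteq> [] \<and> set P \<subseteq> Stab (rep (seg l v)))"
    by (rule pred_seg)
  have [measurable]: "Measurable.pred (GeoM adj) (\<lambda>v. nth_elt i \<in> Stab (rep (seg l v)))" for i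
    by (rule pred_seg)
  have [measurable]: "Measurable.pred (GeoM adj) (\<lambda>v. map (act (nth_elt k)) (seg l v) = rep (seg l v))" for k
    by (rule pred_seg)
  have [measurable]: "(\<lambda>v. l1dist (emp (map (\<lambda>h. mv h (mv (nth_elt k) v)) P))
         (emp (map (\<lambda>h. mv h (mv (nth_elt k) v)) (map (\<lambda>h. h \<otimes> nth_elt i) P)))) \<in> borel_measurable (GeoM adj)" for k i
    by (rule measurable_compose[OF mv_measurable[OF nth_elt] l1dist_emp_measurable]) (use P nth_elt in auto)
  show ?thesis unfolding eq by measurable
qed

section \<open>Borel choice of the level and of the list\<close>

definition nth_list :: "nat \<Rightarrow> 'g list" where
  "nth_list = from_nat_into (lists (carrier G))"

lemma nth_list: "set (nth_list n) \<subseteq> carrier G"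
  using from_nat_into[of "lists (carrier G)" n] by (auto simp: nth_list_def)

lemma nth_list_surj:
  assumes "set P \<subseteq> carrier G"
  shows "\<exists>n. nth_list n = P"
  unfolding nth_list_def
  by (rule from_nat_into_surj) (use assms countable_carrier in \<open>auto simp: countable_lists\<close>)

lemma almost_inv_carrier: "almost_inv (Stab \<sigma>) Y j P \<Longrightarrow> set P \<subseteq> carrier G"
  using Stab_sub by (auto simp: almost_inv_def)

lemma almost_inv_ex_iff:
  "(\<exists>P. almost_inv (Stab \<sigma>) Y j P) \<longleftrightarrow> (\<exists>n. almost_inv (Stab \<sigma>) Y j (nth_list n))"
proof
  assume "\<exists>P. almost_inv (Stab \<sigma>) Y j P"
  then obtain P where P: "almost_inv (Stab \<sigma>) Y j P" ..
  obtain n where "nth_list n = P" using nth_list_surj[OF almost_inv_carrier[OF P]] ..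
  then show "\<exists>n. almost_inv (Stab \<sigma>) Y j (nth_list n)" using P by blast
qed blast

text \<open>Invariant under the group, but dependent on the starting vertex of v. The value is
  meaningful only where some level is coamenable, which the hypothesis ensures for all
  geodesics.\<close>

definition lev :: "(nat \<Rightarrow> 'v) \<Rightarrow> nat" where
  "lev v = (LEAST l. coamenable v l)"

definition index :: "nat \<Rightarrow> (nat \<Rightarrow> 'v) \<Rightarrow> nat" where
  "index j v = (LEAST n. almost_inv (Stab (rep (seg (lev v) v))) (moved v (lev v)) j (nth_list n))"

text \<open>Applied to v, these elements give the almost invariant list applied to the translate of
  v whose initial segment is the representative.\<close>

definition elts :: "nat \<Rightarrow> (nat \<Rightarrow> 'v) \<Rightarrow> 'g list" where
  "elts j v = map (\<lambda>h. h \<otimes> to_rep (seg (lev v) v)) (nth_list (index j v))"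

lemma lev_measurable: "lev \<in> GeoM adj \<rightarrow>\<^sub>M count_space UNIV"
proof -
  have eq: "coamenable v l \<longleftrightarrow> (\<forall>j. \<exists>n. almost_inv (Stab (rep (seg l v))) (moved v l) j (nth_list n))" for v l
    unfolding coamenable_def almost_inv_ex_iff by (rule refl)
  have [measurable]: "Measurable.pred (GeoM adj) (\<lambda>v. almost_inv (Stab (rep (seg l v))) (moved v l) j (nth_list n))" for l j n
    by (rule almost_inv_measurable[OF nth_list])
  have "Measurable.pred (GeoM adj) (\<lambda>v. coamenable v l)" for l unfolding eq by measurable
  then show ?thesis unfolding lev_def by (rule measurable_Least)
qed

lemma index_measurable: "index j \<in> GeoM adj \<rightarrow>\<^sub>M count_space UNIV"
  unfolding index_def
proof (rule measurable_Least)
  fix n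
  show "Measurable.pred (GeoM adj) (\<lambda>v. almost_inv (Stab (rep (seg (lev v) v))) (moved v (lev v)) j (nth_list n))"
    by (rule measurable_compose_countable[where f = "\<lambda>l v. almost_inv (Stab (rep (seg l v))) (moved v l) j (nth_list n)",
          OF almost_inv_measurable[OF nth_list] lev_measurable])
qed

text \<open>The type of group elements is not assumed countable. With the lists over the countable
  carrier as target, splitting according to the value becomes a countable case distinction.\<close>

lemma elts_measurable: "elts j \<in> GeoM adj \<rightarrow>\<^sub>M count_space (lists (carrier G))"
proof -
  have s: "(\<lambda>v. seg (lev v) v) \<in> GeoM adj \<rightarrow>\<^sub>M count_space UNIV"
    by (rule measurable_compose_countable[where f = seg, OF seg_measurable lev_measurable])
  show ?thesis
    unfolding elts_def
  proof (rule measurable_compose_countable[where f = "\<lambda>n v. map (\<lambda>h. h \<otimes> to_rep (seg (lev v) v)) (nth_list n)", OF _ index_measurable])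
    fix n
    have "(\<lambda>\<sigma>. map (\<lambda>h. h \<otimes> to_rep \<sigma>) (nth_list n)) \<in> count_space UNIV \<rightarrow>\<^sub>M count_space (lists (carrier G))"
      using nth_list[of n] to_rep(1) by (auto simp: subset_iff)
    from measurable_compose[OF s this]
    show "(\<lambda>v. map (\<lambda>h. h \<otimes> to_rep (seg (lev v) v)) (nth_list n)) \<in> GeoM adj \<rightarrow>\<^sub>M count_space (lists (carrier G))" .
  qed
qed

lemma elts_carrier: "set (elts j v) \<subseteq> carrier G"
  using nth_list[of "index j v"] to_rep(1) by (auto simp: elts_def)

lemma lev_invariant: "g \<in> carrier G \<Longrightarrow> lev (mv g v) = lev v"
  by (simp add: lev_def coamenable_invariant)

lemma index_invariant: "g \<in> carrier G \<Longrightarrow> index j (mv g v) = index j v"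
  by (simp add: index_def lev_invariant moved_invariant seg_mv rep_invariant)

lemma index_almost_inv:
  assumes "\<exists>l. coamenable v l"
  shows "almost_inv (Stab (rep (seg (lev v) v))) (moved v (lev v)) j (nth_list (index j v))"
proof -
  have "coamenable v (lev v)" unfolding lev_def using assms by (rule LeastI_ex)
  then have "\<exists>n. almost_inv (Stab (rep (seg (lev v) v))) (moved v (lev v)) j (nth_list n)"
    unfolding coamenable_def almost_inv_ex_iff by blast
  then show ?thesis unfolding index_def by (rule LeastI_ex)
qed

lemma elts_nonempty: "\<exists>l. coamenable v l \<Longrightarrow> elts j v \<noteq> []"
  using index_almost_inv[of v j] by (auto simp: elts_def almost_inv_def)

lemma map_mv_elts: "map (\<lambda>a. mv a v) (elts j v) = map (\<lambda>h. mv h (mv (to_rep (seg (lev v) v)) v)) (nth_list (index j v))"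
  using nth_list[of "index j v"] to_rep(1) by (auto simp: elts_def mv_mult)

lemma to_rep_mover: "to_rep (seg l v) \<in> movers v l"
  using to_rep by (simp add: movers_def)

text \<open>Both lists are the same almost invariant list applied to two points of a single stabiliser orbit.\<close>

lemma elts_close:
  assumes co: "\<exists>l. coamenable v l" and g: "g \<in> carrier G"
  shows "\<exists>j0. \<forall>j\<ge>j0. l1dist (emp (map (\<lambda>a. mv a v) (elts j v))) (emp (map (\<lambda>a. mv a (mv g v)) (elts j (mv g v))))
    < 1 / real (Suc j)"
proof -
  define l where "l = lev v"
  define t where "t = to_rep (seg l v)"
  \<comment> \<open>Both t and t' are movers of v itself, so the translates obtained from v and from
    \<open>mv g v\<close> differ by an element s of the stabiliser of the representative.\<close>
  define t' where "t' = to_rep (seg l (mv g v)) \<otimes> g"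
  have t: "t \<in> movers v l" unfolding t_def by (rule to_rep_mover)
  have c: "t \<in> carrier G" "to_rep (seg l (mv g v)) \<in> carrier G" unfolding t_def by (rule to_rep)+
  have "map (act (to_rep (seg l (mv g v)))) (map (act g) (seg l v)) = rep (seg l v)"
    using to_rep(2)[of "seg l (mv g v)"] g by (simp only: seg_mv rep_invariant)
  then have t': "t' \<in> movers v l"
    using map_act_mult[OF c(2) g, of "seg l v"] c g by (simp add: movers_def t'_def del: map_map)
  define s where "s = t' \<otimes> inv t"
  have s: "s \<in> Stab (rep (seg l v))" unfolding s_def by (rule movers_eq_Stab[OF t' t])
  have sc: "s \<in> carrier G" using s Stab_sub by blast
  have t'c: "t' \<in> carrier G" using c g by (simp add: t'_def)
  have "s \<otimes> t = t'" using c t'c by (simp add: s_def m_assoc)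
  then have st: "mv s (mv t v) = mv t' v" using mv_mult[OF sc c(1), of v] by simp
  have y: "mv t v \<in> moved v l" using t by (auto simp: moved_def)
  \<comment> \<open>From the position of s in the enumeration on, s is among the tested
    elements.\<close>
  obtain j0 where j0: "nth_elt j0 = s" using nth_elt_surj[OF sc] ..
  have "l1dist (emp (map (\<lambda>a. mv a v) (elts j v))) (emp (map (\<lambda>a. mv a (mv g v)) (elts j (mv g v)))) < 1 / real (Suc j)"
    if "j \<ge> j0" for j
  proof -
    have "s \<in> nth_elt ` {..j} \<inter> Stab (rep (seg l v))" using s j0 that by auto
    then have "l1dist (emp (map (\<lambda>h. mv h (mv t v)) (nth_list (index j v))))
        (emp (map (\<lambda>h. mv h (mv s (mv t v))) (nth_list (index j v)))) < 1 / real (Suc j)"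
      using index_almost_inv[OF co, of j] y unfolding almost_inv_def l_def[symmetric] by blast
    moreover have "mv (to_rep (seg (lev (mv g v)) (mv g v))) (mv g v) = mv t' v"
      using c g by (simp add: t'_def mv_mult lev_invariant l_def)
    then have "map (\<lambda>a. mv a (mv g v)) (elts j (mv g v)) = map (\<lambda>h. mv h (mv t' v)) (nth_list (index j v))"
      by (simp only: map_mv_elts index_invariant[OF g])
    moreover have "map (\<lambda>a. mv a v) (elts j v) = map (\<lambda>h. mv h (mv t v)) (nth_list (index j v))"
      by (simp add: map_mv_elts t_def l_def)
    ultimately show ?thesis by (simp add: st)
  qed
  then show ?thesis by blast
qed

end

text \<open>Moving the window by one step exchanges a single summand for another, and two
  probability vectors are at distance at most 2.\<close>

lemma l1dist_sum_shift_le: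
  assumes c: "\<And>k. is_prob A (c k)"
  shows "l1dist (\<lambda>z. \<Sum>k\<le>i. c k z) (\<lambda>z. \<Sum>k\<le>i. c (k + n) z) \<le> 2 * real n"
proof (induction n)
  case 0
  show ?case by (simp add: l1dist_def)
next
  case (Suc n)
  have s: "(\<lambda>z. \<Sum>k\<le>i. c (k + n) z) summable_on UNIV" for n
    by (intro summable_on_sum_real is_prob_summable[OF c]) auto
  have "(\<Sum>k\<le>i. c (k + n) z) - (\<Sum>k\<le>i. c (k + Suc n) z) = c n z - c (Suc i + n) z" for z
    by (induction i) auto
  then have "l1dist (\<lambda>z. \<Sum>k\<le>i. c (k + n) z) (\<lambda>z. \<Sum>k\<le>i. c (k + Suc n) z) = l1dist (c n) (c (Suc i + n))"
    by (simp add: l1dist_def)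
  also have "\<dots> \<le> 2" by (rule l1dist_le_2[OF c c])
  finally have "l1dist (\<lambda>z. \<Sum>k\<le>i. c (k + n) z) (\<lambda>z. \<Sum>k\<le>i. c (k + Suc n) z) \<le> 2" .
  moreover have "l1dist (\<lambda>z. \<Sum>k\<le>i. c k z) (\<lambda>z. \<Sum>k\<le>i. c (k + Suc n) z) \<le>
     l1dist (\<lambda>z. \<Sum>k\<le>i. c k z) (\<lambda>z. \<Sum>k\<le>i. c (k + n) z) +
     l1dist (\<lambda>z. \<Sum>k\<le>i. c (k + n) z) (\<lambda>z. \<Sum>k\<le>i. c (k + Suc n) z)"
    using s[of 0] by (intro l1dist_triangle s) simp
  ultimately show ?case using Suc by simp
qed

section \<open>Averaged measures on the orbits of ends\<close>

context tree_action
begin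

text \<open>The geodesic v only selects the group elements; they act on \<xi>, so the measure lives
  on the orbit of \<xi> wherever v starts.\<close>

definition elts_prob :: "nat \<Rightarrow> (nat \<Rightarrow> 'v) set \<Rightarrow> (nat \<Rightarrow> 'v) \<Rightarrow> (nat \<Rightarrow> 'v) set \<Rightarrow> real" where
  "elts_prob j \<xi> v = emp (map (\<lambda>a. bdry_act act a \<xi>) (elts j v))"

text \<open>Averaging over the starting point along the ray absorbs the shift.\<close>

definition avg_prob :: "nat \<Rightarrow> nat \<Rightarrow> (nat \<Rightarrow> 'v) set \<Rightarrow> (nat \<Rightarrow> 'v) set \<Rightarrow> real" where
  "avg_prob i j \<xi> \<eta> = 1 / real (Suc i) * (\<Sum>n\<le>i. elts_prob j \<xi> (\<lambda>k. ray \<xi> (k + n)) \<eta>)"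

lemma is_prob_elts_prob:
  assumes "\<xi> \<in> boundary adj" "\<exists>l. coamenable v l"
  shows "is_prob (E `` {\<xi>}) (elts_prob j \<xi> v)"
  unfolding elts_prob_def
  by (rule is_prob_emp)
     (use assms elts_nonempty[of v j] elts_carrier[of j v] in
       \<open>auto simp: orbit_rel_bdry_def bdry_act_boundary subset_iff\<close>)

text \<open>Passing from geodesics to their ends is a push-forward and cannot increase the distance,
  so the estimate for lists of geodesics carries over.\<close>

lemma elts_prob_close:
  assumes \<xi>: "\<xi> \<in> boundary adj" and v: "v \<in> \<xi>" and co: "\<exists>l. coamenable v l" and g: "g \<in> carrier G" and "\<epsilon> > 0"
  shows "\<forall>\<^sub>F j in sequentially. l1dist (elts_prob j \<xi> v) (elts_prob j (bdry_act act g \<xi>) (mv g v)) < \<epsilon>"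
proof -
  have vG: "v \<in> Geo adj" and ev: "endpt v = \<xi>" using in_boundaryD[OF \<xi> v] by auto
  obtain j0 where j0: "\<forall>j\<ge>j0. l1dist (emp (map (\<lambda>a. mv a v) (elts j v)))
      (emp (map (\<lambda>a. mv a (mv g v)) (elts j (mv g v)))) < 1 / real (Suc j)"
    using elts_close[OF co g] ..
  have eq: "elts_prob j (endpt w) w = emp (map endpt (map (\<lambda>a. mv a w) (elts j w)))" if "w \<in> Geo adj" for j w
  proof -
    have "map (\<lambda>a. bdry_act act a (endpt w)) (elts j w) = map endpt (map (\<lambda>a. mv a w) (elts j w))"
      using elts_carrier[of j w] that by (auto simp: bdry_act_endpt)
    then show ?thesis unfolding elts_prob_def by (rule arg_cong)
  qed
  have gG: "mv g v \<in> Geo adj" using g vG by (rule mv_Geo)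
  have "\<forall>\<^sub>F j in sequentially. 1 / real (Suc j) < \<epsilon>"
    using order_tendstoD(2)[OF LIMSEQ_Suc[OF lim_inverse_n'] \<open>\<epsilon> > 0\<close>] .
  then show ?thesis using eventually_ge_at_top[of j0]
  proof eventually_elim
    case (elim j)
    have "l1dist (elts_prob j \<xi> v) (elts_prob j (bdry_act act g \<xi>) (mv g v)) =
        l1dist (elts_prob j (endpt v) v) (elts_prob j (endpt (mv g v)) (mv g v))"
      using bdry_act_endpt[OF g vG] ev by simp
    also have "\<dots> \<le> l1dist (emp (map (\<lambda>a. mv a v) (elts j v))) (emp (map (\<lambda>a. mv a (mv g v)) (elts j (mv g v))))"
      unfolding eq[OF vG] eq[OF gG] by (rule l1dist_emp_map_le)
    also have "\<dots> < \<epsilon>" using j0 elim by (meson less_trans)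
    finally show ?case .
  qed
qed

lemma shift_in_class:
  assumes "\<xi> \<in> boundary adj" "v \<in> \<xi>"
  shows "(\<lambda>k. v (k + n)) \<in> \<xi>"
proof -
  have v: "v \<in> Geo adj" "endpt v = \<xi>" using in_boundaryD[OF assms] by auto
  have "(v, \<lambda>k. v (k + n)) \<in> shift_rel adj"
    by (rule shift_relI[OF v(1) Geo_shift[OF v(1)], where m = n and n = 0]) simp
  then show ?thesis using v(2) by (auto simp: endpt_def)
qed

text \<open>On each of the countably many sets where the list of elements is constant, the value
  counts how many of them take \<xi> to \<eta>, and equality of ends is a Borel condition.\<close>

lemma avg_prob_measurable: "(\<lambda>(\<xi>, \<eta>). avg_prob i j \<xi> \<eta>) \<in> borel_measurable (boundaryM adj \<Otimes>\<^sub>M boundaryM adj)"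
proof -
  interpret cber_maps "boundaryM adj" "\<lambda>k. bdry_act act (nth_elt k)" sep_set E
    by (rule cber_maps_boundary)
  let ?N = "boundaryM adj \<Otimes>\<^sub>M boundaryM adj"
  have eqm: "Measurable.pred ?N (\<lambda>w. bdry_act act a (fst w) = snd w)" if "a \<in> carrier G" for a
    by (rule pred_eq[OF measurable_compose[OF measurable_fst bdry_act_measurable[OF that]] measurable_snd])
  have "(\<lambda>w. elts_prob j (fst w) (\<lambda>k. ray (fst w) (k + n)) (snd w)) \<in> borel_measurable ?N" for n
    unfolding elts_prob_def
  proof (rule measurable_compose_countable'[where I = "lists (carrier G)" and
        f = "\<lambda>P w. emp (map (\<lambda>a. bdry_act act a (fst w)) P) (snd w)"])
    show "(\<lambda>w. elts j (\<lambda>k. ray (fst w) (k + n))) \<in> ?N \<rightarrow>\<^sub>M count_space (lists (carrier G))"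
      using measurable_compose[OF measurable_fst
          measurable_compose[OF ray_measurable measurable_compose[OF shift_measurable elts_measurable]]] .
    show "countable (lists (carrier G))" using countable_carrier by (rule countable_lists)
    fix P assume P: "P \<in> lists (carrier G)"
    have "(\<lambda>w. of_bool (bdry_act act (P ! k) (fst w) = snd w) :: real) \<in> borel_measurable ?N"
      if "k \<in> {..<length P}" for k
      by (rule measurable_compose[OF eqm]) (use P that nth_mem[of k P] in auto)
    then show "(\<lambda>w. emp (map (\<lambda>a. bdry_act act a (fst w)) P) (snd w)) \<in> borel_measurable ?N"
      unfolding emp_def count_list_map_nth of_nat_sum of_nat_of_bool length_map
      by (intro borel_measurable_divide borel_measurable_sum borel_measurable_const)
  qed
  then have "(\<lambda>w. 1 / real (Suc i) * (\<Sum>n\<le>i. elts_prob j (fst w) (\<lambda>k. ray (fst w) (k + n)) (snd w))) \<in> borel_measurable ?N"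
    by (intro borel_measurable_times borel_measurable_sum borel_measurable_const)
  then show ?thesis by (simp only: avg_prob_def case_prod_unfold)
qed

theorem boundary_borel_2_amenable:
  assumes co: "\<And>v. v \<in> Geo adj \<Longrightarrow> \<exists>l. coamenable v l"
  shows "borel_2_amenable (boundaryM adj) E"
  unfolding borel_2_amenable_def
proof (intro exI[of _ avg_prob] conjI allI ballI)
  have co_ray: "\<exists>l. coamenable (\<lambda>k. ray \<xi> (k + n)) l" if "\<xi> \<in> boundary adj" for \<xi> n
    by (rule co[OF Geo_shift[OF ray_Geo[OF that]]])
  have prob_q: "is_prob (E `` {\<xi>}) (elts_prob j \<xi> (\<lambda>k. ray \<xi> (k + n)))" if "\<xi> \<in> boundary adj" for \<xi> j n
    by (rule is_prob_elts_prob[OF that co_ray[OF that]])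
  show "is_prob (E `` {\<xi>}) (avg_prob i j \<xi>)" if "\<xi> \<in> space (boundaryM adj)" for i j \<xi>
  proof -
    have \<xi>: "\<xi> \<in> boundary adj" using that by (simp add: space_boundaryM)
    have "((\<lambda>\<eta>. \<Sum>n\<le>i. elts_prob j \<xi> (\<lambda>k. ray \<xi> (k + n)) \<eta>) has_sum (\<Sum>n\<le>i. 1)) (E `` {\<xi>})"
      using prob_q[OF \<xi>] by (intro has_sum_sum_real) (auto simp: is_prob_def)
    from has_sum_cmult_right[OF this, of "1 / real (Suc i)"]
    have "(avg_prob i j \<xi> has_sum 1) (E `` {\<xi>})" by (simp add: avg_prob_def[abs_def])
    moreover have "0 \<le> avg_prob i j \<xi> \<eta>" for \<eta>
      unfolding avg_prob_def using prob_q[OF \<xi>] by (intro mult_nonneg_nonneg sum_nonneg) (auto simp: is_prob_def)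
    moreover have "avg_prob i j \<xi> \<eta> = 0" if "\<eta> \<notin> E `` {\<xi>}" for \<eta>
    proof -
      have "elts_prob j \<xi> (\<lambda>k. ray \<xi> (k + n)) \<eta> = 0" for n
        using prob_q[OF \<xi>, of j n] that unfolding is_prob_def by blast
      then show ?thesis unfolding avg_prob_def by simp
    qed
    ultimately show ?thesis unfolding is_prob_def by blast
  qed
  show "(\<lambda>(\<xi>, \<eta>). avg_prob i j \<xi> \<eta>) \<in> borel_measurable (restrict_space (boundaryM adj \<Otimes>\<^sub>M boundaryM adj) E)" for i j
    by (rule measurable_restrict_space1[OF avg_prob_measurable])
  fix x assume "x \<in> E"
  then obtain \<xi> \<eta> g where x: "x = (\<xi>, \<eta>)" and b: "\<xi> \<in> boundary adj" "\<eta> \<in> boundary adj"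
    and g: "g \<in> carrier G" "bdry_act act g \<xi> = \<eta>"
    by (auto simp: orbit_rel_bdry_def)
  define v where "v = ray \<xi>"
  define w where "w = ray \<eta>"
  have v: "v \<in> \<xi>" "v \<in> Geo adj" unfolding v_def using b ray_in ray_Geo by auto
  have w: "w \<in> \<eta>" "w \<in> Geo adj" unfolding w_def using b ray_in ray_Geo by auto
  have "endpt (mv g v) = \<eta>" using bdry_act_eq[OF g(1) b(1)] g(2) by (simp add: v_def)
  moreover have "endpt w = \<eta>" using in_boundaryD[OF b(2) w(1)] by simp
  ultimately have "(w, mv g v) \<in> shift_rel adj" using endpt_eq_iff[OF w(2) mv_Geo[OF g(1) v(2)]] by simp
  \<comment> \<open>The ray of \<eta> and the translate by g of the ray of \<xi> represent the same
    end; m and n are the lengths to cut off until they coincide.\<close>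
  then obtain m n where mn: "\<forall>k. w (k + m) = mv g v (k + n)" using shift_relD by blast
  have tail: "(\<lambda>k'. w (k' + (k + m))) = mv g (\<lambda>k'. v (k' + (k + n)))" for k
  proof
    fix k'
    show "w (k' + (k + m)) = mv g (\<lambda>k'. v (k' + (k + n))) k'"
      using mn[rule_format, of "k' + k"] by (simp add: mv_def add.assoc)
  qed
  define c where "c j k = elts_prob j \<xi> (\<lambda>k'. v (k' + k))" for j k
  define d where "d j k = elts_prob j \<eta> (\<lambda>k'. w (k' + k))" for j k
  have c: "is_prob (E `` {\<xi>}) (c j k)" and d: "is_prob (E `` {\<eta>}) (d j k)" for j k
    unfolding c_def d_def v_def w_def using prob_q b by auto
  have close: "\<forall>\<^sub>F j in sequentially. l1dist (c j (k + n)) (d j (k + m)) < \<epsilon>" if "\<epsilon> > 0" for k \<epsilon>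
    using elts_prob_close[OF b(1) shift_in_class[OF b(1) v(1)] co[OF Geo_shift[OF v(2)]] g(1) that, of "k + n"]
    unfolding c_def d_def tail g(2) .
  \<comment> \<open>The window of \<open>c\<close> is moved by n and that of \<open>d\<close> by m,
    after which the terms refer to geodesics that differ by g and can be compared one by
    one.\<close>
  have bound: "l1dist (avg_prob i j \<xi>) (avg_prob i j \<eta>) \<le>
      1 / real (Suc i) * (2 * real n + 2 * real m + (\<Sum>k\<le>i. l1dist (c j (k + n)) (d j (k + m))))" for i j
  proof -
    let ?C = "\<lambda>n z. \<Sum>k\<le>i. c j (k + n) z" and ?D = "\<lambda>m z. \<Sum>k\<le>i. d j (k + m) z"
    have sC: "?C n summable_on UNIV" and sD: "?D n summable_on UNIV" for n
      by (intro summable_on_sum_real is_prob_summable[OF c] is_prob_summable[OF d]; simp)+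
    have "l1dist (?C 0) (?D 0) \<le> l1dist (?C 0) (?C n) + l1dist (?C n) (?D 0)"
      by (intro l1dist_triangle sC sD)
    also have "l1dist (?C n) (?D 0) \<le> l1dist (?C n) (?D m) + l1dist (?D m) (?D 0)"
      by (intro l1dist_triangle sC sD)
    also have "l1dist (?C 0) (?C n) \<le> 2 * real n" using l1dist_sum_shift_le[of "E `` {\<xi>}" "c j" i n, OF c] by simp
    also have "l1dist (?D m) (?D 0) \<le> 2 * real m"
      using l1dist_sum_shift_le[of "E `` {\<eta>}" "d j" i m, OF d] by (simp add: l1dist_commute)
    also have "l1dist (?C n) (?D m) \<le> (\<Sum>k\<le>i. l1dist (c j (k + n)) (d j (k + m)))"
      by (intro l1dist_sum_le is_prob_summable[OF c] is_prob_summable[OF d]) simp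
    finally have *: "l1dist (?C 0) (?D 0) \<le> 2 * real n + 2 * real m + (\<Sum>k\<le>i. l1dist (c j (k + n)) (d j (k + m)))"
      by simp
    have "l1dist (avg_prob i j \<xi>) (avg_prob i j \<eta>) = l1dist (\<lambda>z. 1 / real (Suc i) * ?C 0 z) (\<lambda>z. 1 / real (Suc i) * ?D 0 z)"
      by (simp only: avg_prob_def[abs_def] c_def d_def v_def w_def add_0_right)
    also have "\<dots> = 1 / real (Suc i) * l1dist (?C 0) (?D 0)" by (rule l1dist_scale) simp
    also have "\<dots> \<le> 1 / real (Suc i) * (2 * real n + 2 * real m + (\<Sum>k\<le>i. l1dist (c j (k + n)) (d j (k + m))))"
      using * by (intro mult_left_mono) auto
    finally show ?thesis .
  qed
  have "\<forall>\<^sub>F i in sequentially. \<forall>\<^sub>F j in sequentially. l1dist (avg_prob i j \<xi>) (avg_prob i j \<eta>) < \<epsilon>" if "\<epsilon> > 0" for \<epsilon>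
  proof -
    \<comment> \<open>The shift error does not involve j, so i settles it alone. For this fixed i
      only finitely many terms remain, and one large j makes all of them small.\<close>
    have "(\<lambda>i. (2 * real n + 2 * real m) * (1 / real (Suc i))) \<longlonglongrightarrow> (2 * real n + 2 * real m) * 0"
      by (intro tendsto_mult tendsto_const LIMSEQ_Suc[OF lim_inverse_n'])
    then have "\<forall>\<^sub>F i in sequentially. (2 * real n + 2 * real m) * (1 / real (Suc i)) < \<epsilon> / 2"
      using that by (intro order_tendstoD) auto
    then show ?thesis
    proof eventually_elim
      case (elim i)
      have "\<epsilon> / 2 > 0" using that by simp
      then have "\<forall>\<^sub>F j in sequentially. \<forall>k\<in>{..i}. l1dist (c j (k + n)) (d j (k + m)) < \<epsilon> / 2"
        by (intro eventually_ball_finite ballI close) auto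
      then show ?case
      proof eventually_elim
        case j: (elim j)
        have "(\<Sum>k\<le>i. l1dist (c j (k + n)) (d j (k + m))) \<le> (\<Sum>k\<le>i. \<epsilon> / 2)"
          using j by (intro sum_mono) (auto intro: less_imp_le)
        also have "\<dots> = real (Suc i) * (\<epsilon> / 2)" by simp
        finally have "1 / real (Suc i) * (\<Sum>k\<le>i. l1dist (c j (k + n)) (d j (k + m))) \<le> 1 / real (Suc i) * (real (Suc i) * (\<epsilon> / 2))"
          by (intro mult_left_mono) auto
        also have "\<dots> = \<epsilon> / 2" by (simp del: of_nat_Suc)
        finally have "1 / real (Suc i) * (\<Sum>k\<le>i. l1dist (c j (k + n)) (d j (k + m))) \<le> \<epsilon> / 2" .
        moreover have "l1dist (avg_prob i j \<xi>) (avg_prob i j \<eta>) \<le> (2 * real n + 2 * real m) * (1 / real (Suc i)) +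
            1 / real (Suc i) * (\<Sum>k\<le>i. l1dist (c j (k + n)) (d j (k + m)))"
          using bound[of i j] by (simp only: distrib_left distrib_right mult.commute)
        ultimately show ?case using elim by linarith
      qed
    qed
  qed
  then show "case x of (x, y) \<Rightarrow> \<forall>\<epsilon>>0. \<forall>\<^sub>F i in sequentially. \<forall>\<^sub>F j in sequentially. l1dist (avg_prob i j x) (avg_prob i j y) < \<epsilon>"
    unfolding x by simp
qed

end

theorem theorem4p6:
  fixes G :: "('g, 'b) monoid_scheme"
    and adj :: "'v::countable \<Rightarrow> 'v \<Rightarrow> bool"
    and act :: "'g \<Rightarrow> 'v \<Rightarrow> 'v"
  assumes "group G"
    and "countable (carrier G)"
    and "is_tree adj"
    and "tree_aut_action G adj act"
    and "\<forall>v. inf_geodesic adj v \<longrightarrow>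
            (\<exists>n. unif_coamenable G (stab_seg G act n v) (stab_geo G act v))"
  shows "borel_2_amenable (boundaryM adj) (orbit_rel_bdry G adj act) \<and>
         measure_hyperfinite (boundaryM adj) (orbit_rel_bdry G adj act)"
proof -
  \<comment> \<open>Any vertex may serve as the root, since the claim does not mention it.\<close>
  interpret tree_action adj undefined G act
    using assms by (intro tree_action.intro rooted_tree.intro tree_action_axioms.intro)
  have "\<exists>l. coamenable v l" if "v \<in> Geo adj" for v
    using assms(5) that coamenableI unfolding Geo_def by blast
  then have am: "borel_2_amenable (boundaryM adj) (orbit_rel_bdry G adj act)"
    by (rule boundary_borel_2_amenable)
  moreover have "measure_hyperfinite (boundaryM adj) (orbit_rel_bdry G adj act)"
    by (rule cber_maps.borel_2_amenable_imp_measure_hyperfinite[OF cber_maps_boundary am])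
  ultimately show ?thesis ..
qed

end
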